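(* Let $G$ be a connected Banach-Lie group with Banach-Lie algebra $\mathfrak{g}$, equipped with a compatible norm $\|\cdot\|$. For $g\in G$ define the exponential length $$\mathrm{el}_G(g):=\inf\left\{\sum_{i=1}^n\|X_i\| \;\middle|\; n\in\mathbb{N},\ X_1,\dots,X_n\in\mathfrak{g},\ g=\exp(X_1)\cdots\exp(X_n)\right\}.$$ Then $\mathrm{el}_G$ is a compatible length function on $G$, and the left-invariant metric $d_G(g,h):=\mathrm{el}_G(g^{-1}h)$ is both maximal (so it defines the quasi-isometry type of $G$) and minimal. Thus $\mathrm{el}_G$ defines a global Lipschitz geometric structure on $G$.
   Context: A Banach-Lie group is a Hausdorff topological group that is a smooth Banach manifold (modelled on a real or complex Banach space) with smooth group operations. Its Banach-Lie algebra $\mathfrak{g}$ is the tangent space at the identity, with exponential map $\exp:\mathfrak{g}\to G$; a norm on $\mathfrak{g}$ is compatible if it induces the Banach space topology of $\mathfrak{g}$. A length function on a group $G$ is $\ell:G\to[0,\infty)$ with $\ell(g)=0$ iff $g=1_G$, $\ell(g)=\ell(g^{-1})$, $\ell(gh)\le\ell(g)+\ell(h)$; it corresponds to the left-invariant metric $(g,h)\mapsto\ell(g^{-1}h)$. It (or the metric) is compatible if the metric induces the topology of $G$. On the set $\mathcal{P}$ of continuous left-invariant pseudometrics on $G$ write $d\ll p$ if there are constants $K,L>0$ with $d\le Kp+L$. An element $d\in\mathcal{P}$ is maximal if it is a maximal element for $\ll$ (equivalently, $p\ll d$ for all $p\in\mathcal{P}$). Any two maximal pseudometrics are quasi-isometric,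 and a maximal one is said to define the quasi-isometry type of $G$. A left-invariant metric $d$ on $G$ is minimal if it is compatible and for every compatible left-invariant metric $\partial$ on $G$ the identity map $(G,\partial)\to(G,d)$ is Lipschitz on some neighborhood of the identity. A compatible left-invariant metric that is both maximal and minimal is said to define a global Lipschitz geometric structure on $G$. *)

theory Defs
  imports "HOL-Analysis.Analysis" "HOL-Algebra.Group"
begin

section \<open>Smooth maps between Banach spaces\<close>

text \<open>
  A map of type \<open>'a list \<Rightarrow> 'b\<close>, read on lists of length \<open>k\<close>, represents a \<open>k\<close>-linear map;
  its values on lists of other lengths are ignored.
\<close>

definition bounded_multilinear ::
    "nat \<Rightarrow> ('a::real_normed_vector list \<Rightarrow> 'b::real_normed_vector) \<Rightarrow> bool" where
  "bounded_multilinear k m \<longleftrightarrow>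
     (\<forall>vs i. length vs = k \<and> i < k \<longrightarrow> linear (\<lambda>v. m (vs[i := v]))) \<and>
     (\<exists>C. \<forall>vs. length vs = k \<longrightarrow> norm (m vs) \<le> C * (\<Prod>v\<leftarrow>vs. norm v))"

text \<open>
  \<open>f\<close> is \<open>C\<^sup>\<infinity>\<close> in the Frechet sense on the open set \<open>S\<close>. On lists of length \<open>k\<close>, \<open>D x\<close> is the
  \<open>k\<close>-th derivative of \<open>f\<close> at \<open>x\<close>. The last clause says that \<open>x \<mapsto> D\<^sup>kf(x)\<close>, as a map into the
  bounded \<open>k\<close>-linear maps with the operator norm, has Frechet derivative
  \<open>h \<mapsto> D\<^sup>k\<^sup>+\<^sup>1f(x)(h, \<dots>)\<close>. (The spaces of \<open>k\<close>-linear maps are different types for different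
  \<open>k\<close> when built by iterating \<open>blinfun\<close>, which is why the operator-norm estimate is spelled out.)
\<close>

definition smooth_on :: "'a::real_normed_vector set \<Rightarrow> ('a \<Rightarrow> 'b::real_normed_vector) \<Rightarrow> bool" where
  "smooth_on S f \<longleftrightarrow> open S \<and>
     (\<exists>D :: 'a \<Rightarrow> 'a list \<Rightarrow> 'b.
        (\<forall>x\<in>S. D x [] = f x) \<and>
        (\<forall>k. \<forall>x\<in>S. bounded_multilinear k (D x)) \<and>
        (\<forall>k. \<forall>x\<in>S. \<forall>\<epsilon>>0. \<exists>\<delta>>0. \<forall>y\<in>S. norm (y - x) < \<delta> \<longrightarrow>
           (\<forall>vs. length vs = k \<longrightarrow>
              norm (D y vs - D x vs - D x ((y - x) # vs))
                \<le> \<epsilon> * norm (y - x) * (\<Prod>v\<leftarrow>vs. norm v))))"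


section \<open>Banach manifolds\<close>

text \<open>
  A chart is a domain together with a map that is only meaningful on it. All smoothness is over the
  reals. A complex Banach manifold (with holomorphic chart changes) is in particular a manifold in
  this sense, over the underlying real Banach space, with the same topology, charts, tangent spaces
  and norms, so complex Banach-Lie groups are covered.
\<close>

type_synonym ('g, 'e) chart = "'g set \<times> ('g \<Rightarrow> 'e)"

definition smooth_compatible ::
    "('g, 'e::real_normed_vector) chart \<Rightarrow> ('g, 'e) chart \<Rightarrow> bool" where
  "smooth_compatible = (\<lambda>(U, \<phi>) (V, \<psi>). smooth_on (\<phi> ` (U \<inter> V)) (\<psi> \<circ> inv_into U \<phi>))"

locale banach_manifold =
  fixes T :: "'g topology" and A :: "('g, 'e::banach) chart set"
  assumes chart_domain: "\<And>U \<phi>. (U, \<phi>) \<in> A \<Longrightarrow> openin T U"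
    and chart_range: "\<And>U \<phi>. (U, \<phi>) \<in> A \<Longrightarrow> open (\<phi> ` U)"
    and chart_homeo:
      "\<And>U \<phi>. (U, \<phi>) \<in> A \<Longrightarrow> homeomorphic_map (subtopology T U) (top_of_set (\<phi> ` U)) \<phi>"
    and charts_cover: "(\<Union>(U, \<phi>)\<in>A. U) = topspace T"
    and charts_compatible: "\<And>c c'. c \<in> A \<Longrightarrow> c' \<in> A \<Longrightarrow> smooth_compatible c c'"

definition smooth_map ::
    "'g topology \<Rightarrow> ('g, 'e::real_normed_vector) chart set \<Rightarrow>
     'h topology \<Rightarrow> ('h, 'f::real_normed_vector) chart set \<Rightarrow> ('g \<Rightarrow> 'h) \<Rightarrow> bool" where
  "smooth_map T A T' A' f \<longleftrightarrow> continuous_map T T' f \<and>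
     (\<forall>(U, \<phi>)\<in>A. \<forall>(V, \<psi>)\<in>A'. smooth_on (\<phi> ` (U \<inter> f -` V)) (\<psi> \<circ> f \<circ> inv_into U \<phi>))"

definition prod_atlas ::
    "('g, 'e) chart set \<Rightarrow> ('h, 'f) chart set \<Rightarrow> ('g \<times> 'h, 'e \<times> 'f) chart set" where
  "prod_atlas A B = {(U \<times> V, map_prod \<phi> \<psi>) | U \<phi> V \<psi>. (U, \<phi>) \<in> A \<and> (V, \<psi>) \<in> B}"

definition std_atlas :: "('e, 'e) chart set" where
  "std_atlas = {(UNIV, id)}"


section \<open>Tangent spaces and compatible norms\<close>

definition charts_at :: "('g, 'e) chart set \<Rightarrow> 'g \<Rightarrow> ('g, 'e) chart set" where
  "charts_at A p = {c \<in> A. p \<in> fst c}"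

text \<open>
  A tangent vector at \<open>p\<close> is an equivalence class of pairs (chart at \<open>p\<close>, vector of the model
  space), two pairs being equivalent if the derivative of the chart change carries one vector to the
  other. Such a class contains exactly one pair for each chart at \<open>p\<close>, hence is the graph of a
  function on these charts, here extended by 0. Vector space operations are therefore pointwise.
\<close>

definition tangent_space ::
    "('g, 'e::real_normed_vector) chart set \<Rightarrow> 'g \<Rightarrow> (('g, 'e) chart \<Rightarrow> 'e) set" where
  "tangent_space A p =
     {X. (\<forall>c. c \<notin> charts_at A p \<longrightarrow> X c = 0) \<and>
         (\<forall>(U, \<phi>)\<in>charts_at A p. \<forall>(V, \<psi>)\<in>charts_at A p.
            X (V, \<psi>) = frechet_derivative (\<psi> \<circ> inv_into U \<phi>) (at (\<phi> p)) (X (U, \<phi>)))}"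

text \<open>
  The locale \<open>Metric_space\<close> requires symmetry and nonnegativity on the whole type,
  so distance functions on a carrier set are set to 0 outside of it.
\<close>

definition restrict_dist :: "'a set \<Rightarrow> ('a \<Rightarrow> 'a \<Rightarrow> real) \<Rightarrow> 'a \<Rightarrow> 'a \<Rightarrow> real" where
  "restrict_dist M d x y = (if x \<in> M \<and> y \<in> M then d x y else 0)"

text \<open>
  The Banach space topology of the tangent space is the one transported from the model space by
  \<open>X \<mapsto> X c\<close>, for any chart \<open>c\<close> at \<open>p\<close>.
\<close>

definition compatible_norm ::
    "('g, 'e::banach) chart set \<Rightarrow> 'g \<Rightarrow> ((('g, 'e) chart \<Rightarrow> 'e) \<Rightarrow> real) \<Rightarrow> bool" where
  "compatible_norm A p N \<longleftrightarrow>
     (\<forall>X\<in>tangent_space A p. 0 \<le> N X \<and> (N X = 0 \<longleftrightarrow> X = (\<lambda>c. 0))) \<and>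
     (\<forall>X\<in>tangent_space A p. \<forall>a. N (\<lambda>c. a *\<^sub>R X c) = \<bar>a\<bar> * N X) \<and>
     (\<forall>X\<in>tangent_space A p. \<forall>Y\<in>tangent_space A p. N (\<lambda>c. X c + Y c) \<le> N X + N Y) \<and>
     (\<forall>c\<in>charts_at A p.
        homeomorphic_map
          (Metric_space.mtopology (tangent_space A p)
             (restrict_dist (tangent_space A p) (\<lambda>X Y. N (\<lambda>c. X c - Y c))))
          euclidean (\<lambda>X. X c))"


section \<open>Banach-Lie groups\<close>

locale hausdorff_topological_group = group G for G :: "('g, 'm) monoid_scheme" (structure) +
  fixes T :: "'g topology"
  assumes topspace_carrier: "topspace T = carrier G"
    and hausdorff: "Hausdorff_space T"
    and continuous_mult: "continuous_map (prod_topology T T) T (\<lambda>(g, h). g \<otimes> h)"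
    and continuous_inv: "continuous_map T T (\<lambda>g. inv g)"

locale banach_lie_group =
  hausdorff_topological_group G T + banach_manifold T A
  for G :: "('g, 'm) monoid_scheme" (structure)
    and T :: "'g topology" and A :: "('g, 'e::banach) chart set" +
  assumes smooth_mult:
      "smooth_map (prod_topology T T) (prod_atlas A A) T A (\<lambda>(g, h). g \<otimes> h)"
    and smooth_inv: "smooth_map T A T A (\<lambda>g. inv g)"

definition one_parameter_subgroup ::
    "('g, 'm) monoid_scheme \<Rightarrow> 'g topology \<Rightarrow> ('g, 'e::banach) chart set \<Rightarrow> (real \<Rightarrow> 'g) \<Rightarrow> bool" where
  "one_parameter_subgroup G T A \<gamma> \<longleftrightarrow>
     smooth_map euclideanreal std_atlas T A \<gamma> \<and> (\<forall>s t. \<gamma> (s + t) = \<gamma> s \<otimes>\<^bsub>G\<^esub> \<gamma> t)"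

definition has_velocity ::
    "('g, 'e::banach) chart set \<Rightarrow> (real \<Rightarrow> 'g) \<Rightarrow> (('g, 'e) chart \<Rightarrow> 'e) \<Rightarrow> real \<Rightarrow> bool" where
  "has_velocity A \<gamma> X t \<longleftrightarrow> X \<in> tangent_space A (\<gamma> t) \<and>
     (\<forall>(U, \<phi>)\<in>charts_at A (\<gamma> t). ((\<phi> \<circ> \<gamma>) has_vector_derivative X (U, \<phi>)) (at t))"

definition lie_exp ::
    "('g, 'm) monoid_scheme \<Rightarrow> 'g topology \<Rightarrow> ('g, 'e::banach) chart set \<Rightarrow>
     (('g, 'e) chart \<Rightarrow> 'e) \<Rightarrow> 'g" where
  "lie_exp G T A X = (THE \<gamma>. one_parameter_subgroup G T A \<gamma> \<and> has_velocity A \<gamma> X 0) 1"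

definition exp_length ::
    "('g, 'm) monoid_scheme \<Rightarrow> 'g topology \<Rightarrow> ('g, 'e::banach) chart set \<Rightarrow>
     ((('g, 'e) chart \<Rightarrow> 'e) \<Rightarrow> real) \<Rightarrow> 'g \<Rightarrow> real" where
  "exp_length G T A N g =
     Inf {(\<Sum>X\<leftarrow>Xs. N X) | Xs. set Xs \<subseteq> tangent_space A \<one>\<^bsub>G\<^esub> \<and>
            g = foldr (\<lambda>X h. lie_exp G T A X \<otimes>\<^bsub>G\<^esub> h) Xs \<one>\<^bsub>G\<^esub>}"


section \<open>Length functions and left-invariant metrics\<close>

definition length_function :: "('g, 'm) monoid_scheme \<Rightarrow> ('g \<Rightarrow> real) \<Rightarrow> bool" where
  "length_function G l \<longleftrightarrow>
     (\<forall>g\<in>carrier G. 0 \<le> l g \<and> (l g = 0 \<longleftrightarrow> g = \<one>\<^bsub>G\<^esub>) \<and> l (inv\<^bsub>G\<^esub> g) = l g) \<and>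
     (\<forall>g\<in>carrier G. \<forall>h\<in>carrier G. l (g \<otimes>\<^bsub>G\<^esub> h) \<le> l g + l h)"

definition length_dist :: "('g, 'm) monoid_scheme \<Rightarrow> ('g \<Rightarrow> real) \<Rightarrow> 'g \<Rightarrow> 'g \<Rightarrow> real" where
  "length_dist G l = restrict_dist (carrier G) (\<lambda>g h. l (inv\<^bsub>G\<^esub> g \<otimes>\<^bsub>G\<^esub> h))"

definition left_invariant :: "('g, 'm) monoid_scheme \<Rightarrow> ('g \<Rightarrow> 'g \<Rightarrow> real) \<Rightarrow> bool" where
  "left_invariant G d \<longleftrightarrow>
     (\<forall>k\<in>carrier G. \<forall>g\<in>carrier G. \<forall>h\<in>carrier G. d (k \<otimes>\<^bsub>G\<^esub> g) (k \<otimes>\<^bsub>G\<^esub> h) = d g h)"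

definition compatible_metric ::
    "('g, 'm) monoid_scheme \<Rightarrow> 'g topology \<Rightarrow> ('g \<Rightarrow> 'g \<Rightarrow> real) \<Rightarrow> bool" where
  "compatible_metric G T d \<longleftrightarrow>
     Metric_space (carrier G) d \<and> Metric_space.mtopology (carrier G) d = T"

definition compatible_length_function ::
    "('g, 'm) monoid_scheme \<Rightarrow> 'g topology \<Rightarrow> ('g \<Rightarrow> real) \<Rightarrow> bool" where
  "compatible_length_function G T l \<longleftrightarrow>
     length_function G l \<and> compatible_metric G T (length_dist G l)"

definition pseudometric_on :: "'a set \<Rightarrow> ('a \<Rightarrow> 'a \<Rightarrow> real) \<Rightarrow> bool" where
  "pseudometric_on M d \<longleftrightarrow>
     (\<forall>x\<in>M. d x x = 0) \<and>
     (\<forall>x\<in>M. \<forall>y\<in>M. 0 \<le> d x y \<and> d x y = d y x) \<and>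
     (\<forall>x\<in>M. \<forall>y\<in>M. \<forall>z\<in>M. d x z \<le> d x y + d y z)"

definition cont_left_inv_pseudometrics ::
    "('g, 'm) monoid_scheme \<Rightarrow> 'g topology \<Rightarrow> ('g \<Rightarrow> 'g \<Rightarrow> real) set" where
  "cont_left_inv_pseudometrics G T =
     {d. pseudometric_on (carrier G) d \<and> left_invariant G d \<and>
         continuous_map (prod_topology T T) euclideanreal (\<lambda>(g, h). d g h)}"

definition coarsely_dominated ::
    "('g, 'm) monoid_scheme \<Rightarrow> ('g \<Rightarrow> 'g \<Rightarrow> real) \<Rightarrow> ('g \<Rightarrow> 'g \<Rightarrow> real) \<Rightarrow> bool" where
  "coarsely_dominated G d p \<longleftrightarrow>
     (\<exists>K>0. \<exists>L>0. \<forall>g\<in>carrier G. \<forall>h\<in>carrier G. d g h \<le> K * p g h + L)"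

definition maximal_pseudometric ::
    "('g, 'm) monoid_scheme \<Rightarrow> 'g topology \<Rightarrow> ('g \<Rightarrow> 'g \<Rightarrow> real) \<Rightarrow> bool" where
  "maximal_pseudometric G T d \<longleftrightarrow>
     d \<in> cont_left_inv_pseudometrics G T \<and>
     (\<forall>p\<in>cont_left_inv_pseudometrics G T. coarsely_dominated G d p \<longrightarrow> coarsely_dominated G p d)"

definition minimal_metric ::
    "('g, 'm) monoid_scheme \<Rightarrow> 'g topology \<Rightarrow> ('g \<Rightarrow> 'g \<Rightarrow> real) \<Rightarrow> bool" where
  "minimal_metric G T d \<longleftrightarrow>
     left_invariant G d \<and> compatible_metric G T d \<and>
     (\<forall>\<rho>. left_invariant G \<rho> \<and> compatible_metric G T \<rho> \<longrightarrow>
        (\<exists>U K. openin T U \<and> \<one>\<^bsub>G\<^esub> \<in> U \<and> (\<forall>g\<in>U. \<forall>h\<in>U. d g h \<le> K * \<rho> g h)))"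

definition global_lipschitz_structure ::
    "('g, 'm) monoid_scheme \<Rightarrow> 'g topology \<Rightarrow> ('g \<Rightarrow> 'g \<Rightarrow> real) \<Rightarrow> bool" where
  "global_lipschitz_structure G T d \<longleftrightarrow>
     left_invariant G d \<and> compatible_metric G T d \<and>
     maximal_pseudometric G T d \<and> minimal_metric G T d"

end

theory Submission
  imports Defs
begin

text \<open>
  In a chart around the identity, translated so that the identity becomes 0, the product is
  \<open>x + y\<close> up to an error that is Lipschitz in each variable with constant proportional to the size
  of the other variable. By induction, the map \<open>x \<mapsto> x\<^sup>n\<close> is multiplication by \<open>n\<close> up to a quadratic
  error, uniformly in \<open>n\<close> as long as \<open>n \<parallel>x\<parallel>\<close> is small. Hence \<open>e X = lim (X/n)\<^sup>n\<close> exists, is a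
  near-identity map (so it covers a neighbourhood of 0 by Banach's fixed point theorem), and is a
  homomorphism on lines; this gives existence and uniqueness of one-parameter subgroups without
  solving a differential equation. Products of exponentials of total mass \<open>s\<close> have coordinate of
  norm \<open>O(s)\<close>, and conversely, so the exponential length is comparable to the norm of the coordinate
  near the identity. A word of exponentials can be cut at any prescribed mass, which bounds every
  continuous left-invariant pseudometric by the number of pieces (maximality), and the growth of
  powers \<open>g\<^sup>n\<close> of an element near the identity bounds every compatible metric from below (minimality).
\<close>

section \<open>Multilinear maps and iterated derivatives\<close>

text \<open>The coordinate estimates come from the unit laws. With one factor fixed at the identity,
  the product is the other factor, so the partial derivative along that axis is exactly the
  identity; a local bound on the second derivative then controls the deviation off the axis by the
  size of the fixed factor. Limits of powers produce the right curves but say nothing about their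
  smoothness, whereas \<open>lie_exp\<close> selects by \<open>THE\<close> among curves that are
  smooth in every chart. The limit curve must therefore be shown smooth before it can serve as the
  witness, and this is why derivatives of all orders, encoded on lists of vectors, are treated
  first. The given norm lives on the tangent space and is only topologically tied to the model
  space. All estimates use the norm of the model space, and two-sided constants carry them over.
  Connectedness enters to make every element a word of exponentials, so that the infimum defining
  the length ranges over a nonempty set.\<close>

lemma bounded_multilinear_Cons:
  assumes "bounded_multilinear (Suc k) m"
  shows "bounded_multilinear k (\<lambda>vs. m (a # vs))"
proof -
  have lin: "linear (\<lambda>v. m (vs[i := v]))" if "length vs = Suc k" "i < Suc k" for vs i
    using assms that by (auto simp: bounded_multilinear_def)
  obtain C where C: "\<And>vs. length vs = Suc k \<Longrightarrow> norm (m vs) \<le> C * (\<Prod>v\<leftarrow>vs. norm v)"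
    using assms by (auto simp: bounded_multilinear_def)
  have "linear (\<lambda>v. m (a # vs[i := v]))" if "length vs = k" "i < k" for vs i
    using lin[of "a # vs" "Suc i"] that by simp
  moreover have "norm (m (a # vs)) \<le> (C * norm a) * (\<Prod>v\<leftarrow>vs. norm v)" if "length vs = k" for vs
    using C[of "a # vs"] that by (simp add: mult.assoc)
  ultimately show ?thesis
    unfolding bounded_multilinear_def by blast
qed

lemma bounded_multilinear_linear_hd:
  assumes "bounded_multilinear (Suc k) m" "length vs = k"
  shows "bounded_linear (\<lambda>v. m (v # vs))"
proof -
  obtain C where C: "\<And>vs. length vs = Suc k \<Longrightarrow> norm (m vs) \<le> C * (\<Prod>v\<leftarrow>vs. norm v)"
    using assms by (auto simp: bounded_multilinear_def)
  have "linear (\<lambda>v. m ((0 # vs)[0 := v]))"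
    using assms unfolding bounded_multilinear_def by (metis length_Cons zero_less_Suc)
  moreover have "norm (m (v # vs)) \<le> norm v * (C * (\<Prod>v\<leftarrow>vs. norm v))" for v
    using C[of "v # vs"] assms by (simp add: mult_ac)
  ultimately show ?thesis
    by (simp add: bounded_linear_def bounded_linear_axioms_def) blast
qed

lemma prod_list_norm_nonneg: "0 \<le> (\<Prod>v\<leftarrow>vs. norm v)"
  by (induction vs) auto

lemma tendsto_prod_list_norm:
  assumes "\<And>u. u \<in> set us \<Longrightarrow> (u \<longlongrightarrow> l u) F"
  shows "((\<lambda>s. \<Prod>u\<leftarrow>us. norm (u s)) \<longlongrightarrow> (\<Prod>u\<leftarrow>us. norm (l u))) F"
  using assms by (induction us) (auto intro!: tendsto_intros)

text \<open>Induction on the slots: the norm bound disposes of the deviation in the first slot, and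
  with that slot frozen at its limit the map is multilinear in one argument less.\<close>

lemma tendsto_bounded_multilinear:
  fixes us :: "('s \<Rightarrow> 'a::real_normed_vector) list"
  assumes "list_all2 (\<lambda>u l. (u \<longlongrightarrow> l) F) us ls" "bounded_multilinear (length us) m"
  shows "((\<lambda>s. m (map (\<lambda>u. u s) us)) \<longlongrightarrow> m ls) F"
  using assms
proof (induction arbitrary: m rule: list_all2_induct)
  case (Cons a us l ls)
  have bm: "bounded_multilinear (Suc (length us)) m" using Cons.prems by simp
  then obtain C where C: "\<And>vs. length vs = Suc (length us) \<Longrightarrow> norm (m vs) \<le> C * (\<Prod>v\<leftarrow>vs. norm v)"
    by (auto simp: bounded_multilinear_def)
  have lim: "\<exists>l. (u \<longlongrightarrow> l) F" if "u \<in> set us" for u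
    using Cons.hyps(2) that by (auto simp: list_all2_conv_all_nth in_set_conv_nth)
  have "((\<lambda>s. m ((a s - l) # map (\<lambda>u. u s) us)) \<longlongrightarrow> 0) F"
  proof (rule Lim_null_comparison)
    show "\<forall>\<^sub>F s in F. norm (m ((a s - l) # map (\<lambda>u. u s) us))
        \<le> C * (norm (a s - l) * (\<Prod>u\<leftarrow>us. norm (u s)))"
      using C[of "(a s - l) # map (\<lambda>u. u s) us" for s] by (auto simp: o_def)
    from lim obtain k where k: "\<And>u. u \<in> set us \<Longrightarrow> (u \<longlongrightarrow> k u) F" by metis
    have "((\<lambda>s. C * (norm (a s - l) * (\<Prod>u\<leftarrow>us. norm (u s))))
       \<longlongrightarrow> C * (norm (l - l) * (\<Prod>u\<leftarrow>us. norm (k u)))) F"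
      using Cons.hyps(1) k by (intro tendsto_intros tendsto_prod_list_norm) auto
    then show "((\<lambda>s. C * (norm (a s - l) * (\<Prod>u\<leftarrow>us. norm (u s)))) \<longlongrightarrow> 0) F" by simp
  qed
  moreover have "((\<lambda>s. m (l # map (\<lambda>u. u s) us)) \<longlongrightarrow> m (l # ls)) F"
    using Cons.IH[OF bounded_multilinear_Cons[OF bm]] by simp
  ultimately have "((\<lambda>s. m ((a s - l) # map (\<lambda>u. u s) us) + m (l # map (\<lambda>u. u s) us))
       \<longlongrightarrow> 0 + m (l # ls)) F"
    by (rule tendsto_add)
  moreover have "m ((a s - l) # map (\<lambda>u. u s) us) + m (l # map (\<lambda>u. u s) us)
      = m (a s # map (\<lambda>u. u s) us)" for s
    using linear_diff[OF bounded_linear.linear[OF bounded_multilinear_linear_hd[OF bm, of "map (\<lambda>u. u s) us"]],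
        of "a s" l] by simp
  ultimately show ?case by simp
qed simp

text \<open>In quotient form a derivative is an ordinary limit, so the limit rule for multilinear
  maps applies directly.\<close>

lemma has_vector_derivative_tendsto:
  "(f has_vector_derivative f') (at t) \<longleftrightarrow> ((\<lambda>s. (1 / (s - t)) *\<^sub>R (f s - f t)) \<longlongrightarrow> f') (at t)"
proof -
  have "(f has_vector_derivative f') (at t) \<longleftrightarrow>
    ((\<lambda>s. (1 / norm (s - t)) *\<^sub>R (f s - f t - (s - t) *\<^sub>R f')) \<longlongrightarrow> 0) (at t)"
    unfolding has_vector_derivative_def has_derivative_within
    by (simp add: algebra_simps bounded_linear_scaleR_left)
  also have "\<dots> \<longleftrightarrow> ((\<lambda>s. norm ((1 / norm (s - t)) *\<^sub>R (f s - f t - (s - t) *\<^sub>R f'))) \<longlongrightarrow> 0) (at t)"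
    by (rule tendsto_norm_zero_iff[symmetric])
  also have "\<dots> \<longleftrightarrow> ((\<lambda>s. norm ((1 / (s - t)) *\<^sub>R (f s - f t) - f')) \<longlongrightarrow> 0) (at t)"
  proof (rule filterlim_cong[OF refl refl])
    show "\<forall>\<^sub>F s in at t. norm ((1 / norm (s - t)) *\<^sub>R (f s - f t - (s - t) *\<^sub>R f'))
        = norm ((1 / (s - t)) *\<^sub>R (f s - f t) - f')"
    proof (rule eventually_at_le[THEN iffD2, OF exI[of _ 1]], safe)
      fix s :: real assume "s \<noteq> t"
      then have "(1 / (s - t)) *\<^sub>R (f s - f t) - f' = (1 / (s - t)) *\<^sub>R (f s - f t - (s - t) *\<^sub>R f')"
        using scaleR_diff_right[of "1 / (s - t)" "f s - f t" "(s - t) *\<^sub>R f'"] by simp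
      then show "norm ((1 / norm (s - t)) *\<^sub>R (f s - f t - (s - t) *\<^sub>R f'))
        = norm ((1 / (s - t)) *\<^sub>R (f s - f t) - f')" by simp
    qed simp
  qed
  also have "\<dots> \<longleftrightarrow> ((\<lambda>s. (1 / (s - t)) *\<^sub>R (f s - f t)) \<longlongrightarrow> f') (at t)"
    by (simp only: tendsto_norm_zero_iff LIM_zero_iff)
  finally show ?thesis .
qed

text \<open>Leibniz rule. By linearity in the first slot its difference quotient can be moved inside
  \<open>m\<close>; the other slots follow by induction with the first one frozen at
  \<open>a t\<close>.\<close>

lemma has_vector_derivative_bounded_multilinear:
  fixes us :: "(real \<Rightarrow> 'a::real_normed_vector) list"
  assumes "bounded_multilinear (length us) m"
    and "\<And>u. u \<in> set us \<Longrightarrow> (u has_vector_derivative d u) (at t)"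
  shows "((\<lambda>s. m (map (\<lambda>u. u s) us)) has_vector_derivative
           (\<Sum>i<length us. m ((map (\<lambda>u. u t) us)[i := d (us ! i)]))) (at t)"
  using assms
proof (induction us arbitrary: m)
  case (Cons a us)
  have bm: "bounded_multilinear (Suc (length us)) m" using Cons.prems by simp
  note lin = bounded_linear.linear[OF bounded_multilinear_linear_hd[OF bm length_map, of "\<lambda>u. u s" for s]]
  have IH: "((\<lambda>s. m (a t # map (\<lambda>u. u s) us)) has_vector_derivative
           (\<Sum>i<length us. m (a t # (map (\<lambda>u. u t) us)[i := d (us ! i)]))) (at t)"
    using Cons.IH[OF bounded_multilinear_Cons[OF bm]] Cons.prems(2) by simp
  define q where "q s = (1 / (s - t)) *\<^sub>R (a s - a t)" for s
  have "(q \<longlongrightarrow> d a) (at t)"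
    using Cons.prems(2) unfolding q_def has_vector_derivative_tendsto by simp
  moreover have "(u \<longlongrightarrow> u t) (at t)" if "u \<in> set us" for u
    using has_vector_derivative_continuous[OF Cons.prems(2)[of u]] that by (simp add: continuous_at)
  ultimately have lim: "((\<lambda>s. m (q s # map (\<lambda>u. u s) us)) \<longlongrightarrow> m (d a # map (\<lambda>u. u t) us)) (at t)"
    using tendsto_bounded_multilinear[of "at t" "q # us" "d a # map (\<lambda>u. u t) us" m] bm
    by (simp add: list_all2_map2 list_all2_same)
  have "((\<lambda>s. m (a s # map (\<lambda>u. u s) us)) has_vector_derivative
     (m (d a # map (\<lambda>u. u t) us) + (\<Sum>i<length us. m (a t # (map (\<lambda>u. u t) us)[i := d (us ! i)])))) (at t)"
    unfolding has_vector_derivative_tendsto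
  proof (rule Lim_transform_eventually)
    show "((\<lambda>s. m (q s # map (\<lambda>u. u s) us)
       + (1 / (s - t)) *\<^sub>R (m (a t # map (\<lambda>u. u s) us) - m (a t # map (\<lambda>u. u t) us)))
       \<longlongrightarrow> (m (d a # map (\<lambda>u. u t) us) + (\<Sum>i<length us. m (a t # (map (\<lambda>u. u t) us)[i := d (us ! i)])))) (at t)"
      using lim IH unfolding has_vector_derivative_tendsto by (rule tendsto_add)
    have "m (q s # map (\<lambda>u. u s) us) = (1 / (s - t)) *\<^sub>R (m (a s # map (\<lambda>u. u s) us) - m (a t # map (\<lambda>u. u s) us))" for s
      using linear_scale[OF lin[of s], of "1 / (s - t)" "a s - a t"] linear_diff[OF lin[of s], of "a s" "a t"]
      by (simp only: q_def)
    then show "\<forall>\<^sub>F s in at t. m (q s # map (\<lambda>u. u s) us)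
       + (1 / (s - t)) *\<^sub>R (m (a t # map (\<lambda>u. u s) us) - m (a t # map (\<lambda>u. u t) us))
       = (1 / (s - t)) *\<^sub>R (m (a s # map (\<lambda>u. u s) us) - m (a t # map (\<lambda>u. u t) us))"
      by (simp flip: scaleR_add_right)
  qed
  then show ?case by (simp add: sum.lessThan_Suc_shift del: sum.lessThan_Suc)
qed simp

section \<open>Towers of Frechet derivatives\<close>

text \<open>The witness inside \<open>smooth_on\<close>, detached from the function, so that
  derivatives of every order are available as one object.\<close>

definition derivative_tower ::
    "'a::real_normed_vector set \<Rightarrow> ('a \<Rightarrow> 'a list \<Rightarrow> 'b::real_normed_vector) \<Rightarrow> bool" where
  "derivative_tower S D \<longleftrightarrow> open S \<and>
     (\<forall>k. \<forall>x\<in>S. bounded_multilinear k (D x)) \<and>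
     (\<forall>k. \<forall>x\<in>S. \<forall>\<epsilon>>0. \<exists>\<delta>>0. \<forall>y\<in>S. norm (y - x) < \<delta> \<longrightarrow>
        (\<forall>vs. length vs = k \<longrightarrow>
           norm (D y vs - D x vs - D x ((y - x) # vs)) \<le> \<epsilon> * norm (y - x) * (\<Prod>v\<leftarrow>vs. norm v)))"

lemma smooth_on_iff_tower:
  "smooth_on S f \<longleftrightarrow> open S \<and> (\<exists>D. derivative_tower S D \<and> (\<forall>x\<in>S. D x [] = f x))"
  unfolding smooth_on_def derivative_tower_def by blast

lemma derivative_tower_estimate:
  assumes "derivative_tower S D" "x \<in> S" "\<epsilon> > 0"
  shows "\<exists>\<delta>>0. ball x \<delta> \<subseteq> S \<and> (\<forall>y\<in>ball x \<delta>. \<forall>vs. length vs = k \<longrightarrow>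
     norm (D y vs - D x vs - D x ((y - x) # vs)) \<le> \<epsilon> * norm (y - x) * (\<Prod>v\<leftarrow>vs. norm v))"
proof -
  obtain \<delta> where d: "\<delta> > 0" "\<And>y vs. y \<in> S \<Longrightarrow> norm (y - x) < \<delta> \<Longrightarrow> length vs = k \<Longrightarrow>
     norm (D y vs - D x vs - D x ((y - x) # vs)) \<le> \<epsilon> * norm (y - x) * (\<Prod>v\<leftarrow>vs. norm v)"
    using assms unfolding derivative_tower_def by meson
  obtain \<eta> where e: "\<eta> > 0" "ball x \<eta> \<subseteq> S"
    using assms unfolding derivative_tower_def by (meson openE)
  show ?thesis
    by (rule exI[of _ "min \<delta> \<eta>"]) (use d e in \<open>auto simp: dist_norm norm_minus_commute subset_iff\<close>)
qed

lemma derivative_tower_has_derivative: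
  assumes D: "derivative_tower S D" and x: "x \<in> S"
  shows "((\<lambda>y. D y vs) has_derivative (\<lambda>h. D x (h # vs))) (at x)"
  unfolding has_derivative_at_alt
proof (intro conjI allI impI)
  have "bounded_multilinear (Suc (length vs)) (D x)"
    using assms by (simp add: derivative_tower_def)
  then show "bounded_linear (\<lambda>h. D x (h # vs))"
    by (rule bounded_multilinear_linear_hd) simp
  fix e :: real assume e: "e > 0"
  define p where "p = (\<Prod>v\<leftarrow>vs. norm v)"
  have p: "p \<ge> 0" unfolding p_def by (rule prod_list_norm_nonneg)
  \<comment> \<open>The summand 1 keeps the quotient defined when some vector in \<open>vs\<close>
    is zero.\<close>
  obtain \<delta> where d: "\<delta> > 0" "ball x \<delta> \<subseteq> S" "\<And>y vs'. y \<in> ball x \<delta> \<Longrightarrow> length vs' = length vs \<Longrightarrow>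
     norm (D y vs' - D x vs' - D x ((y - x) # vs')) \<le> e / (p + 1) * norm (y - x) * (\<Prod>v\<leftarrow>vs'. norm v)"
    using derivative_tower_estimate[OF D x, of "e / (p + 1)" "length vs"] e p by auto
  have "norm (D y vs - D x vs - D x ((y - x) # vs)) \<le> e * norm (y - x)" if "norm (y - x) < \<delta>" for y
  proof -
    have "norm (D y vs - D x vs - D x ((y - x) # vs)) \<le> e / (p + 1) * norm (y - x) * p"
      unfolding p_def by (rule d(3)[unfolded p_def]) (use that in \<open>auto simp: dist_norm norm_minus_commute\<close>)
    also have "\<dots> = (e * norm (y - x)) * (p / (p + 1))" by simp
    also have "\<dots> \<le> (e * norm (y - x)) * 1"
      by (rule mult_left_mono) (use p e in auto)
    finally show ?thesis by simp
  qed
  then show "\<exists>d>0. \<forall>y. norm (y - x) < d \<longrightarrow> norm (D y vs - D x vs - D x ((y - x) # vs)) \<le> e * norm (y - x)"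
    using d(1) by blast
qed

text \<open>The tower estimate with tolerance 1 expresses the \<open>k\<close>-th derivative near
  \<open>x\<close> through those of orders \<open>k\<close> and \<open>k + 1\<close> at
  \<open>x\<close>, which are bounded.\<close>

lemma derivative_tower_locally_bounded:
  assumes D: "derivative_tower S D" and x: "x \<in> S"
  shows "\<exists>\<delta>>0. \<exists>C\<ge>0. ball x \<delta> \<subseteq> S \<and>
    (\<forall>y\<in>ball x \<delta>. \<forall>vs. length vs = k \<longrightarrow> norm (D y vs) \<le> C * (\<Prod>v\<leftarrow>vs. norm v))"
proof -
  obtain \<delta> where d: "\<delta> > 0" "ball x \<delta> \<subseteq> S" "\<And>y vs. y \<in> ball x \<delta> \<Longrightarrow> length vs = k \<Longrightarrow>
     norm (D y vs - D x vs - D x ((y - x) # vs)) \<le> 1 * norm (y - x) * (\<Prod>v\<leftarrow>vs. norm v)"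
    using derivative_tower_estimate[OF D x, of 1 k] by auto
  obtain A where A: "\<And>vs. length vs = k \<Longrightarrow> norm (D x vs) \<le> A * (\<Prod>v\<leftarrow>vs. norm v)"
    using D x unfolding derivative_tower_def bounded_multilinear_def by meson
  obtain B where B: "\<And>vs. length vs = Suc k \<Longrightarrow> norm (D x vs) \<le> B * (\<Prod>v\<leftarrow>vs. norm v)"
    using D x unfolding derivative_tower_def bounded_multilinear_def by meson
  have "norm (D y vs) \<le> (\<bar>A\<bar> + \<bar>B\<bar> * \<delta> + \<delta>) * (\<Prod>v\<leftarrow>vs. norm v)" if y: "y \<in> ball x \<delta>" and vs: "length vs = k" for y vs
  proof -
    define p where "p = (\<Prod>v\<leftarrow>vs. norm v)"
    have p: "p \<ge> 0" unfolding p_def by (rule prod_list_norm_nonneg)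
    have n: "norm (y - x) \<le> \<delta>" using y by (simp add: dist_norm norm_minus_commute)
    have "norm (D y vs) \<le> norm (D y vs - D x vs - D x ((y - x) # vs)) + norm (D x vs) + norm (D x ((y - x) # vs))"
      by (smt (verit) norm_triangle_sub)
    also have "norm (D y vs - D x vs - D x ((y - x) # vs)) \<le> \<delta> * p"
      using d(3)[OF y vs] n p unfolding p_def[symmetric] by (smt (verit) mult_right_mono)
    also have "norm (D x vs) \<le> \<bar>A\<bar> * p"
      using A[OF vs] p unfolding p_def[symmetric] by (smt (verit) mult_right_mono)
    also have "norm (D x ((y - x) # vs)) \<le> \<bar>B\<bar> * \<delta> * p"
    proof -
      have "norm (D x ((y - x) # vs)) \<le> B * (norm (y - x) * p)"
        using B[of "(y - x) # vs"] vs by (simp add: p_def)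
      also have "\<dots> \<le> \<bar>B\<bar> * (\<delta> * p)"
        using n p d(1) by (intro mult_mono) auto
      finally show ?thesis by (simp add: mult.assoc)
    qed
    finally show ?thesis unfolding p_def[symmetric] by (simp add: algebra_simps)
  qed
  then show ?thesis using d(1,2)
    by (intro exI[of _ \<delta>] conjI exI[of _ "\<bar>A\<bar> + \<bar>B\<bar> * \<delta> + \<delta>"]) auto
qed

text \<open>Base point and slots move together. The difference quotient splits into the remainder of
  the tower (\<open>lim2\<close>), the derivative in the base point (\<open>lim1\<close>) and the
  Leibniz sum with the base point frozen (\<open>lim3\<close>). The remainder needs the estimate in
  operator norm, since the slots vary with \<open>s\<close>.\<close>

lemma derivative_tower_chain:
  fixes y :: "real \<Rightarrow> 'a::real_normed_vector"
  assumes D: "derivative_tower S D" and S: "y t \<in> S"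
    and y: "(y has_vector_derivative y') (at t)"
    and us: "\<And>u. u \<in> set us \<Longrightarrow> (u has_vector_derivative d u) (at t)"
  shows "((\<lambda>s. D (y s) (map (\<lambda>u. u s) us)) has_vector_derivative
     D (y t) (y' # map (\<lambda>u. u t) us) + (\<Sum>i<length us. D (y t) ((map (\<lambda>u. u t) us)[i := d (us ! i)]))) (at t)"
proof -
  have bm: "bounded_multilinear k (D (y t))" for k
    using D S by (simp add: derivative_tower_def)
  have ycont: "(y \<longlongrightarrow> y t) (at t)"
    using has_vector_derivative_continuous[OF y] by (simp add: continuous_at)
  have ucont: "(u \<longlongrightarrow> u t) (at t)" if "u \<in> set us" for u
    using has_vector_derivative_continuous[OF us[OF that]] by (simp add: continuous_at)
  define z where "z s = y t + (1 / (s - t)) *\<^sub>R (y s - y t)" for s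
  define W where "W s = map (\<lambda>u. u s) us" for s
  have Wl: "length (W s) = length us" for s by (simp add: W_def)
  have qlim: "((\<lambda>s. (1 / (s - t)) *\<^sub>R (y s - y t)) \<longlongrightarrow> y') (at t)"
    using y by (simp add: has_vector_derivative_tendsto)
  have Dlin: "bounded_linear (\<lambda>v. D (y t) (v # W s))" for s
    by (rule bounded_multilinear_linear_hd[OF bm]) (rule Wl)
  have lim1: "((\<lambda>s. D (y t) (((1 / (s - t)) *\<^sub>R (y s - y t)) # W s)) \<longlongrightarrow> D (y t) (y' # W t)) (at t)"
    using tendsto_bounded_multilinear[of "at t" "(\<lambda>s. (1 / (s - t)) *\<^sub>R (y s - y t)) # us" "y' # W t" "D (y t)"]
      qlim bm ucont by (simp add: list_all2_map2 list_all2_same W_def)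
  have lim2: "((\<lambda>s. (1 / (s - t)) *\<^sub>R (D (y s) (W s) - D (y t) (W s) - D (y t) ((y s - y t) # W s))) \<longlongrightarrow> 0) (at t)"
  proof -
    \<comment> \<open>\<open>B\<close> eventually bounds the quotient of \<open>y\<close> times the
      norms of the slots, so the tolerance \<open>e / B\<close> in the tower becomes
      \<open>e\<close>.\<close>
    define B where "B = (norm y' + 1) * ((\<Prod>u\<leftarrow>us. norm (u t)) + 1)"
    have B: "B > 0" unfolding B_def 
      using prod_list_norm_nonneg[of "W t"] by (auto simp: W_def o_def intro!: mult_pos_pos add_nonneg_pos)
    have q1: "\<forall>\<^sub>F s in at t. norm ((1 / (s - t)) *\<^sub>R (y s - y t)) < norm y' + 1"
      by (rule order_tendstoD(2)[OF tendsto_norm[OF qlim]]) simp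
    have q2: "\<forall>\<^sub>F s in at t. (\<Prod>u\<leftarrow>us. norm (u s)) < (\<Prod>u\<leftarrow>us. norm (u t)) + 1"
      by (rule order_tendstoD(2)[OF tendsto_prod_list_norm[where l = "\<lambda>u. u t"]]) (use ucont in auto)
    show ?thesis unfolding tendsto_iff dist_norm diff_zero
    proof (intro allI impI)
      fix e :: real assume e: "e > 0"
      obtain \<delta> where d: "\<delta> > 0" "\<And>x vs. x \<in> ball (y t) \<delta> \<Longrightarrow> length vs = length us \<Longrightarrow>
        norm (D x vs - D (y t) vs - D (y t) ((x - y t) # vs)) \<le> e / B * norm (x - y t) * (\<Prod>v\<leftarrow>vs. norm v)"
        using derivative_tower_estimate[OF D S, of "e / B" "length us"] e B by auto
      have q3: "\<forall>\<^sub>F s in at t. y s \<in> ball (y t) \<delta>"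
        using ycont d(1) by (simp add: tendsto_iff dist_commute)
      show "\<forall>\<^sub>F s in at t. norm ((1 / (s - t)) *\<^sub>R (D (y s) (W s) - D (y t) (W s) - D (y t) ((y s - y t) # W s))) < e"
        using q1 q2 q3
      proof eventually_elim
        case (elim s)
        have p: "(\<Prod>v\<leftarrow>W s. norm v) = (\<Prod>u\<leftarrow>us. norm (u s))" by (simp add: W_def o_def)
        have "norm ((1 / (s - t)) *\<^sub>R (D (y s) (W s) - D (y t) (W s) - D (y t) ((y s - y t) # W s)))
           = \<bar>1 / (s - t)\<bar> * norm (D (y s) (W s) - D (y t) (W s) - D (y t) ((y s - y t) # W s))" by simp
        also have "\<dots> \<le> \<bar>1 / (s - t)\<bar> * (e / B * norm (y s - y t) * (\<Prod>v\<leftarrow>W s. norm v))"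
          by (rule mult_left_mono[OF d(2)]) (use elim Wl in auto)
        also have "\<dots> = e / B * (norm ((1 / (s - t)) *\<^sub>R (y s - y t)) * (\<Prod>u\<leftarrow>us. norm (u s)))"
          unfolding p by (simp add: mult_ac)
        also have "\<dots> < e / B * B"
        proof (rule mult_strict_left_mono)
          show "norm ((1 / (s - t)) *\<^sub>R (y s - y t)) * (\<Prod>u\<leftarrow>us. norm (u s)) < B"
            unfolding B_def using elim prod_list_norm_nonneg[of "W s"] 
            by (intro mult_strict_mono') (auto simp: p)
        qed (use e B in auto)
        finally show ?case using B by simp
      qed
    qed
  qed
  have lim3: "((\<lambda>s. (1 / (s - t)) *\<^sub>R (D (y t) (W s) - D (y t) (W t))) \<longlongrightarrow>
     (\<Sum>i<length us. D (y t) ((W t)[i := d (us ! i)]))) (at t)"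
    using has_vector_derivative_bounded_multilinear[OF bm us]
    unfolding W_def has_vector_derivative_tendsto by simp
  have "((\<lambda>s. (1 / (s - t)) *\<^sub>R (D (y s) (W s) - D (y t) (W t))) \<longlongrightarrow> 
     0 + D (y t) (y' # W t) + (\<Sum>i<length us. D (y t) ((W t)[i := d (us ! i)]))) (at t)"
  proof (rule Lim_transform_eventually[OF tendsto_add[OF tendsto_add[OF lim2 lim1] lim3]], intro always_eventually allI)
    fix s
    have "D (y t) (((1 / (s - t)) *\<^sub>R (y s - y t)) # W s) = (1 / (s - t)) *\<^sub>R D (y t) ((y s - y t) # W s)"
      using linear_scale[OF bounded_linear.linear[OF Dlin]] .
    then show "(1 / (s - t)) *\<^sub>R (D (y s) (W s) - D (y t) (W s) - D (y t) ((y s - y t) # W s)) +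
         D (y t) (((1 / (s - t)) *\<^sub>R (y s - y t)) # W s) + (1 / (s - t)) *\<^sub>R (D (y t) (W s) - D (y t) (W t)) =
         (1 / (s - t)) *\<^sub>R (D (y s) (W s) - D (y t) (W t))"
      by (simp add: algebra_simps)
  qed
  then show ?thesis
    unfolding W_def has_vector_derivative_tendsto by simp
qed

section \<open>Repeated differentiability of curves\<close>

text \<open>The derivative is bound existentially at each order, so inductions need no names for
  higher derivatives. Order 0 imposes nothing.\<close>

primrec times_differentiable :: "real set \<Rightarrow> nat \<Rightarrow> (real \<Rightarrow> 'a::real_normed_vector) \<Rightarrow> bool" where
  "times_differentiable I 0 f \<longleftrightarrow> True"
| "times_differentiable I (Suc n) f \<longleftrightarrow>
     (\<exists>f'. (\<forall>t\<in>I. (f has_vector_derivative f' t) (at t)) \<and> times_differentiable I n f')"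

lemma times_differentiable_Suc_D:
  "times_differentiable I (Suc n) f \<Longrightarrow> times_differentiable I n f"
  by (induction n arbitrary: f) auto

lemma times_differentiable_const: "times_differentiable I n (\<lambda>t. c)"
  by (induction n arbitrary: c) (auto intro!: exI[of _ "\<lambda>t. 0"])

lemma times_differentiable_add:
  "times_differentiable I n f \<Longrightarrow> times_differentiable I n g \<Longrightarrow> times_differentiable I n (\<lambda>t. f t + g t)"
proof (induction n arbitrary: f g)
  case (Suc n)
  from Suc.prems obtain f' g' where
    "\<forall>t\<in>I. (f has_vector_derivative f' t) (at t)" "times_differentiable I n f'"
    "\<forall>t\<in>I. (g has_vector_derivative g' t) (at t)" "times_differentiable I n g'" by auto
  with Suc.IH show ?case
    by (auto intro!: exI[of _ "\<lambda>t. f' t + g' t"] has_vector_derivative_add)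
qed simp

lemma times_differentiable_sum:
  assumes "finite J" "\<And>j. j \<in> J \<Longrightarrow> times_differentiable I n (f j)"
  shows "times_differentiable I n (\<lambda>t. \<Sum>j\<in>J. f j t)"
  using assms by (induction J) (auto intro: times_differentiable_const times_differentiable_add)

lemma times_differentiable_Pair:
  "times_differentiable I n f \<Longrightarrow> times_differentiable I n g \<Longrightarrow> times_differentiable I n (\<lambda>t. (f t, g t))"
proof (induction n arbitrary: f g)
  case (Suc n)
  from Suc.prems obtain f' g' where
    "\<forall>t\<in>I. (f has_vector_derivative f' t) (at t)" "times_differentiable I n f'"
    "\<forall>t\<in>I. (g has_vector_derivative g' t) (at t)" "times_differentiable I n g'" by auto
  with Suc.IH show ?case
    by (auto intro!: exI[of _ "\<lambda>t. (f' t, g' t)"] has_vector_derivative_Pair)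
qed simp

text \<open>By the chain rule the derivative is a sum of expressions of the same shape, with
  \<open>y'\<close> as an additional slot or one slot differentiated. The induction therefore has to
  run over all lists \<open>us\<close>.\<close>

lemma times_differentiable_tower:
  assumes D: "derivative_tower S D" and S: "\<And>t. t \<in> I \<Longrightarrow> y t \<in> S"
    and y: "times_differentiable I n y"
    and us: "\<And>u. u \<in> set us \<Longrightarrow> times_differentiable I n u"
  shows "times_differentiable I n (\<lambda>t. D (y t) (map (\<lambda>u. u t) us))"
  using y us
proof (induction n arbitrary: us)
  case (Suc n)
  obtain y' where y': "\<And>t. t \<in> I \<Longrightarrow> (y has_vector_derivative y' t) (at t)" "times_differentiable I n y'"
    using Suc.prems by auto
  have "\<forall>u\<in>set us. \<exists>u'. (\<forall>t\<in>I. (u has_vector_derivative u' t) (at t)) \<and> times_differentiable I n u'"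
    using Suc.prems by simp
  then obtain d where d: "\<And>u t. u \<in> set us \<Longrightarrow> t \<in> I \<Longrightarrow> (u has_vector_derivative d u t) (at t)"
      "\<And>u. u \<in> set us \<Longrightarrow> times_differentiable I n (d u)"
    by metis
  have yn: "times_differentiable I n y" and un: "\<And>u. u \<in> set us \<Longrightarrow> times_differentiable I n u"
    using Suc.prems times_differentiable_Suc_D by blast+
  have 1: "times_differentiable I n (\<lambda>t. D (y t) (y' t # map (\<lambda>u. u t) us))"
    using Suc.IH[OF yn, of "y' # us"] y'(2) un by auto
  have 2: "times_differentiable I n (\<lambda>t. D (y t) ((map (\<lambda>u. u t) us)[i := d (us ! i) t]))" if "i < length us" for i
  proof -
    have "times_differentiable I n u" if "u \<in> set (us[i := d (us ! i)])" for u
      using set_update_subset_insert[of us i "d (us ! i)"] that un d(2) \<open>i < length us\<close> by auto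
    then show ?thesis using Suc.IH[OF yn, of "us[i := d (us ! i)]"] by (simp add: map_update)
  qed
  define g where "g t = D (y t) (y' t # map (\<lambda>u. u t) us)
    + (\<Sum>i<length us. D (y t) ((map (\<lambda>u. u t) us)[i := d (us ! i) t]))" for t
  have "((\<lambda>t. D (y t) (map (\<lambda>u. u t) us)) has_vector_derivative g t) (at t)" if t: "t \<in> I" for t
    unfolding g_def by (rule derivative_tower_chain[OF D S[OF t] y'(1)[OF t], of _ "\<lambda>u. d u t"]) (rule d(1)[OF _ t])
  moreover have "times_differentiable I n g"
    unfolding g_def using 1 2 by (intro times_differentiable_add times_differentiable_sum) auto
  ultimately show ?case by auto
qed simp

text \<open>A \<open>k\<close>-linear map on the reals is a constant vector times the product of its
  arguments, so the iterated derivatives \<open>g k\<close> already determine a tower.\<close>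

lemma times_differentiable_smooth_on:
  fixes f :: "real \<Rightarrow> 'a::real_normed_vector"
  assumes I: "open I" and f: "\<And>n. times_differentiable I n f"
  shows "smooth_on I f"
proof -
  define g where "g k = ((\<lambda>f t. vector_derivative f (at t)) ^^ k) f" for k
  \<comment> \<open>On an open set derivatives depend only on the values there, so the iterates of
    \<open>vector_derivative\<close> may be exchanged for the existential witnesses.\<close>
  have td: "times_differentiable I n h \<longleftrightarrow> times_differentiable I n h'" if "\<And>t. t \<in> I \<Longrightarrow> h t = h' t"
    for n and h h' :: "real \<Rightarrow> 'a"
  proof -
    have "(h has_vector_derivative d) (at t) \<longleftrightarrow> (h' has_vector_derivative d) (at t)" if "t \<in> I" for t d
      using has_vector_derivative_transform_within_open[OF _ I that] \<open>\<And>t. t \<in> I \<Longrightarrow> h t = h' t\<close> by metis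
    then show ?thesis by (cases n) auto
  qed
  have gn: "times_differentiable I n (g k)" for n k
  proof (induction k arbitrary: n)
    case 0 then show ?case using f by (simp add: g_def)
  next
    case (Suc k)
    obtain h where h: "\<And>t. t \<in> I \<Longrightarrow> (g k has_vector_derivative h t) (at t)" "times_differentiable I n h"
      using Suc[of "Suc n"] by auto
    then have "g (Suc k) t = h t" if "t \<in> I" for t
      using that by (simp add: g_def vector_derivative_at)
    with td h(2) show ?case by blast
  qed
  have gd: "(g k has_vector_derivative g (Suc k) t) (at t)" if "t \<in> I" for k t
  proof -
    have "\<exists>h. \<forall>t\<in>I. (g k has_vector_derivative h t) (at t)"
      using gn[of "Suc 0" k] by simp
    then obtain h where h: "\<forall>t\<in>I. (g k has_vector_derivative h t) (at t)" ..
    then have "(g k has_vector_derivative h t) (at t)" using that by simp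
    moreover from vector_derivative_at[OF this] have "g (Suc k) t = h t" by (simp add: g_def)
    ultimately show ?thesis by simp
  qed
  define D where "D t vs = prod_list vs *\<^sub>R g (length vs) t" for t and vs :: "real list"
  have abs_prod: "(\<Prod>v\<leftarrow>vs. norm v) = norm (prod_list vs)" for vs :: "real list"
    by (induction vs) (auto simp: abs_mult)
  have "derivative_tower I D" unfolding derivative_tower_def
  proof (intro conjI allI ballI impI)
    fix k t assume t: "t \<in> I"
    have "linear (\<lambda>v. D t (vs[i := v]))" if i: "i < length vs" for vs i
    proof -
      have "prod_list (vs[i := v]) = v * (prod_list (take i vs) * prod_list (drop (Suc i) vs))" for v
        using i by (simp add: upd_conv_take_nth_drop)
      then show ?thesis
        unfolding D_def by (intro linearI) (auto simp: algebra_simps)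
    qed
    then show "bounded_multilinear k (D t)"
      unfolding bounded_multilinear_def D_def abs_prod by (auto intro!: exI[of _ "norm (g k t)"])
    fix e :: real assume "e > 0"
    then obtain d where d: "d > 0" "\<And>s. norm (s - t) < d \<Longrightarrow> norm (g k s - g k t - (s - t) *\<^sub>R g (Suc k) t) \<le> e * norm (s - t)"
      using gd[OF t, of k] unfolding has_vector_derivative_def has_derivative_at_alt by meson
    have "norm (D s vs - D t vs - D t ((s - t) # vs)) \<le> e * norm (s - t) * (\<Prod>v\<leftarrow>vs. norm v)"
      if "norm (s - t) < d" "length vs = k" for s vs
    proof -
      have "D s vs - D t vs - D t ((s - t) # vs) = prod_list vs *\<^sub>R (g k s - g k t - (s - t) *\<^sub>R g (Suc k) t)"
        using that(2) by (simp add: D_def algebra_simps)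
      then show ?thesis
        using mult_left_mono[OF d(2)[OF that(1)], of "norm (prod_list vs)"]
        unfolding abs_prod by (simp add: mult_ac)
    qed
    then show "\<exists>\<delta>>0. \<forall>y\<in>I. norm (y - t) < \<delta> \<longrightarrow> (\<forall>vs. length vs = k \<longrightarrow>
       norm (D y vs - D t vs - D t ((y - t) # vs)) \<le> e * norm (y - t) * (\<Prod>v\<leftarrow>vs. norm v))"
      using d(1) by blast
  qed (rule I)
  moreover have "D t [] = f t" for t by (simp add: D_def g_def)
  ultimately show ?thesis using I unfolding smooth_on_iff_tower by blast
qed

lemma smooth_on_has_derivative:
  assumes "smooth_on S f" "x \<in> S"
  shows "\<exists>f'. (f has_derivative f') (at x)"
proof -
  obtain D where D: "derivative_tower S D" "\<And>x. x \<in> S \<Longrightarrow> D x [] = f x" "open S"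
    using assms unfolding smooth_on_iff_tower by blast
  have "(f has_derivative (\<lambda>h. D x [h])) (at x)"
    by (rule has_derivative_transform_within_open[OF derivative_tower_has_derivative[OF D(1) assms(2)]])
      (use D assms(2) in auto)
  then show ?thesis by (rule exI[where x = "\<lambda>h. D x [h]"])
qed

section \<open>Powers in coordinates around the identity\<close>

lemma mult_inverse_cancel_of_nat: "n > 0 \<Longrightarrow> real n * (inverse (real n) * c) = c"
  by simp

text \<open>Replaces a real multiple by integer exponents divided by \<open>k\<close>, so that
  powers can approximate real multiples of a vector.\<close>

lemma floor_div_tendsto:
  fixes s :: real
  assumes "s \<ge> 0"
  shows "(\<lambda>k. real (nat \<lfloor>s * real k\<rfloor>) / real k) \<longlonglongrightarrow> s"
proof -
  have "(\<lambda>k. real (nat \<lfloor>s * real k\<rfloor>) / real k - s) \<longlonglongrightarrow> 0"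
  proof (rule Lim_null_comparison)
    show "\<forall>\<^sub>F k in sequentially. norm (real (nat \<lfloor>s * real k\<rfloor>) / real k - s) \<le> inverse (real k)"
    proof (rule eventually_sequentiallyI[of 1])
      fix k :: nat assume k: "1 \<le> k"
      have "real (nat \<lfloor>s * real k\<rfloor>) = of_int \<lfloor>s * real k\<rfloor>" using assms by simp
      then have "\<bar>real (nat \<lfloor>s * real k\<rfloor>) - s * real k\<bar> \<le> 1" by linarith
      moreover have "real (nat \<lfloor>s * real k\<rfloor>) / real k - s = (real (nat \<lfloor>s * real k\<rfloor>) - s * real k) / real k"
        using k by (simp add: field_simps)
      ultimately show "norm (real (nat \<lfloor>s * real k\<rfloor>) / real k - s) \<le> inverse (real k)"
        using k by (simp add: divide_simps)
    qed
    show "(\<lambda>k. inverse (real k)) \<longlonglongrightarrow> 0" by (rule lim_inverse_n)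
  qed
  then show ?thesis by (simp add: LIM_zero_iff)
qed

lemma norm_divideR:
  fixes v :: "'a::real_normed_vector"
  shows "norm (v /\<^sub>R real n) = norm v / real n"
  by (simp add: divide_inverse_commute)

section \<open>Abstract coordinates at the identity\<close>

text \<open>Isolates what the construction of the exponential needs: no derivative occurs any more.
  \<open>lam\<close> is the translated chart and \<open>q\<close> its inverse. The two estimates say
  that the error \<open>x * y - x - y\<close> is Lipschitz in each variable with a constant
  proportional to the other. For inverses a purely qualitative condition suffices, because
  \<open>coord_exp_uminus\<close> derives the estimate from the product.\<close>

locale local_coordinates = group G for G :: "('g, 'm) monoid_scheme" (structure) +
  fixes U :: "'g set" and lam :: "'g \<Rightarrow> 'e::banach" and q :: "'e \<Rightarrow> 'g" and R C :: real
  assumes U_carrier: "U \<subseteq> carrier G"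
    and one_in_U: "\<one> \<in> U" and lam_one: "lam \<one> = 0"
    and q_lam: "g \<in> U \<Longrightarrow> q (lam g) = g"
    and R_pos: "R > 0" and C_pos: "C > 0"
    and q_in_U: "norm x < R \<Longrightarrow> q x \<in> U" and lam_q: "norm x < R \<Longrightarrow> lam (q x) = x"
    and mult_in_U: "norm x < R \<Longrightarrow> norm y < R \<Longrightarrow> q x \<otimes> q y \<in> U"
    and mult_left_estimate: "norm x < R \<Longrightarrow> norm x' < R \<Longrightarrow> norm y < R \<Longrightarrow>
      norm (lam (q x \<otimes> q y) - lam (q x' \<otimes> q y) - (x - x')) \<le> C * norm (x - x') * norm y"
    and mult_right_estimate: "norm x < R \<Longrightarrow> norm y < R \<Longrightarrow> norm y' < R \<Longrightarrow>
      norm (lam (q x \<otimes> q y) - lam (q x \<otimes> q y') - (y - y')) \<le> C * norm x * norm (y - y')"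
    and inv_small: "\<exists>\<delta>>0. \<forall>x. norm x < \<delta> \<longrightarrow> inv (q x) \<in> U \<and> norm (lam (inv (q x))) < R"
begin

lemma q_zero: "q 0 = \<one>"
  using q_lam[OF one_in_U] lam_one by simp

lemma q_carrier: "norm x < R \<Longrightarrow> q x \<in> carrier G"
  using q_in_U U_carrier by blast

lemma q_mult:
  "norm x < R \<Longrightarrow> norm y < R \<Longrightarrow> q (lam (q x \<otimes> q y)) = q x \<otimes> q y"
  using q_lam mult_in_U by blast

lemma norm_mult_le:
  assumes "norm x < R" "norm y < R"
  shows "norm (lam (q x \<otimes> q y) - (x + y)) \<le> C * norm x * norm y"
proof -
  have "lam (q x \<otimes> q 0) = x" using assms q_zero q_carrier lam_q by simp
  then show ?thesis using mult_right_estimate[of x y 0] assms R_pos by (simp add: algebra_simps)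
qed

text \<open>The admissible size of \<open>n * norm x\<close> for which the powers \<open>q x [^] n\<close> are controlled.\<close>

definition r where "r = min (R / 4) (1 / (4 * C))"

text \<open>Powers will have coordinates of norm at most \<open>2 * r\<close>, which
  \<open>4 * r \<le> R\<close> keeps inside the domain; \<open>4 * C * r \<le> 1\<close> makes
  quadratic errors at most a fixed fraction of the linear terms.\<close>

lemma r_pos: "r > 0" and r_R: "4 * r \<le> R" and r_C: "4 * C * r \<le> 1"
  using R_pos C_pos by (auto simp: r_def min_def field_simps)

section \<open>Estimates for the power maps\<close>

definition coord_power where "coord_power n x = lam (q x [^] (n::nat))"

lemma small_less_R: "real n * norm x \<le> r \<Longrightarrow> n > 0 \<Longrightarrow> norm x < R"
proof -
  assume a: "real n * norm x \<le> r" "n > 0"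
  have "norm x \<le> real n * norm x" using a(2) by (simp add: mult_le_cancel_right1)
  then show "norm x < R" using a r_R r_pos by linarith
qed

lemma coord_power_0: "coord_power 0 x = 0" by (simp add: coord_power_def lam_one)

text \<open>The three claims support each other: membership in \<open>U\<close> makes the coordinate
  meaningful, and the norm bound admits the next multiplication. Each factor adds
  \<open>norm x\<close> plus an error \<open>C * norm x * 2 * r\<close>, hence at most
  \<open>2 * norm x\<close>.\<close>

lemma q_pow:
  assumes "real n * norm x \<le> r"
  shows "q (coord_power n x) = q x [^] n \<and> q x [^] n \<in> U \<and> norm (coord_power n x) \<le> 2 * (real n * norm x)"
  using assms
proof (induction n)
  case 0
  then show ?case by (simp add: coord_power_0 q_zero one_in_U)
next
  case (Suc n)
  have xR: "norm x < R" using small_less_R[OF Suc.prems] by simp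
  have le: "real n * norm x \<le> r" using Suc.prems by (simp add: algebra_simps) (smt (verit) norm_ge_zero)
  note IH = Suc.IH[OF le]
  have PR: "norm (coord_power n x) < R" using IH le r_R r_pos by linarith
  have e: "q x [^] Suc n = q x \<otimes> q (coord_power n x)"
    using IH nat_pow_Suc2[OF q_carrier[OF xR], of n] by simp
  have "norm (coord_power (Suc n) x - (x + coord_power n x)) \<le> C * norm x * norm (coord_power n x)"
    using norm_mult_le[OF xR PR] unfolding coord_power_def[of "Suc n"] e .
  also have "\<dots> \<le> C * norm x * (2 * r)"
    using IH le C_pos by (intro mult_left_mono) auto
  also have "\<dots> = (4 * C * r) * norm x / 2" by simp
  also have "\<dots> \<le> norm x"
    using mult_right_mono[OF r_C norm_ge_zero[of x]] norm_ge_zero[of x] by linarith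
  finally have "norm (coord_power (Suc n) x) \<le> 2 * (real (Suc n) * norm x)"
    using IH norm_triangle_sub[of "coord_power (Suc n) x" "x + coord_power n x"] norm_triangle_ineq[of x "coord_power n x"]
    by (simp add: algebra_simps)
  moreover have "q x [^] Suc n \<in> U" unfolding e using mult_in_U[OF xR PR] .
  ultimately show ?case by (simp add: coord_power_def q_lam del: nat_pow_Suc)
qed

lemma coord_power_Suc:
  assumes "real (Suc n) * norm x \<le> r"
  shows "coord_power (Suc n) x = lam (q x \<otimes> q (coord_power n x))"
proof -
  have xR: "norm x < R" using small_less_R[OF assms] by simp
  have le: "real n * norm x \<le> r" using assms by (simp add: algebra_simps) (smt (verit) norm_ge_zero)
  show ?thesis
    using q_pow[OF le] nat_pow_Suc2[OF q_carrier[OF xR], of n] by (simp add: coord_power_def)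
qed

lemma norm_coord_power_less_R: "real n * norm x \<le> r \<Longrightarrow> norm (coord_power n x) < R"
  using q_pow[of n x] r_R r_pos by linarith

text \<open>The central estimate: its constant grows like \<open>n\<^sup>2 * M\<close>, which is
  \<open>n\<close> times a quantity that stays bounded while \<open>n * M \<le> r\<close>. A common
  bound \<open>M\<close> is kept apart from both norms so that it can be chosen later.\<close>

lemma coord_power_diff_estimate:
  assumes "real n * norm x \<le> r" "real n * norm y \<le> r" "norm x \<le> M" "norm y \<le> M" "real n * M \<le> r"
  shows "norm (coord_power n x - coord_power n y - real n *\<^sub>R (x - y)) \<le> 2 * C * (real n)\<^sup>2 * M * norm (x - y)"
  using assms
proof (induction n)
  case 0
  then show ?case by (simp add: coord_power_0)
next
  case (Suc n)
  have M0: "0 \<le> M" using Suc.prems(3) norm_ge_zero order_trans by blast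
  have le: "real n * norm x \<le> r" "real n * norm y \<le> r" "real n * M \<le> r"
    using Suc.prems(1,2,5) M0 by (simp_all add: algebra_simps) (smt (verit) norm_ge_zero)+
  note IH = Suc.IH[OF le(1,2) Suc.prems(3,4) le(3)]
  have xR: "norm x < R" "norm y < R" using small_less_R Suc.prems by blast+
  have PR: "norm (coord_power n x) < R" "norm (coord_power n y) < R" using le norm_coord_power_less_R by auto
  define d where "d = norm (x - y)"
  have d0: "d \<ge> 0" by (simp add: d_def)
  have nM: "2 * C * (real n * M) \<le> 1"
  proof -
    have "2 * C * (real n * M) \<le> 2 * C * r" using le(3) C_pos by (intro mult_left_mono) auto
    also have "\<dots> \<le> 1" using r_C C_pos r_pos mult_pos_pos[of C r] by linarith
    finally show ?thesis .
  qed
  have Pd: "norm (coord_power n x - coord_power n y) \<le> 2 * (real n * d)"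
  proof -
    have "norm (coord_power n x - coord_power n y) \<le> norm (coord_power n x - coord_power n y - real n *\<^sub>R (x - y)) + norm (real n *\<^sub>R (x - y))"
      by (metis add.commute norm_triangle_sub)
    also have "\<dots> \<le> 2 * C * (real n)\<^sup>2 * M * d + real n * d"
      using IH by (simp add: d_def)
    also have "2 * C * (real n)\<^sup>2 * M * d = (2 * C * (real n * M)) * (real n * d)"
      by (simp add: power2_eq_square)
    also have "\<dots> \<le> 1 * (real n * d)"
      using nM d0 by (intro mult_right_mono) auto
    finally show ?thesis by (simp add: mult_ac)
  qed
  define u where "u = lam (q x \<otimes> q (coord_power n x)) - lam (q x \<otimes> q (coord_power n y)) - (coord_power n x - coord_power n y)"
  define v where "v = lam (q x \<otimes> q (coord_power n y)) - lam (q y \<otimes> q (coord_power n y)) - (x - y)"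
  define w where "w = coord_power n x - coord_power n y - real n *\<^sub>R (x - y)"
  have "norm (coord_power (Suc n) x - coord_power (Suc n) y - real (Suc n) *\<^sub>R (x - y)) = norm (u + v + w)"
    unfolding coord_power_Suc[OF Suc.prems(1)] coord_power_Suc[OF Suc.prems(2)] by (simp add: u_def v_def w_def algebra_simps)
  also have "\<dots> \<le> norm u + norm v + norm w"
    by (rule norm_triangle_mono[OF norm_triangle_ineq order_refl])
  also have "norm u \<le> C * norm x * norm (coord_power n x - coord_power n y)"
    unfolding u_def by (rule mult_right_estimate[OF xR(1) PR])
  also have "norm v \<le> C * d * norm (coord_power n y)"
    unfolding v_def d_def by (rule mult_left_estimate[OF xR PR(2)])
  also have "norm w \<le> 2 * C * (real n)\<^sup>2 * M * d"
    unfolding w_def d_def by (rule IH)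
  also have "C * norm x * norm (coord_power n x - coord_power n y) \<le> C * M * (2 * (real n * d))"
    using C_pos Suc.prems(3) M0 Pd by (intro mult_mono) auto
  also have "C * d * norm (coord_power n y) \<le> C * d * (2 * (real n * M))"
  proof (rule mult_left_mono)
    have "norm (coord_power n y) \<le> 2 * (real n * norm y)" using q_pow le by blast
    also have "\<dots> \<le> 2 * (real n * M)" using Suc.prems(4) by (simp add: mult_left_mono)
    finally show "norm (coord_power n y) \<le> 2 * (real n * M)" .
  qed (use C_pos d0 in simp)
  \<comment> \<open>The new errors amount to \<open>4 * C * n * M * d\<close>, and the square pays
    for them because \<open>2 * ((n + 1)\<^sup>2 - n\<^sup>2) = 4 * n + 2\<close>.\<close>
  also have "C * M * (2 * (real n * d)) + C * d * (2 * (real n * M)) + 2 * C * (real n)\<^sup>2 * M * d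
      \<le> 2 * C * (real (Suc n))\<^sup>2 * M * d"
  proof -
    have "2 * C * (real (Suc n))\<^sup>2 * M * d = C * M * (2 * (real n * d)) + C * d * (2 * (real n * M)) + 2 * C * (real n)\<^sup>2 * M * d + 2 * C * M * d"
      by (simp add: power2_eq_square algebra_simps)
    moreover have "0 \<le> 2 * C * M * d" using C_pos M0 d0 by simp
    ultimately show ?thesis by linarith
  qed
  finally show ?case unfolding d_def by this simp_all
qed

text \<open>With \<open>M\<close> the larger of the two norms,
  \<open>2 * C * n * M \<le> 2 * C * r \<le> 1 / 2\<close>, so the quadratic error is half of the
  linear term.\<close>

lemma coord_power_lipschitz:
  assumes "real n * norm x \<le> r" "real n * norm y \<le> r"
  shows "norm (coord_power n x - coord_power n y - real n *\<^sub>R (x - y)) \<le> real n * norm (x - y) / 2"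
proof -
  define M where "M = max (norm x) (norm y)"
  have nM: "real n * M \<le> r" using assms by (auto simp: M_def max_def)
  have M0: "M \<ge> 0" by (simp add: M_def le_max_iff_disj)
  have "norm (coord_power n x - coord_power n y - real n *\<^sub>R (x - y)) \<le> 2 * C * (real n)\<^sup>2 * M * norm (x - y)"
    by (rule coord_power_diff_estimate[OF assms _ _ nM]) (auto simp: M_def)
  also have "\<dots> = (2 * C * (real n * M)) * (real n * norm (x - y))"
    by (simp add: power2_eq_square)
  also have "\<dots> \<le> (1/2) * (real n * norm (x - y))"
  proof (rule mult_right_mono)
    have "2 * C * (real n * M) \<le> 2 * C * r" using nM C_pos by (intro mult_left_mono) auto
    also have "\<dots> \<le> 1/2" using r_C by simp
    finally show "2 * C * (real n * M) \<le> 1/2" .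
  qed simp
  finally show ?thesis by simp
qed

lemma coord_power_lipschitz':
  assumes "real n * norm x \<le> r" "real n * norm y \<le> r"
  shows "norm (coord_power n x - coord_power n y) \<le> 3 / 2 * (real n * norm (x - y))"
  using coord_power_lipschitz[OF assms] norm_triangle_sub[of "coord_power n x - coord_power n y" "real n *\<^sub>R (x - y)"]
  by simp

lemma coord_power_linear_error:
  assumes "real n * norm x \<le> r"
  shows "norm (coord_power n x - real n *\<^sub>R x) \<le> 2 * C * (real n * norm x)\<^sup>2"
proof -
  have "coord_power n 0 = 0" by (simp add: coord_power_def q_zero lam_one)
  then show ?thesis
    using coord_power_diff_estimate[of n x 0 "norm x"] assms r_pos by (simp add: power2_eq_square mult_ac)
qed

lemma coord_power_mult:
  assumes "real (n * k) * norm x \<le> r" "real n * (2 * (real k * norm x)) \<le> r"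
  shows "coord_power (n * k) x = coord_power n (coord_power k x)"
proof (cases "n * k = 0")
  case True
  then show ?thesis by (auto simp: coord_power_0) (simp add: coord_power_def q_zero lam_one)
next
  case False
  have xR: "norm x < R" using small_less_R[OF assms(1)] False by simp
  have "real k * norm x \<le> real (n * k) * norm x" using False
    by (intro mult_right_mono) auto
  then have k: "q (coord_power k x) = q x [^] k" using q_pow[of k x] assms by simp
  then have "q (coord_power k x) [^] n = q x [^] (n * k)"
    using nat_pow_pow[OF q_carrier[OF xR], of k n] by (simp add: mult.commute)
  then show ?thesis by (simp add: coord_power_def)
qed

text \<open>The power of order \<open>n * k\<close> is the \<open>n\<close>-th power of a
  \<open>k\<close>-th power, and the latter is \<open>X / n\<close> up to
  \<open>2 * C * (norm X / n)\<^sup>2\<close>. The \<open>n\<close>-th power stretches this by at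
  most \<open>3 / 2 * n\<close>. The restriction to \<open>r / 2\<close> leaves room for the factor
  2 in the norm of the inner power.\<close>

lemma coord_power_refine:
  assumes "norm X \<le> r / 2" "n > 0" "k > 0"
  shows "norm (coord_power (n * k) (X /\<^sub>R real (n * k)) - coord_power n (X /\<^sub>R real n)) \<le> 3 * C * (norm X)\<^sup>2 / real n"
proof -
  define z where "z = X /\<^sub>R real (n * k)"
  have nz: "real (n * k) * norm z = norm X" using assms by (auto simp: z_def divide_simps)
  have kz: "real k * norm z = norm X / real n" using assms by (simp add: z_def field_simps)
  have kz': "real k *\<^sub>R z = X /\<^sub>R real n"
    unfolding z_def scaleR_scaleR using assms by (intro arg_cong2[of _ _ _ _ scaleR]) (auto simp: divide_simps)
  have Xr: "norm X \<le> r" using assms(1) r_pos norm_ge_zero[of X] by linarith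
  have "norm X / real n \<le> norm X" using assms(2)
    by (simp add: divide_le_eq mult_le_cancel_left1)
  then have kr: "real k * norm z \<le> r" unfolding kz using Xr by linarith
  have e: "coord_power (n * k) z = coord_power n (coord_power k z)"
    using assms Xr nz kz by (intro coord_power_mult) auto
  have "norm (coord_power k z) \<le> 2 * (norm X / real n)" using q_pow[OF kr] kz by simp
  then have "real n * norm (coord_power k z) \<le> real n * (2 * (norm X / real n))" by (intro mult_left_mono) auto
  then have n1: "real n * norm (coord_power k z) \<le> r" using assms by simp
  have n2: "real n * norm (X /\<^sub>R real n) \<le> r" using assms Xr by (simp add: mult_inverse_cancel_of_nat)
  have "norm (coord_power n (coord_power k z) - coord_power n (X /\<^sub>R real n)) \<le> 3/2 * (real n * norm (coord_power k z - X /\<^sub>R real n))"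
    using coord_power_lipschitz'[OF n1 n2] .
  also have "\<dots> \<le> 3/2 * (real n * (2 * C * (norm X / real n)\<^sup>2))"
    using coord_power_linear_error[OF kr] unfolding kz kz' by (intro mult_left_mono) auto
  also have "3/2 * (real n * (2 * C * (norm X / real n)\<^sup>2)) = 3 * C * (norm X)\<^sup>2 / real n"
    using assms by (simp add: power2_eq_square)
  finally show ?thesis unfolding e[symmetric] by (simp only: z_def)
qed

section \<open>The exponential in coordinates as a limit of powers\<close>

text \<open>Convergence is established for \<open>norm X \<le> r / 2\<close>; the estimates below
  carry this bound.\<close>

definition coord_exp where "coord_exp X = lim (\<lambda>n. coord_power n (X /\<^sub>R real n))"

text \<open>The terms of index \<open>m\<close> and \<open>n\<close> are both compared with the one
  of index \<open>m * n\<close>, at a cost of \<open>K / m\<close> and \<open>K / n\<close>.\<close>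

lemma coord_power_tendsto_coord_exp:
  assumes X: "norm X \<le> r / 2"
  shows "(\<lambda>n. coord_power n (X /\<^sub>R real n)) \<longlonglongrightarrow> coord_exp X"
proof -
  define f where "f n = coord_power n (X /\<^sub>R real n)" for n
  define K where "K = 3 * C * (norm X)\<^sup>2"
  have K0: "K \<ge> 0" using C_pos by (simp add: K_def)
  have est: "norm (f m - f n) \<le> K / real m + K / real n" if "m > 0" "n > 0" for m n
  proof -
    have "norm (f (m * n) - f m) \<le> K / real m" "norm (f (m * n) - f n) \<le> K / real n"
      using coord_power_refine[OF X that] coord_power_refine[OF X that(2,1)] by (simp_all add: f_def K_def mult.commute[of n m])
    then show ?thesis
      using norm_triangle_ineq4[of "f (m * n) - f n" "f (m * n) - f m"] by simp
  qed
  have "Cauchy f"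
  proof (rule CauchyI)
    fix \<epsilon> :: real assume e: "\<epsilon> > 0"
    obtain N :: nat where N: "real N > 2 * (K + 1) / \<epsilon>" using reals_Archimedean2 by blast
    have "2 * (K + 1) / \<epsilon> > 0" using K0 e by simp
    then have N0: "real N > 0" using N by linarith
    have lt: "K / real m < \<epsilon> / 2" if "m \<ge> N" for m
    proof -
      have "real m > 2 * (K + 1) / \<epsilon>" using N that by linarith
      then have "\<epsilon> * real m > 2 * (K + 1)" using e by (simp add: field_simps)
      moreover have "real m > 0" using N0 that by simp
      ultimately show ?thesis using K0 by (simp add: field_simps)
    qed
    have "norm (f m - f n) < \<epsilon>" if "m \<ge> N" "n \<ge> N" for m n
    proof -
      have "m > 0" "n > 0" using N0 that by auto
      then show ?thesis using est[of m n] lt[OF that(1)] lt[OF that(2)] by linarith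
    qed
    then show "\<exists>M. \<forall>m\<ge>M. \<forall>n\<ge>M. norm (f m - f n) < \<epsilon>" by blast
  qed
  then have "f \<longlonglongrightarrow> lim f" by (simp add: Cauchy_convergent_iff convergent_LIMSEQ_iff)
  then show ?thesis by (simp add: coord_exp_def f_def[abs_def])
qed

text \<open>Passes to the limit in \<open>coord_power_refine\<close> along the multiples of a fixed
  \<open>n\<close>, with \<open>x = X / n\<close>.\<close>

lemma coord_power_coord_exp_error:
  assumes "real n * norm x \<le> r / 2"
  shows "norm (coord_power n x - coord_exp (real n *\<^sub>R x)) \<le> 3 * C * (real n * norm x) * norm x"
proof (cases "n = 0")
  case True
  have "coord_exp 0 = 0"
    using LIMSEQ_unique[OF coord_power_tendsto_coord_exp[of 0]] r_pos by (simp add: coord_power_def q_zero lam_one)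
  then show ?thesis using True by (simp add: coord_power_0)
next
  case False
  define X where "X = real n *\<^sub>R x"
  have X: "norm X \<le> r / 2" using assms by (simp add: X_def)
  have x: "X /\<^sub>R real n = x" using False by (simp add: X_def)
  have "(\<lambda>k. coord_power (n * Suc k) (X /\<^sub>R real (n * Suc k))) \<longlonglongrightarrow> coord_exp X"
  proof (rule LIMSEQ_subseq_LIMSEQ[OF coord_power_tendsto_coord_exp[OF X], unfolded o_def])
    show "strict_mono (\<lambda>k. n * Suc k)" using False by (auto simp: strict_mono_def)
  qed
  then have "(\<lambda>k. norm (coord_power (n * Suc k) (X /\<^sub>R real (n * Suc k)) - coord_power n x)) \<longlonglongrightarrow> norm (coord_exp X - coord_power n x)"
    by (intro tendsto_intros)
  then have "norm (coord_exp X - coord_power n x) \<le> 3 * C * (norm X)\<^sup>2 / real n"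
  proof (rule LIMSEQ_le_const2, intro exI allI impI)
    fix k show "norm (coord_power (n * Suc k) (X /\<^sub>R real (n * Suc k)) - coord_power n x) \<le> 3 * C * (norm X)\<^sup>2 / real n"
      using coord_power_refine[OF X, of n "Suc k"] False x by simp
  qed
  also have "\<dots> = 3 * C * (real n * norm x) * norm x"
    using False by (simp add: X_def power2_eq_square)
  finally show ?thesis by (simp add: X_def norm_minus_commute)
qed

text \<open>Scaling the arguments by \<open>1 / n\<close> cancels the factor \<open>n\<close> in
  \<open>coord_power_lipschitz\<close>, so the bound survives the limit: \<open>coord_exp\<close> is
  the identity plus a map with Lipschitz constant 1/2.\<close>

lemma coord_exp_diff_estimate:
  assumes "norm X \<le> r / 2" "norm Y \<le> r / 2"
  shows "norm (coord_exp X - coord_exp Y - (X - Y)) \<le> norm (X - Y) / 2"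
proof -
  have lim: "(\<lambda>n. norm (coord_power n (X /\<^sub>R real n) - coord_power n (Y /\<^sub>R real n) - (X - Y))) \<longlonglongrightarrow> norm (coord_exp X - coord_exp Y - (X - Y))"
    by (intro tendsto_intros coord_power_tendsto_coord_exp assms)
  show ?thesis
  proof (rule LIMSEQ_le_const2[OF lim], intro exI allI impI)
    fix n :: nat assume n: "1 \<le> n"
    have "real n *\<^sub>R (X /\<^sub>R real n - Y /\<^sub>R real n) = X - Y"
      using n by (simp add: scaleR_diff_right)
    moreover have "real n * norm (X /\<^sub>R real n - Y /\<^sub>R real n) = norm (X - Y)"
      using n by (simp flip: scaleR_diff_right)
    moreover have "real n * norm (X /\<^sub>R real n) \<le> r" "real n * norm (Y /\<^sub>R real n) \<le> r"
      using n assms r_pos by (simp_all add: mult_inverse_cancel_of_nat)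
    ultimately show "norm (coord_power n (X /\<^sub>R real n) - coord_power n (Y /\<^sub>R real n) - (X - Y)) \<le> norm (X - Y) / 2"
      using coord_power_lipschitz[of n "X /\<^sub>R real n" "Y /\<^sub>R real n"] by simp
  qed
qed

lemma coord_exp_zero: "coord_exp 0 = 0"
  using LIMSEQ_unique[OF coord_power_tendsto_coord_exp[of 0]] r_pos by (simp add: coord_power_def q_zero lam_one)

lemma coord_exp_lipschitz:
  assumes "norm X \<le> r / 2" "norm Y \<le> r / 2"
  shows "norm (coord_exp X - coord_exp Y) \<le> 3 / 2 * norm (X - Y)"
  using coord_exp_diff_estimate[OF assms] norm_triangle_sub[of "coord_exp X - coord_exp Y" "X - Y"] by simp

lemma norm_coord_exp_le: "norm X \<le> r / 2 \<Longrightarrow> norm (coord_exp X) \<le> 3 / 2 * norm X"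
  using coord_exp_lipschitz[of X 0] coord_exp_zero r_pos by simp

lemma coord_exp_linear_error: "norm X \<le> r / 2 \<Longrightarrow> norm (coord_exp X - X) \<le> 3 * C * (norm X)\<^sup>2"
proof -
  assume X: "norm X \<le> r / 2"
  then have "norm X < R" using r_R r_pos by linarith
  then have "coord_power 1 X = X" using lam_q q_carrier by (simp add: coord_power_def)
  then show ?thesis using coord_power_coord_exp_error[of 1 X] X by (simp add: norm_minus_commute power2_eq_square mult_ac)
qed

lemma norm_coord_exp_less_R: "norm X \<le> r / 2 \<Longrightarrow> norm (coord_exp X) < R"
  using norm_coord_exp_le[of X] r_R r_pos by linarith

text \<open>Allowing arbitrary exponents and bases, with only \<open>n k * x k\<close> and
  \<open>x k\<close> prescribed in the limit, lets one statement serve additivity, inverses and the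
  uniqueness of one-parameter subgroups.\<close>

lemma coord_power_tendsto:
  assumes X: "(\<lambda>k. real (n k) *\<^sub>R x k) \<longlonglongrightarrow> X" and x: "x \<longlonglongrightarrow> 0"
    and le: "\<And>k. real (n k) * norm (x k) \<le> r / 2"
  shows "(\<lambda>k. coord_power (n k) (x k)) \<longlonglongrightarrow> coord_exp X"
proof -
  have "(\<lambda>k. norm (real (n k) *\<^sub>R x k)) \<longlonglongrightarrow> norm X" by (rule tendsto_norm[OF X])
  then have Xr: "norm X \<le> r / 2"
    by (rule LIMSEQ_le_const2) (use le in auto)
  have "(\<lambda>k. coord_power (n k) (x k) - coord_exp (real (n k) *\<^sub>R x k)) \<longlonglongrightarrow> 0"
  proof (rule Lim_null_comparison)
    show "\<forall>\<^sub>F k in sequentially. norm (coord_power (n k) (x k) - coord_exp (real (n k) *\<^sub>R x k)) \<le> 3 * C * (r / 2) * norm (x k)"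
    proof (intro always_eventually allI)
      fix k
      have "norm (coord_power (n k) (x k) - coord_exp (real (n k) *\<^sub>R x k)) \<le> 3 * C * (real (n k) * norm (x k)) * norm (x k)"
        by (rule coord_power_coord_exp_error[OF le])
      also have "\<dots> \<le> 3 * C * (r / 2) * norm (x k)"
        using le[of k] C_pos by (intro mult_right_mono mult_left_mono) auto
      finally show "norm (coord_power (n k) (x k) - coord_exp (real (n k) *\<^sub>R x k)) \<le> 3 * C * (r / 2) * norm (x k)" .
    qed
    show "(\<lambda>k. 3 * C * (r / 2) * norm (x k)) \<longlonglongrightarrow> 0"
      using tendsto_mult_right_zero[OF tendsto_norm_zero[OF x]] by blast
  qed
  moreover have "(\<lambda>k. coord_exp (real (n k) *\<^sub>R x k) - coord_exp X) \<longlonglongrightarrow> 0"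
  proof (rule Lim_null_comparison)
    show "\<forall>\<^sub>F k in sequentially. norm (coord_exp (real (n k) *\<^sub>R x k) - coord_exp X) \<le> 3/2 * norm (real (n k) *\<^sub>R x k - X)"
      using coord_exp_lipschitz Xr le by (intro always_eventually allI) simp
    show "(\<lambda>k. 3/2 * norm (real (n k) *\<^sub>R x k - X)) \<longlonglongrightarrow> 0"
      using X by (intro tendsto_mult_right_zero tendsto_norm_zero) (simp add: LIM_zero)
  qed
  ultimately have "(\<lambda>k. (coord_power (n k) (x k) - coord_exp (real (n k) *\<^sub>R x k)) + (coord_exp (real (n k) *\<^sub>R x k) - coord_exp X)) \<longlonglongrightarrow> 0 + 0"
    by (rule tendsto_add)
  then show ?thesis by (simp add: LIM_zero_iff)
qed

lemma mult_continuous: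
  assumes x: "x \<longlonglongrightarrow> a" and y: "y \<longlonglongrightarrow> b"
    and R: "\<And>k. norm (x k) < R" "\<And>k. norm (y k) < R" "norm a < R" "norm b < R"
  shows "(\<lambda>k. lam (q (x k) \<otimes> q (y k))) \<longlonglongrightarrow> lam (q a \<otimes> q b)"
proof -
  have "(\<lambda>k. lam (q (x k) \<otimes> q (y k)) - lam (q a \<otimes> q b)) \<longlonglongrightarrow> 0"
  proof (rule Lim_null_comparison)
    show "\<forall>\<^sub>F k in sequentially. norm (lam (q (x k) \<otimes> q (y k)) - lam (q a \<otimes> q b))
       \<le> (C * R + 1) * norm (x k - a) + (C * R + 1) * norm (y k - b)"
    proof (intro always_eventually allI)
      fix k
      have "norm (lam (q (x k) \<otimes> q (y k)) - lam (q a \<otimes> q (y k))) \<le> (C * R + 1) * norm (x k - a)"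
      proof -
        have "norm (lam (q (x k) \<otimes> q (y k)) - lam (q a \<otimes> q (y k))) \<le> C * norm (x k - a) * norm (y k) + norm (x k - a)"
          using mult_left_estimate[OF R(1)[of k] R(3) R(2)[of k]]
            norm_triangle_sub[of "lam (q (x k) \<otimes> q (y k)) - lam (q a \<otimes> q (y k))" "x k - a"] by linarith
        also have "C * norm (x k - a) * norm (y k) \<le> C * norm (x k - a) * R"
          using R(2)[of k] C_pos by (intro mult_left_mono) auto
        finally show ?thesis by (simp add: algebra_simps)
      qed
      moreover have "norm (lam (q a \<otimes> q (y k)) - lam (q a \<otimes> q b)) \<le> (C * R + 1) * norm (y k - b)"
      proof -
        have "norm (lam (q a \<otimes> q (y k)) - lam (q a \<otimes> q b)) \<le> C * norm a * norm (y k - b) + norm (y k - b)"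
          using mult_right_estimate[OF R(3) R(2)[of k] R(4)]
            norm_triangle_sub[of "lam (q a \<otimes> q (y k)) - lam (q a \<otimes> q b)" "y k - b"] by linarith
        also have "C * norm a * norm (y k - b) \<le> C * R * norm (y k - b)"
          using R(3) C_pos by (intro mult_right_mono mult_left_mono) auto
        finally show ?thesis by (simp add: algebra_simps)
      qed
      ultimately show "norm (lam (q (x k) \<otimes> q (y k)) - lam (q a \<otimes> q b))
       \<le> (C * R + 1) * norm (x k - a) + (C * R + 1) * norm (y k - b)"
        using norm_triangle_ineq[of "lam (q (x k) \<otimes> q (y k)) - lam (q a \<otimes> q (y k))" "lam (q a \<otimes> q (y k)) - lam (q a \<otimes> q b)"]
        by simp
    qed
    have "(\<lambda>k. (C * R + 1) * norm (x k - a) + (C * R + 1) * norm (y k - b)) \<longlonglongrightarrow>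
       (C * R + 1) * norm (a - a) + (C * R + 1) * norm (b - b)"
      by (intro tendsto_intros x y)
    then show "(\<lambda>k. (C * R + 1) * norm (x k - a) + (C * R + 1) * norm (y k - b)) \<longlonglongrightarrow> 0" by simp
  qed
  then show ?thesis by (simp add: LIM_zero_iff)
qed

section \<open>Additivity on lines\<close>

text \<open>For integer exponents the identity is the power law for one element
  \<open>x k = X / k\<close>. The exponents \<open>a k\<close> and \<open>b k\<close> are the
  integer parts of \<open>s * k\<close> and \<open>t * k\<close>, and the identity passes to the
  limit.\<close>

lemma coord_exp_add_nonneg:
  assumes st: "s \<ge> 0" "t \<ge> 0" and le: "(s + t) * norm X \<le> r / 2"
  shows "q (coord_exp (s *\<^sub>R X)) \<otimes> q (coord_exp (t *\<^sub>R X)) = q (coord_exp ((s + t) *\<^sub>R X))"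
proof -
  define a where "a k = nat \<lfloor>s * real k\<rfloor>" for k
  define b where "b k = nat \<lfloor>t * real k\<rfloor>" for k
  define x where "x k = X /\<^sub>R real k" for k :: nat
  have le': "s * norm X \<le> r / 2" "t * norm X \<le> r / 2"
    using le mult_nonneg_nonneg[OF st(1) norm_ge_zero[of X]] mult_nonneg_nonneg[OF st(2) norm_ge_zero[of X]]
    unfolding distrib_right by linarith+
  have ak: "real (a k) * norm (x k) \<le> s * norm X" for k
  proof (cases "k = 0")
    case False
    have "real (a k) \<le> s * real k" using st by (simp add: a_def)
    then have "real (a k) / real k \<le> s" using False by (simp add: divide_le_eq)
    then show ?thesis using mult_right_mono[of "real (a k) / real k" s "norm X"] by (simp add: x_def divide_inverse mult_ac)
  qed (use st in \<open>simp add: x_def\<close>)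
  have bk: "real (b k) * norm (x k) \<le> t * norm X" for k
  proof (cases "k = 0")
    case False
    have "real (b k) \<le> t * real k" using st by (simp add: b_def)
    then have "real (b k) / real k \<le> t" using False by (simp add: divide_le_eq)
    then show ?thesis using mult_right_mono[of "real (b k) / real k" t "norm X"] by (simp add: x_def divide_inverse mult_ac)
  qed (use st in \<open>simp add: x_def\<close>)
  have abk: "real (a k + b k) * norm (x k) \<le> r / 2" for k
    using ak[of k] bk[of k] le by (simp add: algebra_simps)
  have x0: "x \<longlonglongrightarrow> 0"
    unfolding x_def using tendsto_scaleR[OF lim_inverse_n tendsto_const[of X]] by simp
  have la: "(\<lambda>k. real (a k) *\<^sub>R x k) \<longlonglongrightarrow> s *\<^sub>R X"
    using tendsto_scaleR[OF floor_div_tendsto[OF st(1)] tendsto_const[of X]] by (simp add: x_def a_def divide_inverse)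
  have lb: "(\<lambda>k. real (b k) *\<^sub>R x k) \<longlonglongrightarrow> t *\<^sub>R X"
    using tendsto_scaleR[OF floor_div_tendsto[OF st(2)] tendsto_const[of X]] by (simp add: x_def b_def divide_inverse)
  have lab: "(\<lambda>k. real (a k + b k) *\<^sub>R x k) \<longlonglongrightarrow> (s + t) *\<^sub>R X"
    using tendsto_add[OF la lb] by (simp add: algebra_simps)
  have Pa: "(\<lambda>k. coord_power (a k) (x k)) \<longlonglongrightarrow> coord_exp (s *\<^sub>R X)"
    by (rule coord_power_tendsto[OF la x0]) (use ak le' order_trans in blast)
  have Pb: "(\<lambda>k. coord_power (b k) (x k)) \<longlonglongrightarrow> coord_exp (t *\<^sub>R X)"
    by (rule coord_power_tendsto[OF lb x0]) (use bk le' order_trans in blast)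
  have Pab: "(\<lambda>k. coord_power (a k + b k) (x k)) \<longlonglongrightarrow> coord_exp ((s + t) *\<^sub>R X)"
    by (rule coord_power_tendsto[OF lab x0 abk])
  have ar: "real (a k) * norm (x k) \<le> r" and br: "real (b k) * norm (x k) \<le> r" for k
    using ak[of k] bk[of k] le' r_pos by linarith+
  have eq: "lam (q (coord_power (a k) (x k)) \<otimes> q (coord_power (b k) (x k))) = coord_power (a k + b k) (x k)" for k
  proof (cases "a k + b k = 0")
    case True then show ?thesis by (simp add: coord_power_0 q_zero lam_one)
  next
    case False
    have "norm (x k) < R" using small_less_R[of "a k + b k" "x k"] abk[of k] False r_pos by simp
    then show ?thesis using q_pow[OF ar[of k]] q_pow[OF br[of k]] nat_pow_mult[OF q_carrier, of "x k" "a k" "b k"]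
      by (simp add: coord_power_def)
  qed
  have small: "norm (s *\<^sub>R X) \<le> r / 2" "norm (t *\<^sub>R X) \<le> r / 2" using le' st by auto
  have "(\<lambda>k. lam (q (coord_power (a k) (x k)) \<otimes> q (coord_power (b k) (x k)))) \<longlonglongrightarrow> lam (q (coord_exp (s *\<^sub>R X)) \<otimes> q (coord_exp (t *\<^sub>R X)))"
    by (rule mult_continuous[OF Pa Pb]) (auto intro!: norm_coord_power_less_R ar br norm_coord_exp_less_R small)
  then have "lam (q (coord_exp (s *\<^sub>R X)) \<otimes> q (coord_exp (t *\<^sub>R X))) = coord_exp ((s + t) *\<^sub>R X)"
    unfolding eq using Pab LIMSEQ_unique by blast
  then show ?thesis
    using q_mult[OF norm_coord_exp_less_R norm_coord_exp_less_R] small by metis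
qed

text \<open>Inversion has the coordinate expression \<open>i x = - x + O((norm x)\<^sup>2)\<close>.
  The quadratic error of \<open>i (X / n)\<close> still vanishes after multiplication by
  \<open>n\<close>, so the powers of the inverses converge to \<open>coord_exp (- X)\<close>, while
  they are the inverses of the powers.\<close>

lemma coord_exp_uminus:
  assumes X: "norm X < r / 4"
  shows "q (coord_exp (- X)) = inv (q (coord_exp X))"
proof -
  obtain \<delta> where d: "\<delta> > 0" "\<And>x. norm x < \<delta> \<Longrightarrow> inv (q x) \<in> U" "\<And>x. norm x < \<delta> \<Longrightarrow> norm (lam (inv (q x))) < R"
    using inv_small by blast
  define i where "i x = lam (inv (q x))" for x
  \<comment> \<open>The product estimate for \<open>x\<close> and \<open>i x\<close>, whose product
    has coordinate 0, bounds their sum by \<open>C * norm x * norm (i x)\<close>, at most a quarter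
    of \<open>norm (i x)\<close>. Absorbing this gives the linear bound, and inserting that bound
    gives the quadratic one.\<close>
  have iest: "norm (i x) \<le> 2 * norm x \<and> norm (x + i x) \<le> 2 * C * (norm x)\<^sup>2"
    if x: "norm x < \<delta>" "norm x \<le> r" for x
  proof -
    have xR: "norm x < R" using x r_R r_pos by linarith
    have iR: "norm (i x) < R" using d x by (simp add: i_def)
    have "q (i x) = inv (q x)" using d x q_lam by (simp add: i_def)
    then have "lam (q x \<otimes> q (i x)) = 0" using q_carrier[OF xR] lam_one by simp
    then have 1: "norm (x + i x) \<le> C * norm x * norm (i x)"
      using norm_mult_le[OF xR iR] by (simp add: norm_minus_commute add.commute) (metis add.commute minus_add_distrib norm_minus_cancel uminus_add_conv_diff)
    have "C * norm x \<le> C * r" using x C_pos by (intro mult_left_mono) auto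
    then have "C * norm x \<le> 1 / 4" using r_C by simp
    then have 2: "C * norm x * norm (i x) \<le> 1 / 4 * norm (i x)" by (intro mult_right_mono) auto
    have "norm (i x) \<le> norm (x + i x) + norm x" using norm_triangle_ineq4[of "x + i x" x] by simp
    then have 3: "norm (i x) \<le> 2 * norm x" using 1 2 norm_ge_zero[of x] norm_ge_zero[of "i x"] by linarith
    have "C * norm x * norm (i x) \<le> C * norm x * (2 * norm x)" using 3 C_pos by (intro mult_left_mono) auto
    then show ?thesis using 1 3 by (simp add: power2_eq_square)
  qed
  define x where "x k = X /\<^sub>R real k" for k :: nat
  have x0: "x \<longlonglongrightarrow> 0"
    unfolding x_def using tendsto_scaleR[OF lim_inverse_n tendsto_const[of X]] by simp
  obtain K where K: "\<And>k. k \<ge> K \<Longrightarrow> norm (x k) < \<delta>"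
    using x0 d(1) unfolding LIMSEQ_iff by (metis diff_zero)
  \<comment> \<open>Starting beyond \<open>K\<close> makes every term invertible inside the chart:
    \<open>coord_power_tendsto\<close> wants its bound at all indices. \<open>Suc\<close> excludes
    index 0.\<close>
  define n where "n k = Suc (k + K)" for k
  define y where "y k = x (n k)" for k
  have nK: "norm (y k) < \<delta>" for k using K[of "n k"] by (simp add: y_def n_def)
  have ny: "real (n k) *\<^sub>R y k = X" for k by (simp add: y_def x_def n_def)
  have nny: "real (n k) * norm (y k) = norm X" for k
    using arg_cong[OF ny[of k], of norm] by simp
  have yr: "norm (y k) \<le> r" for k
  proof -
    have "1 * norm (y k) \<le> real (n k) * norm (y k)" by (rule mult_right_mono) (auto simp: n_def)
    then show ?thesis using nny[of k] X r_pos by linarith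
  qed
  have y0: "y \<longlonglongrightarrow> 0" unfolding y_def n_def using LIMSEQ_ignore_initial_segment[OF x0, of "Suc K"] by simp
  note ie = iest[OF nK yr]
  have i0: "(\<lambda>k. i (y k)) \<longlonglongrightarrow> 0"
  proof (rule Lim_null_comparison)
    show "\<forall>\<^sub>F k in sequentially. norm (i (y k)) \<le> 2 * norm (y k)" using ie by simp
    show "(\<lambda>k. 2 * norm (y k)) \<longlonglongrightarrow> 0" by (rule tendsto_mult_right_zero[OF tendsto_norm_zero[OF y0]])
  qed
  have "(\<lambda>k. real (n k) *\<^sub>R (y k + i (y k))) \<longlonglongrightarrow> 0"
  proof (rule Lim_null_comparison)
    have "norm (real (n k) *\<^sub>R (y k + i (y k))) \<le> 2 * C * norm X * norm (y k)" for k
    proof -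
      have "norm (real (n k) *\<^sub>R (y k + i (y k))) \<le> real (n k) * (2 * C * (norm (y k))\<^sup>2)"
        using ie[of k] by (simp add: mult_left_mono)
      also have "\<dots> = 2 * C * (real (n k) * norm (y k)) * norm (y k)" by (simp add: power2_eq_square)
      finally show ?thesis unfolding nny .
    qed
    then show "\<forall>\<^sub>F k in sequentially. norm (real (n k) *\<^sub>R (y k + i (y k))) \<le> 2 * C * norm X * norm (y k)" by simp
    show "(\<lambda>k. 2 * C * norm X * norm (y k)) \<longlonglongrightarrow> 0" by (rule tendsto_mult_right_zero[OF tendsto_norm_zero[OF y0]])
  qed
  then have "(\<lambda>k. real (n k) *\<^sub>R (y k + i (y k)) - X) \<longlonglongrightarrow> 0 - X" by (intro tendsto_intros)
  moreover have "real (n k) *\<^sub>R (y k + i (y k)) - X = real (n k) *\<^sub>R i (y k)" for k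
    using ny[of k] by (simp add: scaleR_add_right)
  ultimately have ni: "(\<lambda>k. real (n k) *\<^sub>R i (y k)) \<longlonglongrightarrow> - X" by simp
  have ler: "real (n k) * norm (i (y k)) \<le> r / 2" for k
  proof -
    have "real (n k) * norm (i (y k)) \<le> real (n k) * (2 * norm (y k))" using ie[of k] by (intro mult_left_mono) auto
    then show ?thesis using nny[of k] X by simp
  qed
  have Pi: "(\<lambda>k. coord_power (n k) (i (y k))) \<longlonglongrightarrow> coord_exp (- X)"
    by (rule coord_power_tendsto[OF ni i0 ler])
  have Py: "(\<lambda>k. coord_power (n k) (y k)) \<longlonglongrightarrow> coord_exp X"
    by (rule coord_power_tendsto[OF _ y0]) (use ny nny X r_pos in auto)
  have le1: "real (n k) * norm (y k) \<le> r" and le2: "real (n k) * norm (i (y k)) \<le> r" for k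
    using nny[of k] ler[of k] X r_pos by auto
  have eq: "lam (q (coord_power (n k) (y k)) \<otimes> q (coord_power (n k) (i (y k)))) = 0" for k
  proof -
    have yR: "norm (y k) < R" using yr[of k] r_R r_pos by linarith
    have "q (i (y k)) = inv (q (y k))" using d nK q_lam by (simp add: i_def)
    then have "q (coord_power (n k) (i (y k))) = inv (q (y k) [^] n k)"
      using q_pow[OF le2[of k]] nat_pow_inv[OF q_carrier[OF yR]] by simp
    then show ?thesis using q_pow[OF le1[of k]] q_carrier[OF yR] lam_one by simp
  qed
  have small: "norm X \<le> r / 2" "norm (- X) \<le> r / 2" using X r_pos by auto
  have "(\<lambda>k. lam (q (coord_power (n k) (y k)) \<otimes> q (coord_power (n k) (i (y k))))) \<longlonglongrightarrow> lam (q (coord_exp X) \<otimes> q (coord_exp (- X)))"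
    by (rule mult_continuous[OF Py Pi]) (auto intro!: norm_coord_power_less_R le1 le2 norm_coord_exp_less_R small)
  then have "lam (q (coord_exp X) \<otimes> q (coord_exp (- X))) = 0"
    unfolding eq using LIMSEQ_unique tendsto_const by blast
  then have "q (coord_exp X) \<otimes> q (coord_exp (- X)) = \<one>"
    using q_mult[OF norm_coord_exp_less_R[OF small(1)] norm_coord_exp_less_R[OF small(2)]] q_zero by simp
  then show ?thesis
    using q_carrier[OF norm_coord_exp_less_R] small inv_equality inv_comm by metis
qed

text \<open>The bound \<open>r / 8\<close> for both terms keeps the sum below \<open>r / 4\<close>,
  where \<open>coord_exp_uminus\<close> still applies.\<close>

lemma coord_exp_add:
  assumes "\<bar>s\<bar> * norm X < r / 8" "\<bar>t\<bar> * norm X < r / 8"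
  shows "q (coord_exp (s *\<^sub>R X)) \<otimes> q (coord_exp (t *\<^sub>R X)) = q (coord_exp ((s + t) *\<^sub>R X))"
proof -
  have c: "q (coord_exp (a *\<^sub>R X)) \<in> carrier G" if "\<bar>a\<bar> * norm X < r / 4" for a
    using that r_pos by (intro q_carrier norm_coord_exp_less_R) auto
  have neg: "q (coord_exp ((- a) *\<^sub>R X)) = inv (q (coord_exp (a *\<^sub>R X)))" if "\<bar>a\<bar> * norm X < r / 4" for a
    using coord_exp_uminus[of "a *\<^sub>R X"] that by simp
  define h where "h a = q (coord_exp (a *\<^sub>R X))" for a
  have pos: "h a \<otimes> h b = h (a + b)" if "a \<ge> 0" "b \<ge> 0" "(a + b) * norm X \<le> r / 2" for a b
    using coord_exp_add_nonneg[OF that] by (simp add: h_def)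
  have hc: "h a \<in> carrier G" and hn: "h (- a) = inv (h a)" if "\<bar>a\<bar> * norm X < r / 4" for a
    using c[OF that] neg[OF that] by (simp_all add: h_def)
  text \<open>All sign patterns follow from the nonnegative case by moving a factor to the other side.\<close>
  have main: "h a \<otimes> h b = h (a + b)" if ab: "\<bar>a\<bar> * norm X < r / 8" "\<bar>b\<bar> * norm X < r / 8" for a b
  proof -
    have sum: "\<bar>a + b\<bar> * norm X < r / 4"
      using mult_right_mono[OF abs_triangle_ineq[of a b], of "norm X"] ab by (simp add: distrib_right)
    have l: "\<bar>a\<bar> * norm X < r / 4" "\<bar>b\<bar> * norm X < r / 4" using ab r_pos by linarith+
    note hh = hc[OF l(1)] hc[OF l(2)] hc[OF sum]
    have P1: "h a \<otimes> h b = h (a + b)" if "a \<ge> 0" "b \<ge> 0"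
      using pos[OF that] sum that r_pos by simp
    consider "a \<ge> 0" "b \<ge> 0" | "a \<le> 0" "b \<le> 0" | "a \<ge> 0" "b \<le> 0" "a + b \<ge> 0" | "a \<ge> 0" "b \<le> 0" "a + b \<le> 0"
      | "a \<le> 0" "b \<ge> 0" "a + b \<ge> 0" | "a \<le> 0" "b \<ge> 0" "a + b \<le> 0" by linarith
    then show ?thesis
    proof cases
      case 1 then show ?thesis by (rule P1)
    next
      case 2
      have "(- b + - a) * norm X \<le> r / 2"
        using mult_right_mono[of "- b + - a" "\<bar>a + b\<bar>" "norm X"] sum r_pos 2 by simp
      then have "h (- b) \<otimes> h (- a) = h (- b + - a)"
        using pos[of "- b" "- a"] 2 by simp
      then have "inv (h b) \<otimes> inv (h a) = inv (h (a + b))"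
        using hn[OF l(1)] hn[OF l(2)] hn[OF sum] by (simp add: add.commute)
      then have "inv (h a \<otimes> h b) = inv (h (a + b))" using hh by (simp add: inv_mult_group)
      then show ?thesis using hh inv_inv m_closed by metis
    next
      case 3
      have "h (a + b) \<otimes> h (- b) = h a"
        using pos[of "a + b" "- b"] 3 l r_pos by simp
      then have "h a = h (a + b) \<otimes> inv (h b)" using hn[OF l(2)] by simp
      then show ?thesis using hh by (simp add: m_assoc)
    next
      case 4
      have "h (- (a + b)) \<otimes> h a = h (- (a + b) + a)"
        using 4 l r_pos by (intro pos) auto
      then have "inv (h (a + b)) \<otimes> h a = inv (h b)" using hn[OF l(2)] hn[OF sum] by simp
      moreover have "h a = h (a + b) \<otimes> (inv (h (a + b)) \<otimes> h a)"
        using hh by (simp flip: m_assoc)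
      ultimately have "h a = h (a + b) \<otimes> inv (h b)" by simp
      then show ?thesis using hh by (simp add: m_assoc)
    next
      case 5
      have "h (- a) \<otimes> h (a + b) = h b"
        using pos[of "- a" "a + b"] 5 l r_pos by simp
      then have "h b = inv (h a) \<otimes> h (a + b)" using hn[OF l(1)] by simp
      then show ?thesis using hh by (simp flip: m_assoc)
    next
      case 6
      have "h b \<otimes> h (- (a + b)) = h (b + - (a + b))"
        using 6 l r_pos by (intro pos) auto
      then have "h b \<otimes> inv (h (a + b)) = inv (h a)" using hn[OF l(1)] hn[OF sum] by simp
      moreover have "h b = (h b \<otimes> inv (h (a + b))) \<otimes> h (a + b)"
        using hh by (simp add: m_assoc)
      ultimately have "h b = inv (h a) \<otimes> h (a + b)" by simp
      then show ?thesis using hh by (simp flip: m_assoc)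
    qed
  qed
  show ?thesis using main[OF assms] by (simp add: h_def)
qed

section \<open>Local surjectivity and growth\<close>

text \<open>The equation is rewritten as \<open>X = y - (coord_exp X - X)\<close>, whose right-hand
  side contracts by 1/2. The radius \<open>2 * norm y\<close> solves
  \<open>norm y + radius / 2 = radius\<close>, and \<open>r / 4\<close> keeps it within
  \<open>r / 2\<close>.\<close>

lemma coord_exp_surj:
  assumes "norm y \<le> r / 4"
  shows "\<exists>X. norm X \<le> 2 * norm y \<and> coord_exp X = y"
proof -
  define B where "B = cball (0::'e) (2 * norm y)"
  have Br: "norm X \<le> r / 2" if "X \<in> B" for X using that assms by (simp add: B_def)
  have est: "norm (y - (coord_exp X - X) - (y - (coord_exp Y - Y))) \<le> 1 / 2 * norm (X - Y)" if "X \<in> B" "Y \<in> B" for X Y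
    using coord_exp_diff_estimate[OF Br[OF that(1)] Br[OF that(2)]]
    by (simp add: norm_minus_commute algebra_simps)
  have "\<exists>!X\<in>B. y - (coord_exp X - X) = X"
  proof (rule Banach_fix)
    show "complete B" unfolding B_def by (simp add: complete_eq_closed)
    show "B \<noteq> {}" by (simp add: B_def)
    show "(\<lambda>X. y - (coord_exp X - X)) ` B \<subseteq> B"
    proof
      fix Z assume "Z \<in> (\<lambda>X. y - (coord_exp X - X)) ` B"
      then obtain X where X: "X \<in> B" "Z = y - (coord_exp X - X)" by blast
      have "norm (coord_exp X - X) \<le> norm X / 2" using coord_exp_diff_estimate[OF Br[OF X(1)], of 0] coord_exp_zero r_pos by simp
      then have "norm (coord_exp X - X) \<le> norm y" using X(1) by (simp add: B_def)
      then show "Z \<in> B" using X(2) norm_triangle_ineq4[of y "coord_exp X - X"] by (simp add: B_def)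
    qed
    show "\<And>x z. x \<in> B \<Longrightarrow> z \<in> B \<Longrightarrow> dist (y - (coord_exp x - x)) (y - (coord_exp z - z)) \<le> 1 / 2 * dist x z"
      using est by (simp add: dist_norm)
  qed auto
  then obtain X where "X \<in> B" "y - (coord_exp X - X) = X" by blast
  then show ?thesis by (intro exI[of _ X]) (simp add: B_def algebra_simps)
qed

text \<open>The partial products keep coordinates of norm at most \<open>3 * r / 4\<close>, so
  multiplying by another exponential costs at most \<open>5 / 4\<close> of its coordinate, and that
  coordinate has norm at most \<open>3 / 2 * norm X\<close>. As
  \<open>5 / 4 * 3 / 2 \<le> 3\<close>, the bound sees the total mass and not the number of
  factors.\<close>

lemma product_estimate:
  assumes "(\<Sum>X\<leftarrow>Xs. norm X) \<le> r / 4"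
  shows "foldr (\<lambda>X h. q (coord_exp X) \<otimes> h) Xs \<one> \<in> U \<and>
    norm (lam (foldr (\<lambda>X h. q (coord_exp X) \<otimes> h) Xs \<one>)) \<le> 3 * (\<Sum>X\<leftarrow>Xs. norm X)"
  using assms
proof (induction Xs)
  case Nil
  then show ?case by (simp add: one_in_U lam_one)
next
  case (Cons X Xs)
  define g where "g = foldr (\<lambda>X h. q (coord_exp X) \<otimes> h) Xs \<one>"
  define s where "s = (\<Sum>X\<leftarrow>Xs. norm X)"
  have s0: "s \<ge> 0" unfolding s_def by (rule sum_list_nonneg) auto
  have le: "norm X + s \<le> r / 4" using Cons.prems by (simp add: s_def)
  have g: "g \<in> U" "norm (lam g) \<le> 3 * s"
    using Cons.IH le norm_ge_zero[of X] unfolding g_def s_def by linarith+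
  have X: "norm X \<le> r / 2" using le s0 r_pos by linarith
  have gr: "norm (lam g) \<le> r" using g(2) le r_pos norm_ge_zero[of X] by linarith
  then have gR: "norm (lam g) < R" using r_R r_pos by linarith
  note eR = norm_coord_exp_less_R[OF X]
  have "norm (lam (q (coord_exp X) \<otimes> g) - (coord_exp X + lam g)) \<le> C * norm (coord_exp X) * norm (lam g)"
    using norm_mult_le[OF eR gR] q_lam[OF g(1)] by simp
  also have "\<dots> \<le> C * norm (coord_exp X) * r" using gr C_pos by (intro mult_left_mono) auto
  also have "\<dots> \<le> norm (coord_exp X) / 4" using mult_right_mono[OF r_C, of "norm (coord_exp X)"] by (simp add: mult_ac)
  finally have "norm (lam (q (coord_exp X) \<otimes> g)) \<le> norm (coord_exp X) + norm (lam g) + norm (coord_exp X) / 4"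
    using norm_triangle_sub[of "lam (q (coord_exp X) \<otimes> g)" "coord_exp X + lam g"] norm_triangle_ineq[of "coord_exp X" "lam g"] by linarith
  then have "norm (lam (q (coord_exp X) \<otimes> g)) \<le> 3 * norm X + 3 * s"
    using norm_coord_exp_le[OF X] g(2) norm_ge_zero[of X] by argo
  then have "norm (lam (q (coord_exp X) \<otimes> g)) \<le> 3 * (norm X + s)" by simp
  moreover have "q (coord_exp X) \<otimes> g \<in> U" using mult_in_U[OF eR gR] q_lam[OF g(1)] by simp
  ultimately show ?case by (simp add: g_def s_def)
qed

text \<open>Powers leave the identity at linear speed; this is the escape that forces
  minimality.\<close>

lemma norm_coord_power_ge:
  assumes "real n * norm x \<le> r"
  shows "norm (coord_power n x) \<ge> real n * norm x / 2"
proof -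
  have "norm (coord_power n x - real n *\<^sub>R x) \<le> 2 * C * (real n * norm x)\<^sup>2" by (rule coord_power_linear_error[OF assms])
  also have "\<dots> \<le> 2 * C * (r * (real n * norm x))"
    unfolding power2_eq_square using assms C_pos by (intro mult_left_mono mult_right_mono) auto
  also have "\<dots> \<le> (real n * norm x) / 2" using mult_right_mono[OF r_C, of "real n * norm x"] by (simp add: mult_ac)
  finally show ?thesis
    using norm_triangle_ineq2[of "real n *\<^sub>R x" "real n *\<^sub>R x - coord_power n x"] by (simp add: norm_minus_commute)
qed

end

section \<open>The exponential map\<close>

text \<open>\<open>j\<close> and \<open>k\<close> embed the two factors around the base point
  \<open>w\<close>, so that exchanging them yields the estimate for the other factor. On the axis of
  \<open>j\<close> the function is a translation with derivative the identity; a bound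
  \<open>C\<close> for second derivatives makes the partial derivative differ from it by at most
  \<open>C * norm y\<close>, and the mean value inequality in \<open>x\<close> concludes.\<close>

lemma derivative_tower_unit_estimate:
  fixes D :: "'z::real_normed_vector \<Rightarrow> 'z list \<Rightarrow> 'e::real_normed_vector"
  assumes D: "derivative_tower S D" and w: "w \<in> S"
    and j: "bounded_linear j" "\<And>x. norm (j x) \<le> norm x"
    and k: "bounded_linear k" "\<And>x. norm (k x) \<le> norm x"
    and unit: "\<And>x. w + j x \<in> S \<Longrightarrow> D (w + j x) [] = x + c"
  shows "\<exists>R>0. \<exists>C>0. \<forall>x x' y. norm x < R \<longrightarrow> norm x' < R \<longrightarrow> norm y < R \<longrightarrow>
    norm (D (w + j x + k y) [] - D (w + j x' + k y) [] - (x - x')) \<le> C * norm (x - x') * norm y"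
proof -
  obtain \<delta> C where d: "\<delta> > 0" "C \<ge> 0" "ball w \<delta> \<subseteq> S"
    and C: "\<And>z vs. z \<in> ball w \<delta> \<Longrightarrow> length vs = 2 \<Longrightarrow> norm (D z vs) \<le> C * (\<Prod>v\<leftarrow>vs. norm v)"
    using derivative_tower_locally_bounded[OF D w, of 2] by meson
  define R where "R = \<delta> / 2"
  have inb: "w + j x + k y \<in> ball w \<delta>" if "norm x < R" "norm y < R" for x y
  proof -
    have "norm (j x + k y) < \<delta>"
      using norm_triangle_ineq[of "j x" "k y"] j(2)[of x] k(2)[of y] that unfolding R_def by linarith
    moreover have "w + j x + k y - w = j x + k y" by simp
    ultimately have "dist (w + j x + k y) w < \<delta>" by (simp only: dist_norm)
    then show ?thesis by (simp only: mem_ball dist_commute)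
  qed
  have k0: "k 0 = 0" using k(1) by (simp add: linear_0 bounded_linear.linear)
  have D1: "norm (D z [v] - D z' [v]) \<le> C * norm v * norm (z - z')"
    if z: "z \<in> ball w \<delta>" "z' \<in> ball w \<delta>" for z z' v
  proof (rule differentiable_bound[OF convex_ball _ _ z(1) z(2)])
    fix u assume u: "u \<in> ball w \<delta>"
    then have uS: "u \<in> S" using d by blast
    show "((\<lambda>z. D z [v]) has_derivative (\<lambda>h. D u [h, v])) (at u within ball w \<delta>)"
      by (rule has_derivative_at_withinI[OF derivative_tower_has_derivative[OF D uS]])
    show "onorm (\<lambda>h. D u [h, v]) \<le> C * norm v"
    proof (rule onorm_bound)
      show "norm (D u [h, v]) \<le> C * norm v * norm h" for h
        using C[OF u, of "[h, v]"] by (simp add: mult_ac)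
    qed (use d in simp)
  qed
  have deriv: "((\<lambda>x. D (w + j x + k y) []) has_derivative (\<lambda>h. D (w + j x + k y) [j h])) (at x)"
    if "norm x < R" "norm y < R" for x y
  proof -
    have S: "w + j x + k y \<in> S" using inb[OF that] d by blast
    have "((\<lambda>x. w + j x + k y) has_derivative (\<lambda>h. 0 + j h + 0)) (at x)"
      by (intro derivative_intros bounded_linear_imp_has_derivative j(1))
    from has_derivative_compose[OF this derivative_tower_has_derivative[OF D S, of "[]"]]
    show ?thesis by simp
  qed
  \<comment> \<open>The unit law holds on a whole ball of the axis, so it can be differentiated
    there.\<close>
  have unitD: "D (w + j x) [j h] = h" if "norm x < R" for x h
  proof -
    have "((\<lambda>x. x + c) has_derivative (\<lambda>h. D (w + j x) [j h])) (at x)"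
    proof (rule has_derivative_transform_within_open[where s = "ball 0 R"])
      show "((\<lambda>x. D (w + j x) []) has_derivative (\<lambda>h. D (w + j x) [j h])) (at x)"
        using deriv[OF that, of 0] d(1) k0 by (simp add: R_def)
      show "x \<in> ball 0 R" using that by simp
      show "D (w + j u) [] = u + c" if "u \<in> ball 0 R" for u
        using unit[of u] inb[of u 0] that k0 d by (auto simp: R_def)
    qed simp
    moreover have "((\<lambda>x. x + c) has_derivative (\<lambda>h. h)) (at x)"
      by (auto intro!: derivative_eq_intros)
    ultimately show ?thesis using has_derivative_unique by metis
  qed
  have main: "norm (D (w + j x + k y) [] - D (w + j x' + k y) [] - (x - x')) \<le> (C + 1) * norm (x - x') * norm y"
    if x: "norm x < R" "norm x' < R" and y: "norm y < R" for x x' y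
  proof -
    have "norm ((D (w + j x + k y) [] - x) - (D (w + j x' + k y) [] - x')) \<le> C * norm y * norm (x - x')"
    proof (rule differentiable_bound[OF convex_ball[of 0 R]])
      fix u :: 'e assume "u \<in> ball 0 R"
      then have u: "norm u < R" by simp
      show "((\<lambda>x. D (w + j x + k y) [] - x) has_derivative (\<lambda>h. D (w + j u + k y) [j h] - h)) (at u within ball 0 R)"
        by (rule has_derivative_at_withinI) (intro derivative_intros deriv[OF u y])
      show "onorm (\<lambda>h. D (w + j u + k y) [j h] - h) \<le> C * norm y"
      proof (rule onorm_bound)
        fix h
        have "w + j u \<in> ball w \<delta>" using inb[of u 0] u k0 d(1) by (simp add: R_def)
        then have "norm (D (w + j u + k y) [j h] - D (w + j u) [j h]) \<le> C * norm (j h) * norm (k y)"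
          using D1[OF inb[OF u y], of "w + j u" "j h"] by simp
        also have "\<dots> \<le> C * norm h * norm y"
          using j k d(2) by (intro mult_mono mult_left_mono) auto
        finally show "norm (D (w + j u + k y) [j h] - h) \<le> C * norm y * norm h"
          unfolding unitD[OF u] by (simp add: mult_ac)
      qed (use d in simp)
    qed (use x in auto)
    also have "\<dots> \<le> (C + 1) * norm y * norm (x - x')"
      by (intro mult_right_mono) auto
    finally show ?thesis by (simp add: algebra_simps)
  qed
  show ?thesis
    by (rule exI[of _ R], intro conjI exI[of _ "C + 1"]) (use main d R_def in auto)
qed

context banach_lie_group
begin

lemma chart_inj: "(V, \<psi>) \<in> A \<Longrightarrow> inj_on \<psi> V"
  using homeomorphic_imp_injective_map[OF chart_homeo] openin_subset[OF chart_domain]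
  by (metis inf.absorb2 topspace_subtopology)

lemma chart_inv: "(V, \<psi>) \<in> A \<Longrightarrow> g \<in> V \<Longrightarrow> inv_into V \<psi> (\<psi> g) = g"
  using chart_inj inv_into_f_f by metis

lemma chart_carrier: "(V, \<psi>) \<in> A \<Longrightarrow> V \<subseteq> carrier G"
  using openin_subset[OF chart_domain] topspace_carrier by blast

lemma chart_open_image:
  assumes "(V, \<psi>) \<in> A" "openin T W" "W \<subseteq> V"
  shows "open (\<psi> ` W)"
proof -
  have "openin (subtopology T V) W" using assms by (metis inf.absorb2 inf_commute openin_subtopology)
  then have "openin (top_of_set (\<psi> ` V)) (\<psi> ` W)"
    using homeomorphic_imp_open_map[OF chart_homeo[OF assms(1)]] by (simp add: open_map_def)
  then show ?thesis using chart_range[OF assms(1)] openin_open_trans by blast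
qed

lemma chart_open_preimage:
  assumes "(V, \<psi>) \<in> A" "open B"
  shows "openin T {g \<in> V. \<psi> g \<in> B}"
proof -
  have "continuous_map (subtopology T V) (top_of_set (\<psi> ` V)) \<psi>"
    using homeomorphic_imp_continuous_map[OF chart_homeo[OF assms(1)]] .
  then have "continuous_map (subtopology T V) euclidean \<psi>"
    by (simp add: continuous_map_in_subtopology)
  then have "openin (subtopology T V) {g \<in> topspace (subtopology T V). \<psi> g \<in> B}"
    using assms(2) by (simp add: continuous_map_def)
  moreover have tV: "topspace (subtopology T V) = V"
    using openin_subset[OF chart_domain[OF assms(1)]] by auto
  ultimately show ?thesis
    using openin_trans_full[OF _ chart_domain[OF assms(1)]] unfolding tV by blast
qed

text \<open>Three independent charts are allowed: later the first factor and the product may be far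
  from the identity, with the second factor near it.\<close>

lemma mult_tower:
  assumes c: "(U1, \<phi>1) \<in> A" "(U2, \<phi>2) \<in> A" "(V, \<psi>) \<in> A"
  shows "\<exists>D. derivative_tower {(\<phi>1 g, \<phi>2 h) | g h. g \<in> U1 \<and> h \<in> U2 \<and> g \<otimes> h \<in> V} D \<and>
     (\<forall>g\<in>U1. \<forall>h\<in>U2. g \<otimes> h \<in> V \<longrightarrow> D (\<phi>1 g, \<phi>2 h) [] = \<psi> (g \<otimes> h))"
proof -
  let ?f = "map_prod \<phi>1 \<phi>2"
  have inj: "inj_on ?f (U1 \<times> U2)" using chart_inj[OF c(1)] chart_inj[OF c(2)] by (rule map_prod_inj_on)
  have "(U1 \<times> U2, ?f) \<in> prod_atlas A A" using c by (auto simp: prod_atlas_def)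
  then have "smooth_on (?f ` ((U1 \<times> U2) \<inter> (\<lambda>(g, h). g \<otimes> h) -` V)) (\<psi> \<circ> (\<lambda>(g, h). g \<otimes> h) \<circ> inv_into (U1 \<times> U2) ?f)"
    using smooth_mult c(3) unfolding smooth_map_def by blast
  moreover have "?f ` ((U1 \<times> U2) \<inter> (\<lambda>(g, h). g \<otimes> h) -` V) = {(\<phi>1 g, \<phi>2 h) | g h. g \<in> U1 \<and> h \<in> U2 \<and> g \<otimes> h \<in> V}"
    by force
  ultimately obtain D where D: "derivative_tower {(\<phi>1 g, \<phi>2 h) | g h. g \<in> U1 \<and> h \<in> U2 \<and> g \<otimes> h \<in> V} D"
     "\<And>z. z \<in> {(\<phi>1 g, \<phi>2 h) | g h. g \<in> U1 \<and> h \<in> U2 \<and> g \<otimes> h \<in> V} \<Longrightarrow>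
        D z [] = (\<psi> \<circ> (\<lambda>(g, h). g \<otimes> h) \<circ> inv_into (U1 \<times> U2) ?f) z"
    unfolding smooth_on_iff_tower by auto
  have "D (\<phi>1 g, \<phi>2 h) [] = \<psi> (g \<otimes> h)" if "g \<in> U1" "h \<in> U2" "g \<otimes> h \<in> V" for g h
  proof -
    have "inv_into (U1 \<times> U2) ?f (?f (g, h)) = (g, h)" using that by (intro inv_into_f_f[OF inj]) auto
    then show ?thesis using D(2)[of "(\<phi>1 g, \<phi>2 h)"] that by auto
  qed
  then show ?thesis using D(1) by blast
qed

lemma continuous_left_mult:
  assumes "g \<in> carrier G"
  shows "continuous_map T T (\<lambda>h. g \<otimes> h)"
proof -
  have "continuous_map T (prod_topology T T) (\<lambda>h. (g, h))"
    using assms topspace_carrier by (intro continuous_map_pairedI) auto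
  from continuous_map_compose[OF this continuous_mult] show ?thesis by (simp add: o_def)
qed

lemma openin_left_translate:
  "openin T W \<Longrightarrow> g \<in> carrier G \<Longrightarrow> openin T {h \<in> carrier G. g \<otimes> h \<in> W}"
  using continuous_left_mult[of g] topspace_carrier by (simp add: continuous_map_def)

end

locale lie_chart = banach_lie_group G T A + local_coordinates G U lam q R C
  for G :: "('g, 'm) monoid_scheme" (structure) and T :: "'g topology"
    and A :: "('g, 'e::banach) chart set"
    and U :: "'g set" and lam :: "'g \<Rightarrow> 'e" and q :: "'e \<Rightarrow> 'g" and R C :: real +
  fixes \<phi> :: "'g \<Rightarrow> 'e"
  assumes chart: "(U, \<phi>) \<in> A"
    and lam_eq: "lam g = \<phi> g - \<phi> \<one>"
    and q_eq: "q x = inv_into U \<phi> (x + \<phi> \<one>)"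

lemma (in banach_lie_group) lie_chart_exists:
  assumes ch: "(U, \<phi>) \<in> A" and one: "\<one> \<in> U"
  shows "\<exists>R C. lie_chart G T A U (\<lambda>g. \<phi> g - \<phi> \<one>) (\<lambda>x. inv_into U \<phi> (x + \<phi> \<one>)) R C \<phi>"
proof -
  define p where "p = \<phi> \<one>"
  define S where "S = {(\<phi> g, \<phi> h) | g h. g \<in> U \<and> h \<in> U \<and> g \<otimes> h \<in> U}"
  define q where "q x = inv_into U \<phi> (x + p)" for x
  obtain D where D: "derivative_tower S D"
    and Dv: "\<And>g h. g \<in> U \<Longrightarrow> h \<in> U \<Longrightarrow> g \<otimes> h \<in> U \<Longrightarrow> D (\<phi> g, \<phi> h) [] = \<phi> (g \<otimes> h)"
    using mult_tower[OF ch ch ch] unfolding S_def by blast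
  have Uc: "U \<subseteq> carrier G" using chart_carrier[OF ch] .
  have pS: "(p, p) \<in> S" using one unfolding S_def p_def by (intro CollectI exI[of _ \<one>]) auto
  have Sdec: "\<exists>g h. x = \<phi> g \<and> y = \<phi> h \<and> g \<in> U \<and> h \<in> U \<and> g \<otimes> h \<in> U" if "(x, y) \<in> S" for x y
    using that by (auto simp: S_def)
  have pu: "g = \<one>" if "\<phi> g = p" "g \<in> U" for g
    using that one chart_inj[OF ch] by (auto simp: p_def inj_on_def)
  \<comment> \<open>Injectivity of the chart forces the factor with coordinate \<open>p\<close> to
    be the identity, and the unit law gives the value.\<close>
  have u1: "D ((p, p) + (x, 0)) [] = x + p" if "(p, p) + (x, 0) \<in> S" for x
  proof -
    from that have "(p + x, p) \<in> S" by simp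
    from Sdec[OF this] obtain g h where gh: "p + x = \<phi> g" "p = \<phi> h" "g \<in> U" "h \<in> U" "g \<otimes> h \<in> U" by blast
    then have "h = \<one>" using pu by metis
    then show ?thesis using Dv[OF gh(3-5)] gh Uc by (auto simp: add.commute)
  qed
  have u2: "D ((p, p) + (0, y)) [] = y + p" if "(p, p) + (0, y) \<in> S" for y
  proof -
    from that have "(p, p + y) \<in> S" by simp
    from Sdec[OF this] obtain g h where gh: "p = \<phi> g" "p + y = \<phi> h" "g \<in> U" "h \<in> U" "g \<otimes> h \<in> U" by blast
    then have "g = \<one>" using pu by metis
    then show ?thesis using Dv[OF gh(3-5)] gh Uc by (auto simp: add.commute)
  qed
  have bl: "bounded_linear (\<lambda>x::'e. (x, 0::'e))" "bounded_linear (\<lambda>x::'e. (0::'e, x))"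
    by (intro bounded_linear_Pair bounded_linear_ident bounded_linear_zero)+
  have nm: "norm (x, 0::'e) \<le> norm x" "norm (0::'e, x) \<le> norm x" for x :: 'e
    by (simp_all add: norm_prod_def)
  obtain R1 C1 where 1: "R1 > 0" "C1 > 0" "\<And>x x' y. norm x < R1 \<Longrightarrow> norm x' < R1 \<Longrightarrow> norm y < R1 \<Longrightarrow>
    norm (D ((p, p) + (x, 0) + (0, y)) [] - D ((p, p) + (x', 0) + (0, y)) [] - (x - x')) \<le> C1 * norm (x - x') * norm y"
    using derivative_tower_unit_estimate[OF D pS bl(1) nm(1) bl(2) nm(2) u1] by blast
  obtain R2 C2 where 2: "R2 > 0" "C2 > 0" "\<And>y y' x. norm y < R2 \<Longrightarrow> norm y' < R2 \<Longrightarrow> norm x < R2 \<Longrightarrow>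
    norm (D ((p, p) + (0, y) + (x, 0)) [] - D ((p, p) + (0, y') + (x, 0)) [] - (y - y')) \<le> C2 * norm (y - y') * norm x"
    using derivative_tower_unit_estimate[OF D pS bl(2) nm(2) bl(1) nm(1) u2] by blast
  obtain R3 where 3: "R3 > 0" "ball (p, p) R3 \<subseteq> S"
    using D pS unfolding derivative_tower_def by (meson openE)
  \<comment> \<open>Half of \<open>R3\<close>, because the norm of a pair is at most the sum of the
    two norms.\<close>
  define R where "R = min (min R1 R2) (R3 / 2)"
  define C where "C = max C1 C2"
  have R: "R > 0" "R \<le> R1" "R \<le> R2" using 1 2 3 by (auto simp: R_def)
  have C: "C > 0" "C1 \<le> C" "C2 \<le> C" using 1 2 by (auto simp: C_def)
  have inS: "(x + p, y + p) \<in> S" if "norm x < R" "norm y < R" for x y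
  proof -
    have "norm (x, y) \<le> norm x + norm y" by (rule norm_Pair_le)
    also have "\<dots> < R3" using that by (simp add: R_def)
    finally have "dist (p, p) (x + p, y + p) < R3"
      by (metis add_Pair add_diff_cancel_right' dist_commute dist_norm)
    then show ?thesis using 3 by (auto simp: mem_ball)
  qed
  have qU: "q x \<in> U \<and> \<phi> (q x) = x + p" if "norm x < R" for x
  proof -
    from Sdec[OF inS[OF that that]] obtain g where "g \<in> U" "x + p = \<phi> g" by blast
    then show ?thesis using chart_inv[OF ch] by (simp add: q_def)
  qed
  have qm: "q x \<otimes> q y \<in> U \<and> D (x + p, y + p) [] = \<phi> (q x \<otimes> q y)" if "norm x < R" "norm y < R" for x y
  proof -
    from Sdec[OF inS[OF that]] obtain g h where
      gh: "x + p = \<phi> g" "y + p = \<phi> h" "g \<in> U" "h \<in> U" "g \<otimes> h \<in> U" by blast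
    then have "q x = g" "q y = h" using chart_inv[OF ch] by (simp_all add: q_def)
    then show ?thesis using gh Dv[OF gh(3-5)] by simp
  qed
  have "lie_chart G T A U (\<lambda>g. \<phi> g - p) q R C \<phi>"
  proof (unfold_locales)
    show "U \<subseteq> carrier G" by (rule Uc)
    show "\<one> \<in> U" by (rule one)
    show "\<phi> \<one> - p = 0" by (simp add: p_def)
    show "q (\<phi> g - p) = g" if "g \<in> U" for g using chart_inv[OF ch that] by (simp add: q_def)
    show "0 < R" "0 < C" using R C by auto
    show "q x \<in> U" "\<phi> (q x) - p = x" if "norm x < R" for x using qU[OF that] by auto
    show "q x \<otimes> q y \<in> U" if "norm x < R" "norm y < R" for x y using qm that by blast
    show "norm (\<phi> (q x \<otimes> q y) - p - (\<phi> (q x' \<otimes> q y) - p) - (x - x')) \<le> C * norm (x - x') * norm y"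
      if "norm x < R" "norm x' < R" "norm y < R" for x x' y
    proof -
      have "norm (D (x + p, y + p) [] - D (x' + p, y + p) [] - (x - x')) \<le> C1 * norm (x - x') * norm y"
        using 1(3)[of x x' y] that R by (simp add: add.commute)
      also have "\<dots> \<le> C * norm (x - x') * norm y" using C by (intro mult_right_mono) auto
      finally show ?thesis using qm that by simp
    qed
    show "norm (\<phi> (q x \<otimes> q y) - p - (\<phi> (q x \<otimes> q y') - p) - (y - y')) \<le> C * norm x * norm (y - y')"
      if "norm x < R" "norm y < R" "norm y' < R" for x y y'
    proof -
      have "norm (D (x + p, y + p) [] - D (x + p, y' + p) [] - (y - y')) \<le> C2 * norm (y - y') * norm x"
        using 2(3)[of y y' x] that R by (simp add: add.commute)
      also have "\<dots> \<le> C * norm (y - y') * norm x" using C by (intro mult_right_mono) auto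
      finally show ?thesis using qm that by (simp add: mult_ac)
    qed
    \<comment> \<open>Continuity of inversion makes \<open>W'\<close> an open neighbourhood of the
      identity; its open image under the chart contains a ball, whose radius is the required
      bound.\<close>
    show "\<exists>\<delta>>0. \<forall>x. norm x < \<delta> \<longrightarrow> inv q x \<in> U \<and> norm (\<phi> (inv q x) - p) < R"
    proof -
      define W where "W = {g \<in> U. \<phi> g \<in> ball p R}"
      define W' where "W' = U \<inter> {g \<in> carrier G. inv g \<in> W}"
      have "openin T W" unfolding W_def by (rule chart_open_preimage[OF ch]) simp
      then have "openin T {g \<in> carrier G. inv g \<in> W}"
        using continuous_inv topspace_carrier by (simp add: continuous_map_def)
      then have "openin T W'" unfolding W'_def using chart_domain[OF ch] by blast
      then have "open (\<phi> ` W')" by (rule chart_open_image[OF ch]) (simp add: W'_def)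
      moreover have "p \<in> \<phi> ` W'" using one R by (auto simp: W'_def W_def p_def)
      ultimately obtain \<delta> where d: "\<delta> > 0" "ball p \<delta> \<subseteq> \<phi> ` W'" by (meson openE)
      have "inv q x \<in> W" if "norm x < \<delta>" for x
      proof -
        have "x + p \<in> ball p \<delta>" using that by (simp add: dist_norm)
        then obtain g where "g \<in> W'" "x + p = \<phi> g" using d by blast
        then show ?thesis using chart_inv[OF ch, of g] by (auto simp: q_def W'_def)
      qed
      then show ?thesis using d(1) by (intro exI[of _ \<delta>]) (auto simp: W_def dist_norm norm_minus_commute)
    qed
    show "(U, \<phi>) \<in> A" by (rule ch)
    show "\<phi> g - p = \<phi> g - \<phi> \<one>" for g by (simp add: p_def)
    show "q x = inv_into U \<phi> (x + \<phi> \<one>)" for x by (simp add: q_def p_def)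
  qed
  then show ?thesis unfolding q_def[abs_def] p_def by blast
qed

section \<open>The global exponential\<close>

context lie_chart
begin

lemma openin_small: "openin T {g \<in> U. norm (lam g) < \<epsilon>}"
  using chart_open_preimage[OF chart, of "ball (\<phi> \<one>) \<epsilon>"]
  by (simp add: dist_norm lam_eq norm_minus_commute)

lemma small_nhds:
  assumes "openin T W" "\<one> \<in> W"
  shows "\<exists>\<epsilon>>0. \<epsilon> \<le> R \<and> (\<forall>x. norm x < \<epsilon> \<longrightarrow> q x \<in> W)"
proof -
  have "openin T (U \<inter> W)" using chart_domain[OF chart] assms by blast
  then have "open (\<phi> ` (U \<inter> W))" by (rule chart_open_image[OF chart]) simp
  moreover have "\<phi> \<one> \<in> \<phi> ` (U \<inter> W)" using assms one_in_U by blast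
  ultimately obtain \<epsilon> where e: "\<epsilon> > 0" "ball (\<phi> \<one>) \<epsilon> \<subseteq> \<phi> ` (U \<inter> W)" by (meson openE)
  have "q x \<in> W" if "norm x < \<epsilon>" for x
  proof -
    have "x + \<phi> \<one> \<in> ball (\<phi> \<one>) \<epsilon>" using that by (simp add: dist_norm)
    then obtain g where "g \<in> U \<inter> W" "x + \<phi> \<one> = \<phi> g" using e by blast
    then show ?thesis using chart_inv[OF chart, of g] by (simp add: q_eq)
  qed
  then show ?thesis using e R_pos by (intro exI[of _ "min \<epsilon> R"]) auto
qed

lemma qe_carrier: "norm x \<le> r / 2 \<Longrightarrow> q (coord_exp x) \<in> carrier G"
  using q_carrier norm_coord_exp_less_R by blast

lemma qe_pow:
  assumes "real k * norm x < r / 8"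
  shows "q (coord_exp (real k *\<^sub>R x)) = q (coord_exp x) [^] k"
  using assms
proof (induction k)
  case 0
  then show ?case by (simp add: coord_exp_zero q_zero)
next
  case (Suc k)
  have 1: "real k * norm x + norm x < r / 8" using Suc.prems by (simp add: algebra_simps)
  have 2: "0 \<le> real k * norm x" "0 \<le> norm x" by simp_all
  then have "real k * norm x < r / 8" "norm x < r / 8" using 1 by linarith+
  then show ?case using Suc.IH coord_exp_add[of "real k" x 1] by (simp add: add.commute)
qed

text \<open>The exponential map read on the model space: the local one at \<open>v / n\<close>,
  raised to the power \<open>n\<close>. The explicit \<open>n\<close> is positive and puts
  \<open>v / n\<close> strictly inside the ball of radius \<open>r / 8\<close>, where additivity
  holds.\<close>

definition expo :: "'e \<Rightarrow> 'g" where
  "expo v = (let n = Suc (nat \<lceil>8 * norm v / r\<rceil>) in q (coord_exp (v /\<^sub>R real n)) [^] n)"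

text \<open>Two admissible subdivisions are compared through their common refinement
  \<open>m * n\<close>.\<close>

lemma expo_eq:
  assumes "n > 0" "norm v / real n < r / 8"
  shows "expo v = q (coord_exp (v /\<^sub>R real n)) [^] n"
proof -
  define m where "m = Suc (nat \<lceil>8 * norm v / r\<rceil>)"
  have "8 * norm v / r < real m" unfolding m_def by linarith
  moreover have "real m > 0" by (simp add: m_def)
  ultimately have m: "norm v / real m < r / 8" using r_pos by (simp add: field_simps)
  have m0: "m > 0" by (simp add: m_def)
  have *: "q (coord_exp (v /\<^sub>R real a)) [^] a = q (coord_exp (v /\<^sub>R real (a * b))) [^] (a * b)"
    if a: "a > 0" "b > 0" "norm v / real a < r / 8" for a b
  proof -
    have eq: "real b *\<^sub>R (v /\<^sub>R real (a * b)) = v /\<^sub>R real a"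
      unfolding scaleR_scaleR using a by (intro arg_cong2[of _ _ _ _ scaleR]) (auto simp: divide_simps)
    have nm: "real b * norm (v /\<^sub>R real (a * b)) = norm v / real a"
      using a by (auto simp: divide_simps)
    have "norm (v /\<^sub>R real (a * b)) \<le> norm v / real a"
      using nm a mult_right_mono[of 1 "real b" "norm (v /\<^sub>R real (a * b))"] by simp
    then have "norm (v /\<^sub>R real (a * b)) \<le> r / 2" using a r_pos by linarith
    note c = qe_carrier[OF this]
    have "q (coord_exp (v /\<^sub>R real a)) = q (coord_exp (v /\<^sub>R real (a * b))) [^] b"
      using qe_pow[of b "v /\<^sub>R real (a * b)"] a(3) unfolding nm eq by simp
    then show ?thesis using nat_pow_pow[OF c, of b a] by (simp add: mult.commute)
  qed
  have "expo v = q (coord_exp (v /\<^sub>R real m)) [^] m" by (simp add: expo_def m_def Let_def)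
  also have "\<dots> = q (coord_exp (v /\<^sub>R real (m * n))) [^] (m * n)" by (rule *[OF m0 assms(1) m])
  also have "\<dots> = q (coord_exp (v /\<^sub>R real n)) [^] n" using *[OF assms(1) m0 assms(2)] by (simp add: mult.commute)
  finally show ?thesis .
qed

lemma expo_small: "norm v < r / 8 \<Longrightarrow> expo v = q (coord_exp v)"
  using expo_eq[of 1 v] qe_carrier[of v] r_pos by simp

lemma exists_divisor: "\<exists>n>0. c / real n < r / 8"
proof -
  obtain n :: nat where n: "8 * \<bar>c\<bar> / r < real n" using reals_Archimedean2 by blast
  have "0 \<le> 8 * \<bar>c\<bar> / r" using r_pos by simp
  then have n0: "real n > 0" using n by linarith
  have "8 * \<bar>c\<bar> < real n * r" using n r_pos by (simp add: field_simps)
  then have "c / real n < r / 8" using n0 by (simp add: field_simps)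
  then show ?thesis using n0 by (intro exI[of _ n]) simp
qed

lemma expo_carrier: "expo v \<in> carrier G"
proof -
  obtain n where n: "n > 0" "norm v / real n < r / 8" using exists_divisor by blast
  have "norm (v /\<^sub>R real n) \<le> r / 2" using n r_pos unfolding norm_divideR by linarith
  then show ?thesis unfolding expo_eq[OF n] using qe_carrier by simp
qed

text \<open>One subdivision fine enough for \<open>s\<close>, \<open>t\<close> and
  \<open>s + t\<close> reduces this to \<open>(a * b)^n = a^n * b^n\<close>, valid because local
  additivity makes the two factors commute.\<close>

lemma expo_add: "expo (s *\<^sub>R v) \<otimes> expo (t *\<^sub>R v) = expo ((s + t) *\<^sub>R v)"
proof -
  obtain n where n: "n > 0" "(\<bar>s\<bar> + \<bar>t\<bar>) * norm v / real n < r / 8" using exists_divisor by blast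
  define x where "x = v /\<^sub>R real n"
  have nx: "norm x = norm v / real n" unfolding x_def by (rule norm_divideR)
  have sum: "\<bar>s\<bar> * norm x + \<bar>t\<bar> * norm x < r / 8" using n by (simp add: nx distrib_right add_divide_distrib)
  have nn: "0 \<le> \<bar>s\<bar> * norm x" "0 \<le> \<bar>t\<bar> * norm x" by simp_all
  have st: "\<bar>s\<bar> * norm x < r / 8" "\<bar>t\<bar> * norm x < r / 8" using sum nn by linarith+
  have "\<bar>s + t\<bar> * norm x \<le> (\<bar>s\<bar> + \<bar>t\<bar>) * norm x" by (intro mult_right_mono) auto
  then have st': "\<bar>s + t\<bar> * norm x < r / 8" using sum by (simp add: distrib_right)
  have ex: "expo (a *\<^sub>R v) = q (coord_exp (a *\<^sub>R x)) [^] n" if "\<bar>a\<bar> * norm x < r / 8" for a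
  proof -
    have "a *\<^sub>R x = (a *\<^sub>R v) /\<^sub>R real n" by (simp add: x_def mult.commute)
    then show ?thesis using expo_eq[OF n(1), of "a *\<^sub>R v"] that nx by simp
  qed
  have c: "q (coord_exp (s *\<^sub>R x)) \<in> carrier G" "q (coord_exp (t *\<^sub>R x)) \<in> carrier G"
    using st r_pos by (auto intro!: qe_carrier)
  have "q (coord_exp (s *\<^sub>R x)) \<otimes> q (coord_exp (t *\<^sub>R x)) = q (coord_exp (t *\<^sub>R x)) \<otimes> q (coord_exp (s *\<^sub>R x))"
    using coord_exp_add[OF st] coord_exp_add[OF st(2,1)] by (simp add: add.commute)
  from pow_mult_distrib[OF this c, of n] show ?thesis
    unfolding ex[OF st(1)] ex[OF st(2)] ex[OF st'] coord_exp_add[OF st] ..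
qed

lemma expo_zero: "expo 0 = \<one>"
  using expo_small[of 0] r_pos coord_exp_zero q_zero by simp

lemma expo_uminus: "expo (- v) = inv (expo v)"
  using expo_add[of "-1" v 1] expo_zero expo_carrier inv_equality[of "expo (- v)" "expo v"] by simp

section \<open>Smoothness and velocity of the exponential curves\<close>

lemma coord_exp_has_vector_derivative: "((\<lambda>s. coord_exp ((s - t) *\<^sub>R v)) has_vector_derivative v) (at t)"
proof -
  have "(\<lambda>s. (1 / (s - t)) *\<^sub>R coord_exp ((s - t) *\<^sub>R v) - v) \<midarrow>t\<rightarrow> 0"
  proof (rule Lim_null_comparison)
    have "\<forall>\<^sub>F s in at t. norm ((s - t) *\<^sub>R v) < r / 2"
    proof (rule order_tendstoD)
      have "(\<lambda>s. norm ((s - t) *\<^sub>R v)) \<midarrow>t\<rightarrow> norm ((t - t) *\<^sub>R v)" by (intro tendsto_intros)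
      then show "(\<lambda>s. norm ((s - t) *\<^sub>R v)) \<midarrow>t\<rightarrow> 0" by simp
    qed (use r_pos in simp)
    moreover have "\<forall>\<^sub>F s in at t. s \<noteq> t" by (simp add: eventually_at_filter)
    ultimately show "\<forall>\<^sub>F s in at t. norm ((1 / (s - t)) *\<^sub>R coord_exp ((s - t) *\<^sub>R v) - v) \<le> 3 * C * (norm v)\<^sup>2 * \<bar>s - t\<bar>"
    proof eventually_elim
      case (elim s)
      have "(1 / (s - t)) *\<^sub>R coord_exp ((s - t) *\<^sub>R v) - v = (1 / (s - t)) *\<^sub>R (coord_exp ((s - t) *\<^sub>R v) - (s - t) *\<^sub>R v)"
        using elim scaleR_diff_right[of "1 / (s - t)" "coord_exp ((s - t) *\<^sub>R v)" "(s - t) *\<^sub>R v"] by simp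
      also have "norm \<dots> \<le> \<bar>1 / (s - t)\<bar> * (3 * C * (norm ((s - t) *\<^sub>R v))\<^sup>2)"
        unfolding norm_scaleR using coord_exp_linear_error[of "(s - t) *\<^sub>R v"] elim by (intro mult_left_mono) auto
      also have "\<dots> = 3 * C * (norm v)\<^sup>2 * \<bar>s - t\<bar>"
        using elim by (simp add: power2_eq_square)
      finally show ?case .
    qed
    have "(\<lambda>s. 3 * C * (norm v)\<^sup>2 * \<bar>s - t\<bar>) \<midarrow>t\<rightarrow> 3 * C * (norm v)\<^sup>2 * \<bar>t - t\<bar>" by (intro tendsto_intros)
    then show "(\<lambda>s. 3 * C * (norm v)\<^sup>2 * \<bar>s - t\<bar>) \<midarrow>t\<rightarrow> 0" by simp
  qed
  then show ?thesis
    unfolding has_vector_derivative_tendsto by (simp add: LIM_zero_iff coord_exp_zero)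
qed

lemma expo_nhds:
  assumes W: "openin T W" "expo (t *\<^sub>R v) \<in> W"
  shows "\<exists>\<delta>>0. \<forall>s. \<bar>s - t\<bar> < \<delta> \<longrightarrow> expo (s *\<^sub>R v) \<in> W"
proof -
  define W' where "W' = {h \<in> carrier G. expo (t *\<^sub>R v) \<otimes> h \<in> W}"
  have "openin T W'" unfolding W'_def by (rule openin_left_translate[OF W(1) expo_carrier])
  moreover have "\<one> \<in> W'" using W expo_carrier by (simp add: W'_def)
  ultimately obtain \<epsilon> where e: "\<epsilon> > 0" "\<And>x. norm x < \<epsilon> \<Longrightarrow> q x \<in> W'" using small_nhds by blast
  \<comment> \<open>\<open>r / 16\<close> keeps the increment where \<open>expo\<close> is given by
    \<open>coord_exp\<close>, \<open>\<epsilon> / 3\<close> pays for the factor 3/2 in its norm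
    bound, and \<open>norm v + 1\<close> avoids division by zero.\<close>
  define \<delta> where "\<delta> = min (r / 16) (\<epsilon> / 3) / (norm v + 1)"
  have v1: "norm v + 1 > 0" by (simp add: add_nonneg_pos)
  have "\<delta> > 0" using e r_pos v1 by (simp add: \<delta>_def)
  moreover have "expo (s *\<^sub>R v) \<in> W" if s: "\<bar>s - t\<bar> < \<delta>" for s
  proof -
    have "\<bar>s - t\<bar> * norm v \<le> \<bar>s - t\<bar> * (norm v + 1)" by (intro mult_left_mono) auto
    also have "\<dots> < min (r / 16) (\<epsilon> / 3)" using s v1 by (simp add: \<delta>_def pos_less_divide_eq)
    finally have small: "norm ((s - t) *\<^sub>R v) < r / 16" "norm ((s - t) *\<^sub>R v) < \<epsilon> / 3" by simp_all
    have "norm (coord_exp ((s - t) *\<^sub>R v)) \<le> 3/2 * norm ((s - t) *\<^sub>R v)"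
      using small r_pos by (intro norm_coord_exp_le) auto
    then have "norm (coord_exp ((s - t) *\<^sub>R v)) < \<epsilon>" using small(2) e by linarith
    then have "expo ((s - t) *\<^sub>R v) \<in> W'" using e expo_small[of "(s - t) *\<^sub>R v"] small r_pos by simp
    then show ?thesis using expo_add[of t v "s - t"] by (simp add: W'_def)
  qed
  ultimately show ?thesis by blast
qed

lemma expo_open_preimage: "openin T W \<Longrightarrow> open ((\<lambda>t. expo (t *\<^sub>R v)) -` W)"
  unfolding open_dist using expo_nhds[of W _ v] by (auto simp: dist_real_def)

lemma expo_continuous: "continuous_map euclideanreal T (\<lambda>t. expo (t *\<^sub>R v))"
  unfolding continuous_map_def using expo_open_preimage[of _ v] expo_carrier topspace_carrier
  by (auto simp: vimage_def)

text \<open>In a chart, the curve solves an autonomous equation whose right-hand side is smooth, so it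
  inherits any number of derivatives.\<close>

lemma expo_times_differentiable:
  assumes c: "(V, \<psi>) \<in> A"
  shows "times_differentiable ((\<lambda>t. expo (t *\<^sub>R v)) -` V) n (\<lambda>t. \<psi> (expo (t *\<^sub>R v)))"
proof -
  define \<gamma> where "\<gamma> t = expo (t *\<^sub>R v)" for t
  define I where "I = \<gamma> -` V"
  define S where "S = {(\<psi> g, \<phi> h) | g h. g \<in> V \<and> h \<in> U \<and> g \<otimes> h \<in> V}"
  obtain D where D: "derivative_tower S D"
    and Dv: "\<And>g h. g \<in> V \<Longrightarrow> h \<in> U \<Longrightarrow> g \<otimes> h \<in> V \<Longrightarrow> D (\<psi> g, \<phi> h) [] = \<psi> (g \<otimes> h)"
    using mult_tower[OF c chart c] unfolding S_def by blast
  have \<gamma>c: "\<gamma> t \<in> carrier G" for t by (simp add: \<gamma>_def expo_carrier)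
  have I: "open I" unfolding I_def \<gamma>_def by (rule expo_open_preimage[OF chart_domain[OF c]])
  have inS: "(\<psi> (\<gamma> t), \<phi> \<one>) \<in> S" if "t \<in> I" for t
    using that one_in_U \<gamma>c unfolding S_def I_def by force
  \<comment> \<open>Near \<open>t\<close> the curve is \<open>\<gamma> t\<close> times the
    exponential of \<open>(s - t) * v\<close>. Hence the derivative of \<open>coord_exp\<close> at 0
    alone, fed through the multiplication, gives the derivative of the curve everywhere.\<close>
  have der: "((\<lambda>s. \<psi> (\<gamma> s)) has_vector_derivative D (\<psi> (\<gamma> t), \<phi> \<one>) [(0, v)]) (at t)" if t: "t \<in> I" for t
  proof -
    have 1: "((\<lambda>s. (\<psi> (\<gamma> t), coord_exp ((s - t) *\<^sub>R v) + \<phi> \<one>)) has_vector_derivative (0, v)) (at t)"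
      using has_vector_derivative_Pair[OF has_vector_derivative_const
        has_vector_derivative_add[OF coord_exp_has_vector_derivative has_vector_derivative_const]]
      by simp
    have S': "(\<psi> (\<gamma> t), coord_exp ((t - t) *\<^sub>R v) + \<phi> \<one>) \<in> S" using inS[OF t] coord_exp_zero by simp
    have 2: "((\<lambda>s. D (\<psi> (\<gamma> t), coord_exp ((s - t) *\<^sub>R v) + \<phi> \<one>) []) has_vector_derivative D (\<psi> (\<gamma> t), \<phi> \<one>) [(0, v)]) (at t)"
      using derivative_tower_chain[OF D S' 1, of "[]" "\<lambda>u. u 0"] coord_exp_zero by simp
    define J where "J = I \<inter> {s. norm ((s - t) *\<^sub>R v) < r / 8}"
    have "open J" unfolding J_def by (intro open_Int I open_Collect_less continuous_intros)
    show ?thesis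
    proof (rule has_vector_derivative_transform_within_open[OF 2 \<open>open J\<close>])
      show "t \<in> J" using t r_pos by (simp add: J_def)
      fix s assume s: "s \<in> J"
      define h where "h = q (coord_exp ((s - t) *\<^sub>R v))"
      have "norm (coord_exp ((s - t) *\<^sub>R v)) < R" using s r_pos by (intro norm_coord_exp_less_R) (auto simp: J_def)
      then have h: "h \<in> U" "\<phi> h = coord_exp ((s - t) *\<^sub>R v) + \<phi> \<one>"
        using q_in_U lam_q[of "coord_exp ((s - t) *\<^sub>R v)"] by (auto simp: h_def lam_eq algebra_simps)
      have "\<gamma> t \<otimes> h = \<gamma> s"
        using expo_add[of t v "s - t"] expo_small[of "(s - t) *\<^sub>R v"] s by (simp add: \<gamma>_def h_def J_def)
      then show "D (\<psi> (\<gamma> t), coord_exp ((s - t) *\<^sub>R v) + \<phi> \<one>) [] = \<psi> (\<gamma> s)"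
        using Dv[of "\<gamma> t" h] h t s by (simp add: J_def I_def)
    qed
  qed
  have "times_differentiable I n (\<lambda>t. \<psi> (\<gamma> t))"
  proof (induction n)
    case (Suc n)
    \<comment> \<open>Bootstrapping: the derivative depends on \<open>t\<close> only through the
      curve itself, so \<open>n\<close> derivatives of the curve yield \<open>n\<close> derivatives
      of its velocity.\<close>
    have "times_differentiable I n (\<lambda>t. D (\<psi> (\<gamma> t), \<phi> \<one>) (map (\<lambda>u. u t) [\<lambda>t. (0, v)]))"
      by (rule times_differentiable_tower[OF D inS])
        (auto intro!: times_differentiable_Pair Suc times_differentiable_const)
    then have "times_differentiable I n (\<lambda>t. D (\<psi> (\<gamma> t), \<phi> \<one>) [(0, v)])" by simp
    moreover have "\<forall>t\<in>I. ((\<lambda>t. \<psi> (\<gamma> t)) has_vector_derivative D (\<psi> (\<gamma> t), \<phi> \<one>) [(0, v)]) (at t)"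
      using der by simp
    ultimately show ?case unfolding times_differentiable.simps
      by (intro exI[of _ "\<lambda>t. D (\<psi> (\<gamma> t), \<phi> \<one>) [(0, v)]"] conjI)
  qed simp
  then show ?thesis by (simp add: I_def \<gamma>_def[abs_def])
qed

lemma expo_one_parameter_subgroup: "one_parameter_subgroup G T A (\<lambda>t. expo (t *\<^sub>R v))"
proof -
  have "smooth_on ((\<lambda>t. expo (t *\<^sub>R v)) -` V) (\<lambda>t. \<psi> (expo (t *\<^sub>R v)))" if c: "(V, \<psi>) \<in> A" for V \<psi>
    by (rule times_differentiable_smooth_on[OF expo_open_preimage[OF chart_domain[OF c]] expo_times_differentiable[OF c]])
  then show ?thesis
    unfolding one_parameter_subgroup_def smooth_map_def std_atlas_def
    using expo_continuous[of v] expo_add by (auto simp: o_def)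
qed

text \<open>In the base chart this is the derivative of \<open>coord_exp\<close> at 0. In any other
  chart the chain rule applies the derivative of the chart change, which is what membership in the
  tangent space prescribes for \<open>X\<close>.\<close>

lemma expo_has_velocity:
  assumes X: "X \<in> tangent_space A \<one>"
  shows "has_velocity A (\<lambda>t. expo (t *\<^sub>R X (U, \<phi>))) X 0"
  unfolding has_velocity_def
proof (intro conjI ballI, goal_cases)
  case 1
  then show ?case using X expo_zero by simp
next
  case (2 c)
  define v where "v = X (U, \<phi>)"
  obtain V \<psi> where c: "c = (V, \<psi>)" "(V, \<psi>) \<in> A" "\<one> \<in> V"
    using 2 expo_zero by (cases c) (auto simp: charts_at_def)
  have ch: "(U, \<phi>) \<in> charts_at A \<one>" "(V, \<psi>) \<in> charts_at A \<one>" using chart one_in_U c by (auto simp: charts_at_def)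
  have Xc: "X (V, \<psi>) = frechet_derivative (\<psi> \<circ> inv_into U \<phi>) (at (\<phi> \<one>)) v"
    using X ch unfolding tangent_space_def v_def by blast
  have "smooth_on (\<phi> ` (U \<inter> V)) (\<psi> \<circ> inv_into U \<phi>)"
    using charts_compatible[OF chart c(2)] by (simp add: smooth_compatible_def)
  then obtain f' where f': "((\<psi> \<circ> inv_into U \<phi>) has_derivative f') (at (\<phi> \<one>))"
    using smooth_on_has_derivative[of _ _ "\<phi> \<one>"] one_in_U c by blast
  then have Xc: "X (V, \<psi>) = f' v" using Xc frechet_derivative_at by metis
  have "((\<lambda>s. coord_exp ((s - 0) *\<^sub>R v) + \<phi> \<one>) has_vector_derivative v + 0) (at 0)"
    by (intro has_vector_derivative_add coord_exp_has_vector_derivative has_vector_derivative_const)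
  then have "((\<lambda>s. coord_exp (s *\<^sub>R v) + \<phi> \<one>) has_derivative (\<lambda>h. h *\<^sub>R v)) (at 0)"
    by (simp add: has_vector_derivative_def)
  moreover have "((\<psi> \<circ> inv_into U \<phi>) has_derivative f') (at (coord_exp (0 *\<^sub>R v) + \<phi> \<one>))" using f' coord_exp_zero by simp
  ultimately have "((\<lambda>s. (\<psi> \<circ> inv_into U \<phi>) (coord_exp (s *\<^sub>R v) + \<phi> \<one>)) has_derivative (\<lambda>h. f' (h *\<^sub>R v))) (at 0)"
    by (rule has_derivative_compose)
  then have 1: "((\<lambda>s. \<psi> (q (coord_exp (s *\<^sub>R v)))) has_vector_derivative f' v) (at 0)"
    using linear_scale[OF has_derivative_linear[OF f']] by (simp add: has_vector_derivative_def q_eq)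
  have "open {s. norm (s *\<^sub>R v) < r / 8}" by (intro open_Collect_less continuous_intros)
  from has_vector_derivative_transform_within_open[OF 1 this]
  have "((\<lambda>s. \<psi> (expo (s *\<^sub>R v))) has_vector_derivative f' v) (at 0)"
    using r_pos expo_small by simp
  then show ?case using Xc by (simp add: c o_def v_def)
qed

section \<open>Uniqueness of one-parameter subgroups\<close>

text \<open>\<open>\<gamma> t\<close> is the \<open>n\<close>-th power of
  \<open>\<gamma> (t / n)\<close>, and the velocity at 0 makes \<open>n\<close> times the coordinate
  of the latter converge to \<open>t * v\<close>. So \<open>coord_power_tendsto\<close> determines
  \<open>\<gamma> t\<close> for small \<open>t\<close>, and powers reach all others.\<close>

lemma one_parameter_subgroup_unique:
  assumes g: "one_parameter_subgroup G T A \<gamma>" and vel: "has_velocity A \<gamma> X 0"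
  shows "\<gamma> t = expo (t *\<^sub>R X (U, \<phi>))"
proof -
  define v where "v = X (U, \<phi>)"
  have cont: "continuous_map euclideanreal T \<gamma>" and add: "\<And>s t. \<gamma> (s + t) = \<gamma> s \<otimes> \<gamma> t"
    using g by (auto simp: one_parameter_subgroup_def smooth_map_def)
  have \<gamma>c: "\<gamma> t \<in> carrier G" for t using cont topspace_carrier by (auto simp: continuous_map_def Pi_def)
  have \<gamma>0: "\<gamma> 0 = \<one>" using add[of 0 0] \<gamma>c[of 0] by (metis add.right_neutral r_cancel_one')
  have pow: "\<gamma> (real n * s) = \<gamma> s [^] n" for n s
  proof (induction n)
    case (Suc n)
    have "\<gamma> (real (Suc n) * s) = \<gamma> (real n * s + s)" by (simp add: algebra_simps)
    then show ?case unfolding add Suc by simp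
  qed (simp add: \<gamma>0)
  have "(U, \<phi>) \<in> charts_at A (\<gamma> 0)" using chart one_in_U \<gamma>0 by (simp add: charts_at_def)
  then have der: "((\<phi> \<circ> \<gamma>) has_vector_derivative v) (at 0)"
    using vel unfolding has_velocity_def v_def by blast
  have "openin euclideanreal {s \<in> topspace euclideanreal. \<gamma> s \<in> U}"
    using cont chart_domain[OF chart] unfolding continuous_map_def by blast
  then have "open {s. \<gamma> s \<in> U}" by simp
  then obtain \<delta> where d: "\<delta> > 0" "\<And>s. \<bar>s\<bar> < \<delta> \<Longrightarrow> \<gamma> s \<in> U"
    using \<gamma>0 one_in_U unfolding open_dist dist_real_def by (metis diff_zero mem_Collect_eq)
  have small: "\<gamma> t = q (coord_exp (t *\<^sub>R v))" if t: "norm (t *\<^sub>R v) < r / 4" "t \<noteq> 0" for t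
  proof -
    define x where "x n = lam (\<gamma> (t / real n))" for n :: nat
    have tn: "(\<lambda>n. t / real n) \<longlonglongrightarrow> 0" by (rule lim_const_over_n)
    have lim: "((\<lambda>s. (1 / s) *\<^sub>R lam (\<gamma> s)) \<longlongrightarrow> v) (at 0)"
      using der unfolding has_vector_derivative_tendsto by (simp add: lam_eq \<gamma>0)
    have "filterlim (\<lambda>n. t / real n) (at 0) sequentially"
      unfolding filterlim_at using tn t(2) by (auto intro!: eventually_sequentiallyI[of 1])
    then have "(\<lambda>n. (1 / (t / real n)) *\<^sub>R x n) \<longlonglongrightarrow> v"
      unfolding x_def by (rule filterlim_compose[OF lim])
    then have "(\<lambda>n. t *\<^sub>R (1 / (t / real n)) *\<^sub>R x n) \<longlonglongrightarrow> t *\<^sub>R v" by (intro tendsto_intros)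
    then have nx: "(\<lambda>n. real n *\<^sub>R x n) \<longlonglongrightarrow> t *\<^sub>R v" using t(2) by simp
    have x0: "x \<longlonglongrightarrow> 0"
    proof (rule Lim_transform_eventually)
      show "(\<lambda>n. inverse (real n) *\<^sub>R (real n *\<^sub>R x n)) \<longlonglongrightarrow> 0"
        using tendsto_scaleR[OF lim_inverse_n nx] by simp
      show "\<forall>\<^sub>F n in sequentially. inverse (real n) *\<^sub>R real n *\<^sub>R x n = x n"
        by (rule eventually_sequentiallyI[of 1]) simp
    qed
    have "\<forall>\<^sub>F n in sequentially. norm (real n *\<^sub>R x n) < r / 4"
      by (rule order_tendstoD(2)[OF tendsto_norm[OF nx] t(1)])
    moreover have "\<forall>\<^sub>F n in sequentially. norm (t / real n) < \<delta>"
      by (rule order_tendstoD(2)[OF tendsto_norm_zero[OF tn] d(1)])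
    moreover have "\<forall>\<^sub>F n in sequentially. n \<ge> 1" by (rule eventually_ge_at_top)
    ultimately have "\<forall>\<^sub>F n in sequentially. norm (real n *\<^sub>R x n) < r / 4 \<and> \<gamma> (t / real n) \<in> U \<and> n \<ge> 1"
      by eventually_elim (use d in auto)
    then obtain K where K: "\<And>n. n \<ge> K \<Longrightarrow> norm (real n *\<^sub>R x n) < r / 4 \<and> \<gamma> (t / real n) \<in> U \<and> n \<ge> 1"
      unfolding eventually_sequentially by blast
    have le: "real (n + K) * norm (x (n + K)) \<le> r / 2" for n
      using K[of "n + K"] r_pos by simp
    \<comment> \<open>From index \<open>K\<close> on these powers all equal
      \<open>\<gamma> t\<close>, so the sequence whose limit is computed is constant.\<close>
    have qP: "q (coord_power (n + K) (x (n + K))) = \<gamma> t \<and> coord_power (n + K) (x (n + K)) = lam (\<gamma> t)" for n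
    proof -
      have "q (x (n + K)) = \<gamma> (t / real (n + K))" unfolding x_def using K[of "n + K"] q_lam by simp
      then have "q (x (n + K)) [^] (n + K) = \<gamma> t"
        using pow[of "n + K" "t / real (n + K)"] K[of "n + K"] by simp
      moreover have "real (n + K) * norm (x (n + K)) \<le> r" using le[of n] r_pos by linarith
      ultimately show ?thesis using q_pow[of "n + K" "x (n + K)"] by (simp add: coord_power_def)
    qed
    have "(\<lambda>n. coord_power (n + K) (x (n + K))) \<longlonglongrightarrow> coord_exp (t *\<^sub>R v)"
      by (rule coord_power_tendsto[OF LIMSEQ_ignore_initial_segment[OF nx] LIMSEQ_ignore_initial_segment[OF x0] le])
    then have "(\<lambda>n::nat. lam (\<gamma> t)) \<longlonglongrightarrow> coord_exp (t *\<^sub>R v)" using qP by simp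
    from LIMSEQ_unique[OF tendsto_const this] have "lam (\<gamma> t) = coord_exp (t *\<^sub>R v)" .
    then show ?thesis using qP by metis
  qed
  show ?thesis
  proof (cases "t = 0")
    case True
    then show ?thesis using \<gamma>0 expo_zero by simp
  next
    case False
    obtain n where n: "n > 0" "norm (t *\<^sub>R v) / real n < r / 8" using exists_divisor by blast
    have eq: "(t / real n) *\<^sub>R v = (t *\<^sub>R v) /\<^sub>R real n" by (simp add: divide_inverse_commute)
    have "norm ((t / real n) *\<^sub>R v) = norm (t *\<^sub>R v) / real n" by simp
    then have "norm ((t / real n) *\<^sub>R v) < r / 4" using n(2) r_pos by linarith
    then have "\<gamma> (t / real n) = q (coord_exp ((t *\<^sub>R v) /\<^sub>R real n))" using small[of "t / real n"] False n(1) eq by simp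
    then have "\<gamma> (real n * (t / real n)) = expo (t *\<^sub>R v)" using pow[of n "t / real n"] expo_eq[OF n] by simp
    then show ?thesis using n by (simp add: v_def)
  qed
qed

lemma lie_exp_eq:
  assumes X: "X \<in> tangent_space A \<one>"
  shows "lie_exp G T A X = expo (X (U, \<phi>))"
proof -
  have "(THE \<gamma>. one_parameter_subgroup G T A \<gamma> \<and> has_velocity A \<gamma> X 0) = (\<lambda>t. expo (t *\<^sub>R X (U, \<phi>)))"
    using expo_one_parameter_subgroup expo_has_velocity[OF X] one_parameter_subgroup_unique
    by (intro the_equality) auto
  then show ?thesis by (simp add: lie_exp_def)
qed

end

section \<open>The exponential length\<close>

locale normed_lie_chart = lie_chart G T A U lam q R C \<phi>
  for G :: "('g, 'm) monoid_scheme" (structure) and T :: "'g topology"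
    and A :: "('g, 'e::banach) chart set"
    and U :: "'g set" and lam :: "'g \<Rightarrow> 'e" and q :: "'e \<Rightarrow> 'g" and R C :: real
    and \<phi> :: "'g \<Rightarrow> 'e" +
  fixes N :: "(('g, 'e) chart \<Rightarrow> 'e) \<Rightarrow> real"
  assumes compatible_norm: "compatible_norm A \<one> N"
    and connected: "connected_space T"
begin

abbreviation TS where "TS \<equiv> tangent_space A \<one>"

lemma base_chart: "(U, \<phi>) \<in> charts_at A \<one>"
  using chart one_in_U by (simp add: charts_at_def)

lemma linear_chart_change:
  assumes "(V, \<psi>) \<in> charts_at A \<one>" "(V', \<psi>') \<in> charts_at A \<one>"
  shows "linear (frechet_derivative (\<psi>' \<circ> inv_into V \<psi>) (at (\<psi> \<one>)))"
proof -
  have c: "(V, \<psi>) \<in> A" "(V', \<psi>') \<in> A" "\<one> \<in> V" "\<one> \<in> V'" using assms by (auto simp: charts_at_def)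
  have "smooth_on (\<psi> ` (V \<inter> V')) (\<psi>' \<circ> inv_into V \<psi>)"
    using charts_compatible[OF c(1,2)] by (simp add: smooth_compatible_def)
  then obtain f' where "((\<psi>' \<circ> inv_into V \<psi>) has_derivative f') (at (\<psi> \<one>))"
    using smooth_on_has_derivative[of _ _ "\<psi> \<one>"] c by blast
  then show ?thesis using frechet_derivative_at has_derivative_linear by metis
qed

lemma tangent_space_lincomb:
  assumes "X \<in> TS" "Y \<in> TS"
  shows "(\<lambda>c. a *\<^sub>R X c + b *\<^sub>R Y c) \<in> TS"
proof -
  have "a *\<^sub>R X c + b *\<^sub>R Y c = 0" if "c \<notin> charts_at A \<one>" for c
  proof -
    have "X c = 0" "Y c = 0" using assms that unfolding tangent_space_def by blast+
    then show ?thesis by simp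
  qed
  moreover have "a *\<^sub>R X (V', \<psi>') + b *\<^sub>R Y (V', \<psi>') =
      frechet_derivative (\<psi>' \<circ> inv_into V \<psi>) (at (\<psi> \<one>)) (a *\<^sub>R X (V, \<psi>) + b *\<^sub>R Y (V, \<psi>))"
    if ch: "(V, \<psi>) \<in> charts_at A \<one>" "(V', \<psi>') \<in> charts_at A \<one>" for V \<psi> V' \<psi>'
  proof -
    note lin = linear_chart_change[OF ch]
    have "X (V', \<psi>') = frechet_derivative (\<psi>' \<circ> inv_into V \<psi>) (at (\<psi> \<one>)) (X (V, \<psi>))"
      "Y (V', \<psi>') = frechet_derivative (\<psi>' \<circ> inv_into V \<psi>) (at (\<psi> \<one>)) (Y (V, \<psi>))"
      using assms ch unfolding tangent_space_def by blast+
    then show ?thesis by (simp only: linear_add[OF lin] linear_scale[OF lin])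
  qed
  ultimately show ?thesis unfolding tangent_space_def by blast
qed

lemma tangent_space_scale: "X \<in> TS \<Longrightarrow> (\<lambda>c. a *\<^sub>R X c) \<in> TS"
  using tangent_space_lincomb[of X X a 0] by simp

lemma tangent_space_diff: "X \<in> TS \<Longrightarrow> Y \<in> TS \<Longrightarrow> (\<lambda>c. X c - Y c) \<in> TS"
  using tangent_space_lincomb[of X Y 1 "-1"] by simp

lemma N_nonneg: "X \<in> TS \<Longrightarrow> 0 \<le> N X"
  and N_eq_0: "X \<in> TS \<Longrightarrow> N X = 0 \<longleftrightarrow> X = (\<lambda>c. 0)"
  and N_scale: "X \<in> TS \<Longrightarrow> N (\<lambda>c. a *\<^sub>R X c) = \<bar>a\<bar> * N X"
  and N_add: "X \<in> TS \<Longrightarrow> Y \<in> TS \<Longrightarrow> N (\<lambda>c. X c + Y c) \<le> N X + N Y"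
  using compatible_norm by (auto simp: compatible_norm_def)

definition "tdist = restrict_dist TS (\<lambda>X Y. N (\<lambda>c. X c - Y c))"

lemma tdist_eq: "X \<in> TS \<Longrightarrow> Y \<in> TS \<Longrightarrow> tdist X Y = N (\<lambda>c. X c - Y c)"
  by (simp add: tdist_def restrict_dist_def)

lemma tdist_metric: "Metric_space TS tdist"
proof
  show "0 \<le> tdist X Y" for X Y
    using N_nonneg tangent_space_diff by (simp add: tdist_def restrict_dist_def)
  show "tdist X Y = tdist Y X" for X Y
  proof (cases "X \<in> TS \<and> Y \<in> TS")
    case True
    then show ?thesis
      using N_scale[OF tangent_space_diff[of X Y], of "-1"] by (simp add: tdist_eq)
  qed (auto simp: tdist_def restrict_dist_def)
  show "tdist X Y = 0 \<longleftrightarrow> X = Y" if "X \<in> TS" "Y \<in> TS" for X Y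
    using N_eq_0[OF tangent_space_diff[OF that]] that by (auto simp: tdist_eq fun_eq_iff)
  show "tdist X Z \<le> tdist X Y + tdist Y Z" if "X \<in> TS" "Y \<in> TS" "Z \<in> TS" for X Y Z
    using N_add[OF tangent_space_diff[OF that(1,2)] tangent_space_diff[OF that(2,3)]] that by (simp add: tdist_eq)
qed

sublocale TM: Metric_space TS tdist by (rule tdist_metric)

lemma homeo: "homeomorphic_map TM.mtopology euclidean (\<lambda>X. X (U, \<phi>))"
  using compatible_norm base_chart unfolding compatible_norm_def tdist_def by blast

lemma coordinate_bij: "bij_betw (\<lambda>X. X (U, \<phi>)) TS UNIV"
  using homeomorphic_imp_injective_map[OF homeo] homeomorphic_imp_surjective_map[OF homeo]
  by (simp add: bij_betw_def)

definition tangent_of where "tangent_of v = inv_into TS (\<lambda>X. X (U, \<phi>)) v"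

lemma tangent_of_TS: "tangent_of v \<in> TS" and tangent_of_coordinate: "tangent_of v (U, \<phi>) = v"
proof -
  have v: "v \<in> (\<lambda>X. X (U, \<phi>)) ` TS" using coordinate_bij by (simp add: bij_betw_def)
  show "tangent_of v \<in> TS" unfolding tangent_of_def by (rule inv_into_into[OF v])
  show "tangent_of v (U, \<phi>) = v" unfolding tangent_of_def by (rule f_inv_into_f[OF v])
qed

lemma coordinate_tangent_of: "X \<in> TS \<Longrightarrow> tangent_of (X (U, \<phi>)) = X"
  unfolding tangent_of_def by (rule inv_into_f_f[OF bij_betw_imp_inj_on[OF coordinate_bij]])

lemma tangent_of_scale: "tangent_of (a *\<^sub>R v) = (\<lambda>c. a *\<^sub>R tangent_of v c)"
  using coordinate_tangent_of[OF tangent_space_scale[OF tangent_of_TS, of a v]] by (simp add: tangent_of_coordinate)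

definition chart_norm where "chart_norm v = N (tangent_of v)"

lemma chart_norm_nonneg: "0 \<le> chart_norm v"
  by (simp add: chart_norm_def N_nonneg tangent_of_TS)

lemma chart_norm_scale: "chart_norm (a *\<^sub>R v) = \<bar>a\<bar> * chart_norm v"
  by (simp add: chart_norm_def tangent_of_scale N_scale tangent_of_TS)

lemma chart_norm_uminus: "chart_norm (- v) = chart_norm v"
  using chart_norm_scale[of "-1" v] by simp

lemma zero_TS: "(\<lambda>c. 0) \<in> TS"
  using tangent_space_scale[OF tangent_of_TS, of 0 0] by simp

text \<open>Continuity of the coordinate map and of its inverse compare unit balls in both
  directions, and homogeneity turns this into an equivalence of norms.\<close>

lemma chart_norm_bounds: "\<exists>a>0. \<exists>b>0. \<forall>v. a * norm v \<le> chart_norm v \<and> chart_norm v \<le> b * norm v"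
proof -
  have "openin TM.mtopology {X \<in> topspace TM.mtopology. X (U, \<phi>) \<in> ball 0 1}"
    by (rule openin_continuous_map_preimage[OF homeomorphic_imp_continuous_map[OF homeo]]) simp
  moreover have "(\<lambda>c. 0) \<in> {X \<in> topspace TM.mtopology. X (U, \<phi>) \<in> ball 0 1}"
    using zero_TS by simp
  ultimately obtain \<delta> where d: "\<delta> > 0" "TM.mball (\<lambda>c. 0) \<delta> \<subseteq> {X \<in> topspace TM.mtopology. X (U, \<phi>) \<in> ball 0 1}"
    unfolding TM.openin_mtopology by blast
  have lower: "norm v < 1" if "chart_norm v < \<delta>" for v
  proof -
    have "tdist (\<lambda>c. 0) (tangent_of v) = chart_norm v"
      using tdist_eq[OF tangent_of_TS zero_TS, of v] TM.commute by (simp add: chart_norm_def)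
    then have "tangent_of v \<in> TM.mball (\<lambda>c. 0) \<delta>" using that zero_TS tangent_of_TS by simp
    then show ?thesis using d(2) tangent_of_coordinate[of v] by auto
  qed
  have lo: "\<delta> / 2 * norm v \<le> chart_norm v" for v
  proof (rule ccontr)
    assume "\<not> \<delta> / 2 * norm v \<le> chart_norm v"
    then have lt: "chart_norm v < \<delta> / 2 * norm v" by simp
    then have "norm v > 0" using chart_norm_nonneg[of v] d(1) by (cases "v = 0") auto
    \<comment> \<open>The rescaled vector has norm 2, against the bound 1 from
      \<open>lower\<close>.\<close>
    then have "chart_norm ((2 / norm v) *\<^sub>R v) < \<delta>" using lt by (simp add: chart_norm_scale field_simps)
    from lower[OF this] show False using \<open>norm v > 0\<close> by simp
  qed
  have "open ((\<lambda>X. X (U, \<phi>)) ` TM.mball (\<lambda>c. 0) 1)"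
    using homeomorphic_imp_open_map[OF homeo] by (simp add: open_map_def)
  moreover have "0 \<in> (\<lambda>X. X (U, \<phi>)) ` TM.mball (\<lambda>c. 0) 1"
    using zero_TS by (intro image_eqI[of _ _ "\<lambda>c. 0"]) auto
  ultimately obtain \<epsilon> where e: "\<epsilon> > 0" "ball 0 \<epsilon> \<subseteq> (\<lambda>X. X (U, \<phi>)) ` TM.mball (\<lambda>c. 0) 1" by (meson openE)
  have upper: "chart_norm v < 1" if "norm v < \<epsilon>" for v
  proof -
    have "v \<in> ball 0 \<epsilon>" using that by simp
    then obtain X where "X \<in> TM.mball (\<lambda>c. 0) 1" "v = X (U, \<phi>)" using e by blast
    then show ?thesis using coordinate_tangent_of[of X] tdist_eq[OF _ zero_TS, of X] TM.commute by (simp add: chart_norm_def)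
  qed
  have up: "chart_norm v \<le> 2 / \<epsilon> * norm v" for v
  proof (cases "v = 0")
    case True
    then show ?thesis using chart_norm_scale[of 0 v] by simp
  next
    case False
    have "norm ((\<epsilon> / (2 * norm v)) *\<^sub>R v) < \<epsilon>" using False e by simp
    from upper[OF this] show ?thesis using False e by (simp add: chart_norm_scale field_simps)
  qed
  show ?thesis using lo up d(1) e(1)
    by (intro exI[of _ "\<delta> / 2"] exI[of _ "2 / \<epsilon>"] conjI allI) auto
qed

section \<open>Words of exponentials and their length\<close>

definition prodexp where "prodexp vs = foldr (\<lambda>v h. expo v \<otimes> h) vs \<one>"

lemma prodexp_simps [simp]: "prodexp [] = \<one>" "prodexp (v # vs) = expo v \<otimes> prodexp vs"
  by (simp_all add: prodexp_def)

lemma prodexp_carrier [simp]: "prodexp vs \<in> carrier G"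
  by (induction vs) (simp_all add: expo_carrier)

lemma prodexp_append: "prodexp (vs @ ws) = prodexp vs \<otimes> prodexp ws"
  by (induction vs) (simp_all add: expo_carrier m_assoc)

lemma prodexp_inv: "inv (prodexp vs) = prodexp (rev (map uminus vs))"
  by (induction vs) (simp_all add: prodexp_append expo_carrier expo_uminus inv_mult_group)

definition el where "el = exp_length G T A N"

text \<open>Tangent vectors correspond bijectively to their coordinates in the base chart, so from
  here on the words consist of vectors of the model space.\<close>

lemma el_eq: "el g = Inf {(\<Sum>v\<leftarrow>vs. chart_norm v) | vs. g = prodexp vs}"
proof -
  have fold: "foldr (\<lambda>X h. lie_exp G T A X \<otimes> h) Xs \<one> = prodexp (map (\<lambda>X. X (U, \<phi>)) Xs)" if "set Xs \<subseteq> TS" for Xs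
    using that by (induction Xs) (simp_all add: lie_exp_eq)
  have sum: "(\<Sum>X\<leftarrow>Xs. N X) = (\<Sum>v\<leftarrow>map (\<lambda>X. X (U, \<phi>)) Xs. chart_norm v)" if "set Xs \<subseteq> TS" for Xs
    using that by (induction Xs) (simp_all add: chart_norm_def coordinate_tangent_of)
  have "{(\<Sum>X\<leftarrow>Xs. N X) | Xs. set Xs \<subseteq> TS \<and> g = foldr (\<lambda>X h. lie_exp G T A X \<otimes> h) Xs \<one>}
      = {(\<Sum>v\<leftarrow>vs. chart_norm v) | vs. g = prodexp vs}" (is "?L = ?R")
  proof
    show "?L \<subseteq> ?R"
    proof
      fix s assume "s \<in> ?L"
      then obtain Xs where "set Xs \<subseteq> TS" "s = (\<Sum>X\<leftarrow>Xs. N X)" "g = foldr (\<lambda>X h. lie_exp G T A X \<otimes> h) Xs \<one>" by blast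
      then show "s \<in> ?R" using fold sum by blast
    qed
    show "?R \<subseteq> ?L"
    proof
      fix s assume "s \<in> ?R"
      then obtain vs where vs: "s = (\<Sum>v\<leftarrow>vs. chart_norm v)" "g = prodexp vs" by blast
      have set: "set (map tangent_of vs) \<subseteq> TS" using tangent_of_TS by auto
      have "map (\<lambda>X. X (U, \<phi>)) (map tangent_of vs) = vs" by (simp add: o_def tangent_of_coordinate)
      then show "s \<in> ?L" using fold[OF set] sum[OF set] vs set by (intro CollectI exI[of _ "map tangent_of vs"]) simp
    qed
  qed
  then show ?thesis unfolding el_def exp_length_def by simp
qed

lemma sum_chart_norm_nonneg: "0 \<le> (\<Sum>v\<leftarrow>vs. chart_norm v)"
  by (rule sum_list_nonneg) (auto simp: chart_norm_nonneg)

lemma el_bdd: "bdd_below {(\<Sum>v\<leftarrow>vs. chart_norm v) | vs. g = prodexp vs}"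
  using sum_chart_norm_nonneg by (intro bdd_belowI[of _ 0]) auto

lemma el_le: "el (prodexp vs) \<le> (\<Sum>v\<leftarrow>vs. chart_norm v)"
  unfolding el_eq by (rule cInf_lower[OF _ el_bdd]) blast

lemma expo_small_surj:
  assumes "norm x < r / 16"
  shows "\<exists>v. norm v \<le> 2 * norm x \<and> q x = expo v"
proof -
  obtain v where v: "norm v \<le> 2 * norm x" "coord_exp v = x" using coord_exp_surj[of x] assms r_pos by auto
  then have "expo v = q x" using expo_small[of v] assms by simp
  then show ?thesis using v by auto
qed

text \<open>A connected group is generated by any neighbourhood of the identity: the set of words is
  open and closed.\<close>

lemma prodexp_surj:
  assumes "g \<in> carrier G"
  shows "\<exists>vs. g = prodexp vs"
proof -
  define H where "H = range prodexp"
  define W where "W = {g \<in> U. norm (lam g) < r / 16}"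
  have W: "openin T W" unfolding W_def by (rule openin_small)
  have oneW: "\<one> \<in> W" using one_in_U lam_one r_pos by (simp add: W_def)
  have We: "\<exists>v. g = expo v" if "g \<in> W" for g
    using expo_small_surj[of "lam g"] q_lam that unfolding W_def by auto
  have Hmult: "a \<otimes> prodexp ws \<in> H" if a: "a \<in> H" for a ws
  proof -
    obtain vs where "a = prodexp vs" using a by (auto simp: H_def)
    then have "a \<otimes> prodexp ws = prodexp (vs @ ws)" by (simp add: prodexp_append)
    then show ?thesis unfolding H_def by blast
  qed
  \<comment> \<open>Membership in \<open>H\<close> is locally constant, since \<open>x\<close> and a
    nearby \<open>y\<close> differ by one exponential and its inverse. This gives openness of
    \<open>H\<close> and of its complement at once.\<close>
  have step: "\<exists>W'. openin T W' \<and> x \<in> W' \<and> (\<forall>y\<in>W'. y \<in> H \<longleftrightarrow> x \<in> H)" if x: "x \<in> carrier G" for x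
  proof (intro exI conjI ballI)
    let ?W = "{y \<in> carrier G. inv x \<otimes> y \<in> W}"
    show "openin T ?W" by (rule openin_left_translate[OF W]) (use x in simp)
    show "x \<in> ?W" using x oneW by simp
    fix y assume y: "y \<in> ?W"
    then obtain v where v: "inv x \<otimes> y = expo v" using We by blast
    have "y = x \<otimes> (inv x \<otimes> y)" using x y by (simp flip: m_assoc)
    then have y1: "y = x \<otimes> prodexp [v]" unfolding v by (simp add: expo_carrier)
    have "(x \<otimes> expo v) \<otimes> inv (expo v) = x" using x expo_carrier by (simp add: m_assoc)
    then have y2: "x = y \<otimes> prodexp [- v]"
      unfolding y1 by (simp add: expo_uminus expo_carrier)
    show "y \<in> H \<longleftrightarrow> x \<in> H"
    proof
      show "y \<in> H" if "x \<in> H" unfolding y1 by (rule Hmult[OF that])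
      show "x \<in> H" if "y \<in> H" by (subst y2) (rule Hmult[OF that])
    qed
  qed
  have Hc: "H \<subseteq> topspace T"
    unfolding topspace_carrier H_def using prodexp_carrier by (rule image_subsetI)
  have "openin T H"
  proof (rule openin_subopen[THEN iffD2], intro ballI)
    fix x assume x: "x \<in> H"
    then have "x \<in> carrier G" using Hc topspace_carrier by blast
    from step[OF this] obtain W' where "openin T W'" "x \<in> W'" "\<forall>y\<in>W'. y \<in> H \<longleftrightarrow> x \<in> H" by blast
    then show "\<exists>W'. openin T W' \<and> x \<in> W' \<and> W' \<subseteq> H" using x by (intro exI[of _ W']) auto
  qed
  moreover have "openin T (topspace T - H)"
  proof (rule openin_subopen[THEN iffD2], intro ballI)
    fix x assume x: "x \<in> topspace T - H"
    then have "x \<in> carrier G" using topspace_carrier by simp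
    from step[OF this] obtain W' where W': "openin T W'" "x \<in> W'" "\<forall>y\<in>W'. y \<in> H \<longleftrightarrow> x \<in> H" by blast
    have "W' \<subseteq> topspace T - H" using W'(3) x openin_subset[OF W'(1)] by blast
    with W' show "\<exists>W'. openin T W' \<and> x \<in> W' \<and> W' \<subseteq> topspace T - H" by blast
  qed
  ultimately have "H = {} \<or> H = topspace T"
    using connected Hc by (simp add: connected_space_clopen_in closedin_def)
  moreover have "H \<noteq> {}" by (simp add: H_def)
  ultimately have "g \<in> H" using assms topspace_carrier by simp
  then show ?thesis by (auto simp: H_def)
qed

lemma el_less:
  assumes "g \<in> carrier G" "el g < s"
  shows "\<exists>vs. g = prodexp vs \<and> (\<Sum>v\<leftarrow>vs. chart_norm v) < s"
proof -
  have "{(\<Sum>v\<leftarrow>vs. chart_norm v) | vs. g = prodexp vs} \<noteq> {}" using prodexp_surj[OF assms(1)] by auto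
  from cInf_lessD[OF this assms(2)[unfolded el_eq]] show ?thesis by blast
qed

lemma el_nonneg: "g \<in> carrier G \<Longrightarrow> 0 \<le> el g"
  using el_less[of g 0] sum_chart_norm_nonneg by (meson not_le)

lemma el_one: "el \<one> = 0"
  using el_le[of "[]"] el_nonneg[OF one_closed] by simp

lemma el_mult:
  assumes "g \<in> carrier G" "h \<in> carrier G"
  shows "el (g \<otimes> h) \<le> el g + el h"
proof (rule field_le_epsilon)
  fix \<epsilon> :: real assume e: "\<epsilon> > 0"
  obtain vs ws where v: "g = prodexp vs" "(\<Sum>v\<leftarrow>vs. chart_norm v) < el g + \<epsilon> / 2"
    and w: "h = prodexp ws" "(\<Sum>v\<leftarrow>ws. chart_norm v) < el h + \<epsilon> / 2"
    using el_less[OF assms(1), of "el g + \<epsilon> / 2"] el_less[OF assms(2), of "el h + \<epsilon> / 2"] e by auto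
  show "el (g \<otimes> h) \<le> el g + el h + \<epsilon>"
    using el_le[of "vs @ ws"] v w by (simp add: prodexp_append)
qed

lemma el_inv_le:
  assumes "g \<in> carrier G"
  shows "el (inv g) \<le> el g"
proof (rule field_le_epsilon)
  fix \<epsilon> :: real assume e: "\<epsilon> > 0"
  obtain vs where v: "g = prodexp vs" "(\<Sum>v\<leftarrow>vs. chart_norm v) < el g + \<epsilon>"
    using el_less[OF assms(1), of "el g + \<epsilon>"] e by auto
  have "(\<Sum>v\<leftarrow>rev (map uminus vs). chart_norm v) = (\<Sum>v\<leftarrow>vs. chart_norm v)"
    by (induction vs) (simp_all add: chart_norm_uminus)
  then show "el (inv g) \<le> el g + \<epsilon>"
    using el_le[of "rev (map uminus vs)"] v by (simp add: prodexp_inv)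
qed

lemma el_inv: "g \<in> carrier G \<Longrightarrow> el (inv g) = el g"
  using el_inv_le[of g] el_inv_le[of "inv g"] by simp

section \<open>Comparison of length and coordinate norm\<close>

text \<open>A word of length below \<open>a * r / 16\<close> has total model norm at most
  \<open>r / 16\<close>. Then each letter lies where \<open>expo\<close> is \<open>coord_exp\<close>
  and \<open>product_estimate\<close> applies to the whole word.\<close>

lemma el_lower: "\<exists>\<eta>>0. \<exists>K>0. \<forall>g\<in>carrier G. el g < \<eta> \<longrightarrow> g \<in> U \<and> norm (lam g) \<le> K * el g"
proof -
  obtain a where a: "a > 0" "\<And>v. a * norm v \<le> chart_norm v" using chart_norm_bounds by blast
  have *: "g \<in> U \<and> norm (lam g) \<le> 3 / a * s" if g: "g \<in> carrier G" "el g < s" "s \<le> a * r / 16" for g s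
  proof -
    obtain vs where vs: "g = prodexp vs" "(\<Sum>v\<leftarrow>vs. chart_norm v) < s" using el_less[OF g(1,2)] by blast
    have "a * (\<Sum>v\<leftarrow>vs. norm v) \<le> (\<Sum>v\<leftarrow>vs. chart_norm v)"
      using sum_list_mono[of vs "\<lambda>v. a * norm v" chart_norm] a by (simp add: sum_list_const_mult)
    then have s: "(\<Sum>v\<leftarrow>vs. norm v) \<le> s / a" using vs a(1) by (simp add: pos_le_divide_eq mult.commute)
    have "s / a \<le> r / 16" using g(3) a(1) by (simp add: field_simps)
    then have sr: "(\<Sum>v\<leftarrow>vs. norm v) \<le> r / 16" using s by linarith
    have "prodexp ws = foldr (\<lambda>X h. q (coord_exp X) \<otimes> h) ws \<one>" if "(\<Sum>v\<leftarrow>ws. norm v) \<le> r / 16" for ws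
      using that
    proof (induction ws)
      case (Cons w ws)
      have "0 \<le> (\<Sum>v\<leftarrow>ws. norm v)" by (rule sum_list_nonneg) auto
      then have "norm w < r / 8" "(\<Sum>v\<leftarrow>ws. norm v) \<le> r / 16"
        using Cons.prems r_pos norm_ge_zero[of w] by (simp_all del: norm_ge_zero)
      then show ?case using Cons.IH expo_small by simp
    qed simp
    then have "g = foldr (\<lambda>X h. q (coord_exp X) \<otimes> h) vs \<one>" using sr vs by simp
    moreover have "(\<Sum>v\<leftarrow>vs. norm v) \<le> r / 4" using sr r_pos by linarith
    ultimately have "g \<in> U" "norm (lam g) \<le> 3 * (\<Sum>v\<leftarrow>vs. norm v)" using product_estimate[of vs] by simp_all
    then show ?thesis using s by simp
  qed
  have main: "g \<in> U \<and> norm (lam g) \<le> 3 / a * el g" if g: "g \<in> carrier G" "el g < a * r / 16" for g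
  proof
    show "g \<in> U" using *[OF g(1) g(2)] by simp
    \<comment> \<open>The infimum may not be attained, so the bound is obtained for all slightly
      larger \<open>s\<close> and then for \<open>el g\<close> itself.\<close>
    have "norm (lam g) * a / 3 \<le> el g"
    proof (rule dense_ge_bounded[OF g(2)])
      fix s assume "el g < s" "s < a * r / 16"
      then show "norm (lam g) * a / 3 \<le> s" using *[OF g(1), of s] a(1) by (simp add: field_simps)
    qed
    then show "norm (lam g) \<le> 3 / a * el g" using a(1) by (simp add: field_simps)
  qed
  show ?thesis using main a r_pos by (intro exI[of _ "a * r / 16"] exI[of _ "3 / a"] conjI ballI impI) auto
qed

text \<open>An element near the identity is a single exponential, and a word of one letter bounds
  the infimum.\<close>

lemma el_upper: "\<exists>K>0. \<forall>g\<in>U. norm (lam g) < r / 16 \<longrightarrow> el g \<le> K * norm (lam g)"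
proof -
  obtain b where b: "b > 0" "\<And>v. chart_norm v \<le> b * norm v" using chart_norm_bounds by blast
  have "el g \<le> (2 * b) * norm (lam g)" if g: "g \<in> U" "norm (lam g) < r / 16" for g
  proof -
    obtain v where v: "norm v \<le> 2 * norm (lam g)" "q (lam g) = expo v" using expo_small_surj[OF g(2)] by blast
    have "el g \<le> chart_norm v" using el_le[of "[v]"] v(2) q_lam[OF g(1)] by (simp add: expo_carrier)
    also have "\<dots> \<le> b * norm v" by (rule b)
    also have "\<dots> \<le> b * (2 * norm (lam g))" using v(1) b(1) by (intro mult_left_mono) auto
    finally show ?thesis by simp
  qed
  then show ?thesis using b(1) by (intro exI[of _ "2 * b"]) auto
qed

lemma el_length_function: "length_function G el"
proof -
  have "g = \<one>" if g: "g \<in> carrier G" "el g = 0" for g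
  proof -
    obtain \<eta> K where K: "\<eta> > 0" "K > 0" "\<And>g. g \<in> carrier G \<Longrightarrow> el g < \<eta> \<Longrightarrow> g \<in> U \<and> norm (lam g) \<le> K * el g"
      using el_lower by blast
    then have "g \<in> U" "lam g = 0" using K(3)[OF g(1)] g by auto
    then show ?thesis using q_lam q_zero by metis
  qed
  then show ?thesis
    unfolding length_function_def using el_nonneg el_one el_inv el_mult by auto
qed

section \<open>The metric and its topology\<close>

definition el_dist where "el_dist = length_dist G el"

lemma el_dist_eq: "g \<in> carrier G \<Longrightarrow> h \<in> carrier G \<Longrightarrow> el_dist g h = el (inv g \<otimes> h)"
  by (simp add: el_dist_def length_dist_def restrict_dist_def)

lemma el_dist_metric: "Metric_space (carrier G) el_dist"
proof
  show "0 \<le> el_dist g h" for g h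
    using el_nonneg by (simp add: el_dist_def length_dist_def restrict_dist_def)
  show "el_dist g h = el_dist h g" for g h
  proof (cases "g \<in> carrier G \<and> h \<in> carrier G")
    case True
    then have "inv (inv g \<otimes> h) = inv h \<otimes> g" by (simp add: inv_mult_group)
    then show ?thesis using True el_inv[of "inv g \<otimes> h"] by (simp add: el_dist_eq)
  qed (auto simp: el_dist_def length_dist_def restrict_dist_def)
  show "el_dist g h = 0 \<longleftrightarrow> g = h" if "g \<in> carrier G" "h \<in> carrier G" for g h
  proof -
    have "el (inv g \<otimes> h) = 0 \<longleftrightarrow> inv g \<otimes> h = \<one>"
      using el_length_function that unfolding length_function_def by simp
    also have "\<dots> \<longleftrightarrow> g = h" using that by (metis inv_solve_left' r_one one_closed)
    finally show ?thesis using that by (simp add: el_dist_eq)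
  qed
  show "el_dist g k \<le> el_dist g h + el_dist h k" if "g \<in> carrier G" "h \<in> carrier G" "k \<in> carrier G" for g h k
  proof -
    have "h \<otimes> (inv h \<otimes> k) = k" using that by (simp flip: m_assoc)
    then have "(inv g \<otimes> h) \<otimes> (inv h \<otimes> k) = inv g \<otimes> k" using that by (simp add: m_assoc)
    then show ?thesis using el_mult[of "inv g \<otimes> h" "inv h \<otimes> k"] that by (simp add: el_dist_eq)
  qed
qed

sublocale EM: Metric_space "carrier G" el_dist by (rule el_dist_metric)

text \<open>Left translation moves both neighbourhood conditions to the identity, where
  \<open>el_upper\<close> makes small coordinates short and \<open>el_lower\<close> gives short
  elements small coordinates.\<close>

lemma el_dist_topology: "EM.mtopology = T"
proof (rule topology_eq[THEN iffD2], intro allI iffI)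
  obtain \<eta> K where K: "\<eta> > 0" "K > 0" "\<And>g. g \<in> carrier G \<Longrightarrow> el g < \<eta> \<Longrightarrow> g \<in> U \<and> norm (lam g) \<le> K * el g"
    using el_lower by blast
  obtain L where L: "L > 0" "\<And>g. g \<in> U \<Longrightarrow> norm (lam g) < r / 16 \<Longrightarrow> el g \<le> L * norm (lam g)"
    using el_upper by blast
  fix S
  show "openin T S" if S: "openin EM.mtopology S"
  proof (rule openin_subopen[THEN iffD2], intro ballI)
    fix x assume x: "x \<in> S"
    obtain \<delta> where dl: "\<delta> > 0" "EM.mball x \<delta> \<subseteq> S" using S x unfolding EM.openin_mtopology by blast
    have xc: "x \<in> carrier G" using S x unfolding EM.openin_mtopology by blast
    define \<epsilon> where "\<epsilon> = min (r / 16) (\<delta> / L)"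
    have e0: "\<epsilon> > 0" using dl L r_pos by (simp add: \<epsilon>_def)
    let ?W = "{y \<in> carrier G. inv x \<otimes> y \<in> {g \<in> U. norm (lam g) < \<epsilon>}}"
    have "openin T ?W" by (rule openin_left_translate[OF openin_small]) (use xc in simp)
    moreover have "x \<in> ?W" using xc one_in_U lam_one e0 by simp
    moreover have "?W \<subseteq> S"
    proof
      fix y assume y: "y \<in> ?W"
      then have "el (inv x \<otimes> y) \<le> L * norm (lam (inv x \<otimes> y))" by (intro L(2)) (auto simp: \<epsilon>_def)
      also have "\<dots> < L * (\<delta> / L)" using y L(1) by (intro mult_strict_left_mono) (auto simp: \<epsilon>_def)
      finally have "y \<in> EM.mball x \<delta>" using y xc L(1) by (simp add: el_dist_eq)
      then show "y \<in> S" using dl by blast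
    qed
    ultimately show "\<exists>W. openin T W \<and> x \<in> W \<and> W \<subseteq> S" by blast
  qed
  show "openin EM.mtopology S" if S: "openin T S"
    unfolding EM.openin_mtopology
  proof (intro conjI allI impI)
    show Sc: "S \<subseteq> carrier G" using openin_subset[OF S] topspace_carrier by simp
    fix x assume x: "x \<in> S"
    then have xc: "x \<in> carrier G" using Sc by blast
    have "openin T {h \<in> carrier G. x \<otimes> h \<in> S}" by (rule openin_left_translate[OF S xc])
    moreover have "\<one> \<in> {h \<in> carrier G. x \<otimes> h \<in> S}" using x xc by simp
    ultimately obtain \<epsilon> where e: "\<epsilon> > 0" "\<And>y. norm y < \<epsilon> \<Longrightarrow> x \<otimes> q y \<in> S"
      using small_nhds[of "{h \<in> carrier G. x \<otimes> h \<in> S}"] by auto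
    show "\<exists>\<delta>>0. EM.mball x \<delta> \<subseteq> S"
    proof (intro exI conjI subsetI)
      show "min \<eta> (\<epsilon> / K) > 0" using K e by simp
      fix y assume y: "y \<in> EM.mball x (min \<eta> (\<epsilon> / K))"
      then have yc: "y \<in> carrier G" and lt: "el (inv x \<otimes> y) < \<eta>" "el (inv x \<otimes> y) < \<epsilon> / K"
        using xc by (auto simp: el_dist_eq)
      have "inv x \<otimes> y \<in> U" "norm (lam (inv x \<otimes> y)) \<le> K * el (inv x \<otimes> y)"
        using K(3)[OF _ lt(1)] xc yc by auto
      moreover have "K * el (inv x \<otimes> y) < \<epsilon>" using lt(2) K(2) by (simp add: field_simps)
      ultimately have "x \<otimes> (inv x \<otimes> y) \<in> S" using e(2)[of "lam (inv x \<otimes> y)"] q_lam by simp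
      then show "y \<in> S" using xc yc by (simp flip: m_assoc)
    qed
  qed
qed

lemma el_dist_compatible: "compatible_metric G T el_dist"
  unfolding compatible_metric_def using el_dist_metric el_dist_topology by blast

lemma el_dist_left_invariant: "left_invariant G el_dist"
  unfolding left_invariant_def
proof (intro ballI)
  fix k g h assume c: "k \<in> carrier G" "g \<in> carrier G" "h \<in> carrier G"
  have "inv k \<otimes> (k \<otimes> h) = h" using c by (simp flip: m_assoc)
  then have "inv (k \<otimes> g) \<otimes> (k \<otimes> h) = inv g \<otimes> h"
    using c by (simp add: inv_mult_group m_assoc)
  then show "el_dist (k \<otimes> g) (k \<otimes> h) = el_dist g h" using c by (simp add: el_dist_eq)
qed

lemma el_dist_continuous: "el_dist \<in> cont_left_inv_pseudometrics G T"
proof -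
  have "pseudometric_on (carrier G) el_dist"
    unfolding pseudometric_on_def using EM.commute EM.triangle by auto
  moreover have "continuous_map (prod_topology T T) euclideanreal (\<lambda>(g, h). el_dist g h)"
  proof -
    have "mtopology_of EM.Self = T" by (simp add: mtopology_of_def el_dist_topology)
    then show ?thesis using continuous_map_mdist_alt[of "prod_topology T T" EM.Self "\<lambda>x. x"] by simp
  qed
  ultimately show ?thesis using el_dist_left_invariant by (simp add: cont_left_inv_pseudometrics_def)
qed

section \<open>Maximality and minimality\<close>

text \<open>When the cut falls inside a letter, that letter is divided along its own one-parameter
  subgroup, where the norm is additive.\<close>

lemma prodexp_split:
  assumes "(\<Sum>v\<leftarrow>vs. chart_norm v) \<le> a + b" "a \<ge> 0" "b \<ge> 0"
  shows "\<exists>ys zs. prodexp vs = prodexp ys \<otimes> prodexp zs \<and> (\<Sum>v\<leftarrow>ys. chart_norm v) \<le> a \<and> (\<Sum>v\<leftarrow>zs. chart_norm v) \<le> b"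
  using assms
proof (induction vs arbitrary: a)
  case Nil
  then show ?case by (intro exI[of _ "[]"]) simp
next
  case (Cons v vs)
  show ?case
  proof (cases "chart_norm v \<le> a")
    case True
    then obtain ys zs where "prodexp vs = prodexp ys \<otimes> prodexp zs" "(\<Sum>v\<leftarrow>ys. chart_norm v) \<le> a - chart_norm v" "(\<Sum>v\<leftarrow>zs. chart_norm v) \<le> b"
      using Cons.IH[of "a - chart_norm v"] Cons.prems by auto
    then show ?thesis by (intro exI[of _ "v # ys"] exI[of _ zs]) (simp add: expo_carrier m_assoc)
  next
    case False
    define t where "t = a / chart_norm v"
    have nv: "chart_norm v > 0" using False Cons.prems by linarith
    have t: "0 \<le> t" "t \<le> 1" "t * chart_norm v = a" using False Cons.prems nv by (auto simp: t_def)
    have "expo (t *\<^sub>R v) \<otimes> expo ((1 - t) *\<^sub>R v) = expo v" using expo_add[of t v "1 - t"] by simp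
    moreover have "chart_norm (t *\<^sub>R v) = a" using t by (simp add: chart_norm_scale)
    moreover have "chart_norm ((1 - t) *\<^sub>R v) = chart_norm v - a" unfolding chart_norm_scale using t by (simp add: left_diff_distrib)
    ultimately show ?thesis using Cons.prems
      by (intro exI[of _ "[t *\<^sub>R v]"] exI[of _ "(1 - t) *\<^sub>R v # vs"]) (simp add: expo_carrier flip: m_assoc)
  qed
qed

lemma el_dist_dominates:
  assumes p: "p \<in> cont_left_inv_pseudometrics G T"
  shows "coarsely_dominated G p el_dist"
proof -
  have ps: "pseudometric_on (carrier G) p" and li: "left_invariant G p"
    and pc: "continuous_map (prod_topology T T) euclideanreal (\<lambda>(g, h). p g h)"
    using p by (auto simp: cont_left_inv_pseudometrics_def)
  have "continuous_map T (prod_topology T T) (\<lambda>g. (\<one>, g))"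
    using topspace_carrier by (intro continuous_map_pairedI) auto
  from continuous_map_compose[OF this pc] have "continuous_map T euclideanreal (\<lambda>g. p \<one> g)" by (simp add: o_def)
  then have "openin T {g \<in> topspace T. p \<one> g \<in> {..<1}}"
    by (rule openin_continuous_map_preimage) simp
  then have "openin EM.mtopology {g \<in> carrier G. p \<one> g < 1}" using topspace_carrier el_dist_topology by simp
  moreover have "\<one> \<in> {g \<in> carrier G. p \<one> g < 1}" using ps by (simp add: pseudometric_on_def)
  ultimately obtain \<delta> where dl: "\<delta> > 0" "EM.mball \<one> \<delta> \<subseteq> {g \<in> carrier G. p \<one> g < 1}"
    unfolding EM.openin_mtopology by blast
  \<comment> \<open>Half the radius: a piece of mass at most \<open>s\<close> then lies strictly
    inside the ball on which \<open>p\<close> is below 1.\<close>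
  define s where "s = \<delta> / 2"
  have s0: "s > 0" using dl by (simp add: s_def)
  have chunk: "p \<one> (prodexp vs) \<le> 1" if "(\<Sum>v\<leftarrow>vs. chart_norm v) \<le> s" for vs
  proof -
    have "el_dist \<one> (prodexp vs) \<le> s" using el_le[of vs] that by (simp add: el_dist_eq)
    then have "prodexp vs \<in> EM.mball \<one> \<delta>" using dl by (simp add: s_def)
    then have "prodexp vs \<in> {g \<in> carrier G. p \<one> g < 1}" by (rule subsetD[OF dl(2)])
    then show ?thesis by simp
  qed
  have chunks: "p \<one> (prodexp vs) \<le> real (Suc n)" if "(\<Sum>v\<leftarrow>vs. chart_norm v) \<le> real (Suc n) * s" for n vs
    using that
  proof (induction n arbitrary: vs)
    case 0
    then show ?case using chunk by simp
  next
    case (Suc n)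
    have "(\<Sum>v\<leftarrow>vs. chart_norm v) \<le> real (Suc n) * s + s" using Suc.prems by (simp add: algebra_simps)
    then obtain ys zs where yz: "prodexp vs = prodexp ys \<otimes> prodexp zs"
        "(\<Sum>v\<leftarrow>ys. chart_norm v) \<le> real (Suc n) * s" "(\<Sum>v\<leftarrow>zs. chart_norm v) \<le> s"
      using prodexp_split[of vs "real (Suc n) * s" s] s0 by auto
    have "p \<one> (prodexp vs) \<le> p \<one> (prodexp ys) + p (prodexp ys) (prodexp ys \<otimes> prodexp zs)"
      unfolding yz using ps unfolding pseudometric_on_def by simp
    also have "p (prodexp ys) (prodexp ys \<otimes> prodexp zs) = p \<one> (prodexp zs)"
      using li unfolding left_invariant_def by (metis one_closed prodexp_carrier r_one)
    finally show ?case using Suc.IH[OF yz(2)] chunk[OF yz(3)] by simp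
  qed
  have "p g h \<le> 1 / s * el_dist g h + (1 / s + 2)" if gh: "g \<in> carrier G" "h \<in> carrier G" for g h
  proof -
    define k where "k = inv g \<otimes> h"
    have k: "k \<in> carrier G" using gh by (simp add: k_def)
    have "g \<otimes> k = h" unfolding k_def using gh by (simp flip: m_assoc)
    then have pk: "p g h = p \<one> k" using li gh k unfolding left_invariant_def by (metis one_closed r_one)
    \<comment> \<open>The slack 1 allows for an infimum that is not attained and costs
      \<open>1 / s\<close>; rounding up to full pieces costs at most 1. Both go into the additive
      constant.\<close>
    obtain vs where vs: "k = prodexp vs" "(\<Sum>v\<leftarrow>vs. chart_norm v) < el k + 1" using el_less[OF k, of "el k + 1"] by auto
    define n where "n = nat \<lfloor>(\<Sum>v\<leftarrow>vs. chart_norm v) / s\<rfloor>"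
    have q0: "0 \<le> (\<Sum>v\<leftarrow>vs. chart_norm v) / s" using sum_chart_norm_nonneg s0 by simp
    have "(\<Sum>v\<leftarrow>vs. chart_norm v) / s \<le> real (Suc n)" unfolding n_def by linarith
    then have "(\<Sum>v\<leftarrow>vs. chart_norm v) \<le> real (Suc n) * s" using s0 by (simp add: field_simps)
    then have "p \<one> k \<le> real (Suc n)" using chunks vs by simp
    also have "real (Suc n) \<le> (\<Sum>v\<leftarrow>vs. chart_norm v) / s + 1" using q0 unfolding n_def by simp
    also have "\<dots> \<le> (el k + 1) / s + 1" using vs s0 by (simp add: divide_right_mono)
    also have "\<dots> \<le> 1 / s * el_dist g h + (1 / s + 2)" using gh by (simp add: el_dist_eq k_def add_divide_distrib)
    finally show ?thesis using pk by simp
  qed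
  then show ?thesis unfolding coarsely_dominated_def
    using s0 by (intro exI[of _ "1 / s"] exI[of _ "1 / s + 2"] conjI ballI) (auto simp: add_pos_pos)
qed

lemma el_dist_maximal: "maximal_pseudometric G T el_dist"
  unfolding maximal_pseudometric_def using el_dist_continuous el_dist_dominates by blast

text \<open>An element close to the identity has a power at distance comparable to 1 from the identity,
  and the size of the exponent is inversely proportional to its coordinate.\<close>

lemma el_dist_minimal: "minimal_metric G T el_dist"
  unfolding minimal_metric_def
proof (intro conjI el_dist_left_invariant el_dist_compatible allI impI)
  fix \<rho> assume \<rho>: "left_invariant G \<rho> \<and> compatible_metric G T \<rho>"
  interpret RM: Metric_space "carrier G" \<rho> using \<rho> by (simp add: compatible_metric_def)
  have RT: "RM.mtopology = T" using \<rho> by (simp add: compatible_metric_def)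
  have li: "\<rho> (k \<otimes> g) (k \<otimes> h) = \<rho> g h" if "k \<in> carrier G" "g \<in> carrier G" "h \<in> carrier G" for k g h
    using \<rho> that by (simp add: left_invariant_def)
  obtain \<eta> K where K: "\<eta> > 0" "K > 0" "\<And>g. g \<in> carrier G \<Longrightarrow> el g < \<eta> \<Longrightarrow> g \<in> U \<and> norm (lam g) \<le> K * el g"
    using el_lower by blast
  obtain L where L: "L > 0" "\<And>g. g \<in> U \<Longrightarrow> norm (lam g) < r / 16 \<Longrightarrow> el g \<le> L * norm (lam g)"
    using el_upper by blast
  have "openin RM.mtopology {g \<in> U. norm (lam g) < r / 4}" unfolding RT by (rule openin_small)
  moreover have "\<one> \<in> {g \<in> U. norm (lam g) < r / 4}" using one_in_U lam_one r_pos by simp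
  ultimately obtain \<delta> where dl: "\<delta> > 0" "RM.mball \<one> \<delta> \<subseteq> {g \<in> U. norm (lam g) < r / 4}"
    unfolding RM.openin_mtopology by blast
  have pow: "\<rho> \<one> (g [^] n) \<le> real n * \<rho> \<one> g" if g: "g \<in> carrier G" for g and n :: nat
  proof (induction n)
    case (Suc n)
    have "\<rho> \<one> (g [^] Suc n) \<le> \<rho> \<one> (g [^] n) + \<rho> (g [^] n) (g [^] n \<otimes> g)"
      using RM.triangle[of \<one> "g [^] n" "g [^] n \<otimes> g"] g by simp
    also have "\<rho> (g [^] n) (g [^] n \<otimes> g) = \<rho> \<one> g" using li[of "g [^] n" \<one> g] g by simp
    finally show ?case using Suc by (simp add: algebra_simps)
  qed simp
  have key: "el g \<le> L * (r / \<delta>) * \<rho> \<one> g" if g: "g \<in> U" "norm (lam g) < r / 16" for g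
  proof (cases "lam g = 0")
    case True
    then have "g = \<one>" using q_lam[OF g(1)] q_zero by simp
    then show ?thesis using el_one by simp
  next
    case False
    define x where "x = lam g"
    have x0: "norm x > 0" using False by (simp add: x_def)
    have gc: "g \<in> carrier G" using g U_carrier by blast
    \<comment> \<open>The largest exponent with \<open>n * norm x \<le> r\<close>. Since
      \<open>norm x < r / 16\<close>, the product stays above \<open>r / 2\<close>, so the
      \<open>n\<close>-th power has coordinate norm at least \<open>r / 4\<close> and has left the
      \<open>\<rho>\<close>-ball of radius \<open>\<delta>\<close>.\<close>
    define n where "n = nat \<lfloor>r / norm x\<rfloor>"
    have q0: "0 \<le> r / norm x" using r_pos by simp
    have n1: "real n \<le> r / norm x" "r / norm x < real n + 1" unfolding n_def using q0 by linarith+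
    have n2: "real n * norm x \<le> r" "r < real n * norm x + norm x"
      using n1 x0 by (simp_all add: field_simps)
    have n0: "real n > 0"
    proof (rule ccontr)
      assume "\<not> real n > 0"
      then show False using n2(2) g(2) r_pos by (simp add: x_def)
    qed
    have "q x [^] n \<in> U" "norm (coord_power n x) \<ge> real n * norm x / 2" using q_pow[OF n2(1)] norm_coord_power_ge[OF n2(1)] by auto
    moreover have "real n * norm x / 2 \<ge> r / 4" using n2(2) g(2) r_pos by (simp add: x_def)
    ultimately have "\<not> norm (lam (g [^] n)) < r / 4" using q_lam[OF g(1)] by (simp add: coord_power_def x_def)
    then have "g [^] n \<notin> RM.mball \<one> \<delta>" using dl by blast
    then have "\<delta> \<le> \<rho> \<one> (g [^] n)" using gc by simp
    also have "\<dots> \<le> real n * \<rho> \<one> g" by (rule pow[OF gc])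
    also have "\<dots> \<le> r / norm x * \<rho> \<one> g" using n1 by (intro mult_right_mono) auto
    finally have "norm x \<le> (r / \<delta>) * \<rho> \<one> g" using x0 dl by (simp add: field_simps)
    then have "L * norm x \<le> L * ((r / \<delta>) * \<rho> \<one> g)" using L(1) by (intro mult_left_mono) auto
    then show ?thesis using L(2)[OF g] by (simp add: x_def mult.assoc)
  qed
  \<comment> \<open>Halved because two points of the ball may be \<open>2 * \<epsilon>\<close>
    apart; \<open>inv g * h\<close> then satisfies the bounds needed for \<open>el_lower\<close> and
    for \<open>key\<close>.\<close>
  define \<epsilon> where "\<epsilon> = min \<eta> (r / 16 / K) / 2"
  have e0: "\<epsilon> > 0" using K r_pos by (simp add: \<epsilon>_def)
  show "\<exists>W K. openin T W \<and> \<one> \<in> W \<and> (\<forall>g\<in>W. \<forall>h\<in>W. el_dist g h \<le> K * \<rho> g h)"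
  proof (intro exI conjI ballI)
    show "openin T (EM.mball \<one> \<epsilon>)" using EM.openin_mball[of \<one> \<epsilon>] el_dist_topology by simp
    show "\<one> \<in> EM.mball \<one> \<epsilon>" using e0 by simp
    fix g h assume gh: "g \<in> EM.mball \<one> \<epsilon>" "h \<in> EM.mball \<one> \<epsilon>"
    then have c: "g \<in> carrier G" "h \<in> carrier G" by auto
    have "el_dist g h < 2 * \<epsilon>" using EM.triangle[of g \<one> h] EM.commute[of g \<one>] gh by simp
    then have lt: "el (inv g \<otimes> h) < \<eta>" "el (inv g \<otimes> h) < r / 16 / K" using c by (simp_all add: el_dist_eq \<epsilon>_def)
    have 1: "inv g \<otimes> h \<in> U" "norm (lam (inv g \<otimes> h)) \<le> K * el (inv g \<otimes> h)" using K(3)[OF _ lt(1)] c by auto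
    have "K * el (inv g \<otimes> h) < r / 16" using lt(2) K(2) by (simp add: field_simps)
    then have "el (inv g \<otimes> h) \<le> L * (r / \<delta>) * \<rho> \<one> (inv g \<otimes> h)" using 1 by (intro key) auto
    moreover have "\<rho> \<one> (inv g \<otimes> h) = \<rho> g h"
      using li[of g \<one> "inv g \<otimes> h"] c by (simp flip: m_assoc)
    ultimately show "el_dist g h \<le> L * (r / \<delta>) * \<rho> g h" using c by (simp add: el_dist_eq)
  qed
qed

end

theorem theoremA:
  fixes G :: "('g, 'm) monoid_scheme"
    and T :: "'g topology"
    and A :: "('g, 'e::banach) chart set"
    and N :: "(('g, 'e) chart \<Rightarrow> 'e) \<Rightarrow> real"
  assumes "banach_lie_group G T A"
    and "connected_space T"
    and "compatible_norm A \<one>\<^bsub>G\<^esub> N"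
  shows "compatible_length_function G T (exp_length G T A N) \<and>
    maximal_pseudometric G T (length_dist G (exp_length G T A N)) \<and>
    minimal_metric G T (length_dist G (exp_length G T A N)) \<and>
    global_lipschitz_structure G T (length_dist G (exp_length G T A N))"
proof -
  interpret banach_lie_group G T A by (rule assms(1))
  have "\<one>\<^bsub>G\<^esub> \<in> (\<Union>(U, \<phi>)\<in>A. U)"
    using charts_cover topspace_carrier by simp
  then obtain U \<phi> where "(U, \<phi>) \<in> A" "\<one>\<^bsub>G\<^esub> \<in> U" by blast
  then obtain R C where
    "lie_chart G T A U (\<lambda>g. \<phi> g - \<phi> \<one>\<^bsub>G\<^esub>) (\<lambda>x. inv_into U \<phi> (x + \<phi> \<one>\<^bsub>G\<^esub>)) R C \<phi>"
    using lie_chart_exists by blast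
  then interpret normed_lie_chart G T A U "\<lambda>g. \<phi> g - \<phi> \<one>\<^bsub>G\<^esub>" "\<lambda>x. inv_into U \<phi> (x + \<phi> \<one>\<^bsub>G\<^esub>)" R C \<phi> N
    by (intro normed_lie_chart.intro normed_lie_chart_axioms.intro assms(2,3))
  have "compatible_length_function G T el"
    unfolding compatible_length_function_def
    using el_length_function el_dist_compatible by (simp add: el_dist_def)
  moreover have "global_lipschitz_structure G T el_dist"
    unfolding global_lipschitz_structure_def
    using el_dist_left_invariant el_dist_compatible el_dist_maximal el_dist_minimal by blast
  ultimately show ?thesis
    using el_dist_maximal el_dist_minimal unfolding el_dist_def el_def by blast
qed

end
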